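(* Let $N$ be a positive integer and let $p\ge q>\frac13$ with $p>\frac{q+1}{3q-1}$. Let $z_0$ be the largest root of the polynomial $$G(x)=x^4-\frac{4pq(q+1)}{p+1}x^2+\frac{2pq(q+1)(p+q+2)}{(p+1)^2}x-\frac{pq(q+1)^2}{(p+1)^2},$$ and assume $N<2\alpha z_0+2$. Then the system $-\Delta u=|v|^{p-1}v$, $-\Delta v=|u|^{q-1}u$ in $\mathbb{R}^N$ admits no positive solution $(u,v)\in(C^2(\mathbb{R}^N))^2$ that is stable in every bounded open subset of $\mathbb{R}^N$.
   Context: $\alpha=\frac{2(p+1)}{pq-1}$ (the assumptions on $p,q$ imply $pq>1$). A positive solution ($u>0$, $v>0$) is called stable in an open set $\Omega$ if there exist $\xi,\zeta\in C^2(\Omega)$ with $\xi,\zeta>0$ such that $-\Delta\xi\ge pv^{p-1}\zeta$ and $-\Delta\zeta\ge qu^{q-1}\xi$ a.e. in $\Omega$. *)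

theory Defs
  imports "HOL-Analysis.Analysis" "HOL-Computational_Algebra.Polynomial"
begin

definition partial_deriv :: "'a::euclidean_space \<Rightarrow> ('a \<Rightarrow> real) \<Rightarrow> 'a \<Rightarrow> real"
  where "partial_deriv b f x = deriv (\<lambda>t. f (x + t *\<^sub>R b)) 0"

definition has_partial_deriv_at :: "'a::euclidean_space \<Rightarrow> ('a \<Rightarrow> real) \<Rightarrow> 'a \<Rightarrow> bool"
  where "has_partial_deriv_at b f x \<longleftrightarrow> (\<lambda>t. f (x + t *\<^sub>R b)) field_differentiable at 0"

text \<open>Intended for open \<open>S\<close> only: the partial derivatives at a point of \<open>S\<close> then depend
  only on the values of \<open>f\<close> on \<open>S\<close>.\<close>

definition C2_on :: "'a::euclidean_space set \<Rightarrow> ('a \<Rightarrow> real) \<Rightarrow> bool"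
  where "C2_on S f \<longleftrightarrow>
    continuous_on S f \<and>
    (\<forall>i\<in>Basis.
       (\<forall>x\<in>S. has_partial_deriv_at i f x) \<and>
       continuous_on S (partial_deriv i f) \<and>
       (\<forall>j\<in>Basis.
          (\<forall>x\<in>S. has_partial_deriv_at j (partial_deriv i f) x) \<and>
          continuous_on S (partial_deriv j (partial_deriv i f))))"

definition laplacian :: "('a::euclidean_space \<Rightarrow> real) \<Rightarrow> 'a \<Rightarrow> real"
  where "laplacian f x = (\<Sum>i\<in>Basis. partial_deriv i (partial_deriv i f) x)"

definition positive_solution ::
  "real \<Rightarrow> real \<Rightarrow> ('a::euclidean_space \<Rightarrow> real) \<Rightarrow> ('a \<Rightarrow> real) \<Rightarrow> bool"
  where "positive_solution p q u v \<longleftrightarrow>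
    C2_on UNIV u \<and> C2_on UNIV v \<and>
    (\<forall>x. u x > 0 \<and> v x > 0) \<and>
    (\<forall>x. - laplacian u x = \<bar>v x\<bar> powr (p - 1) * v x \<and>
         - laplacian v x = \<bar>u x\<bar> powr (q - 1) * u x)"

definition stable_in ::
  "real \<Rightarrow> real \<Rightarrow> ('a::euclidean_space \<Rightarrow> real) \<Rightarrow> ('a \<Rightarrow> real) \<Rightarrow> 'a set \<Rightarrow> bool"
  where "stable_in p q u v \<Omega> \<longleftrightarrow>
    (\<exists>\<xi> \<zeta>. C2_on \<Omega> \<xi> \<and> C2_on \<Omega> \<zeta> \<and>
       (\<forall>x\<in>\<Omega>. \<xi> x > 0 \<and> \<zeta> x > 0) \<and>
       (AE x\<in>\<Omega> in lebesgue. - laplacian \<xi> x \<ge> p * v x powr (p - 1) * \<zeta> x) \<and>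
       (AE x\<in>\<Omega> in lebesgue. - laplacian \<zeta> x \<ge> q * u x powr (q - 1) * \<xi> x))"

definition alpha :: "real \<Rightarrow> real \<Rightarrow> real"
  where "alpha p q = 2 * (p + 1) / (p * q - 1)"

definition G_poly :: "real \<Rightarrow> real \<Rightarrow> real poly"
  where "G_poly p q =
    monom 1 4
    - monom (4 * p * q * (q + 1) / (p + 1)) 2
    + monom (2 * p * q * (q + 1) * (p + q + 2) / (p + 1)\<^sup>2) 1
    - monom (p * q * (q + 1)\<^sup>2 / (p + 1)\<^sup>2) 0"

end

theory Submission
  imports Defs
begin

text \<open>Write \<open>N\<close> for the dimension, \<open>m = (p + 1) / (q + 1)\<close> and \<open>\<alpha> = 2 (p + 1) / (p q - 1)\<close>. The proof
bounds, for one suitable exponent \<open>X\<close> and a cut-off function \<open>\<phi>\<close> of the ball of radius \<open>R\<close>, the reaction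
integral \<open>T(R) = \<integral> v\<^sup>p u\<^bsup>X-1\<^esup> \<phi>\<^bsup>2k\<^esup>\<close> by a constant times \<open>R\<^bsup>N-2-\<alpha>X\<^esup>\<close>. If \<open>N < 2 + \<alpha>X\<close>, the bound tends to
\<open>0\<close> as \<open>R \<rightarrow> \<infinity>\<close>, although \<open>T(R)\<close> stays above a positive constant. Three inequalities produce it.

\<^item> Comparison (\<open>comparison\<close>): \<open>v \<le> const u\<^bsup>1/m\<^esup>\<close>. The defect \<open>w = v - const u\<^bsup>1/m\<^esup>\<close> is subharmonic where
  it is positive, so the positive part of \<open>w\<close> lies below its means, which lie below the means of \<open>v\<close>. Those
  become arbitrarily small on large balls (\<open>ex_small_wmean\<close>): by the mean value inequality for superharmonic
  functions, the mean of each component over a ball bounds that component from below on the ball, the right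
  hand sides are then bounded below too, and the two resulting inequalities between the means of \<open>u\<close> and \<open>v\<close>
  are incompatible with a lower bound for the means of \<open>v\<close> when \<open>p q > 1\<close>.

\<^item> Stability (\<open>reaction_estimate\<close>): stability gives
  \<open>\<surd>(p q) \<integral> u\<^bsup>(q-1)/2\<^esup> v\<^bsup>(p-1)/2\<^esup> f\<^sup>2 \<le> \<integral> \<bar>\<nabla>f\<bar>\<^sup>2\<close> for test functions \<open>f\<close>. Taking \<open>f = u\<^bsup>X/2\<^esup> \<phi>\<^sup>k\<close> and
  \<open>f = v\<^bsup>mX/2\<^esup> \<phi>\<^sup>k\<close> and using the equations, the gradient terms become reaction integrals with the factors
  \<open>A = X\<^sup>2 / (4 (X - 1))\<close> and \<open>B = (m X)\<^sup>2 / (4 (m X - 1))\<close>, up to cut-off errors. Young's inequality closes the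
  system as soon as \<open>A B < p q\<close>, which is the condition that the polynomial \<open>G_poly p q\<close> is negative at \<open>X / 2\<close>.
  The result is \<open>T(R) \<le> C R\<^sup>-\<^sup>2 \<integral> u\<^sup>X \<phi>\<^bsup>2k-2\<^esup>\<close>.

\<^item> Return (\<open>power_estimate\<close>, \<open>reaction_decay\<close>): testing \<open>- \<Delta>v = u\<^sup>q\<close> with \<open>u\<^bsup>X-q\<^esup> \<phi>\<^bsup>2k-2\<^esup>\<close> and inserting the
  comparison bounds \<open>R\<^sup>-\<^sup>2 \<integral> u\<^sup>X \<phi>\<^bsup>2k-2\<^esup>\<close> by \<open>\<epsilon> T(R) + C R\<^bsup>N-2-\<alpha>X\<^esup>\<close>, for every \<open>\<epsilon> > 0\<close>. The reason is that
  \<open>v / u\<^sup>q\<close> is small where \<open>u\<close> is large, because \<open>1 / m < q\<close>; this needs \<open>X > q + 1\<close>.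

It remains to find \<open>X\<close> with \<open>X > q + 1\<close>, \<open>A B < p q\<close> and \<open>N < 2 + \<alpha>X\<close>. The hypothesis
\<open>p > (q + 1) / (3 q - 1)\<close> says exactly that \<open>A B < p q\<close> holds at \<open>X = q + 1\<close>, and equality holds at twice the
largest root. In the variable \<open>1 / X\<close> the quantity \<open>1 / (A B)\<close> is log-concave, so the strict inequality
persists up to \<open>2 z\<^sub>0\<close> (\<open>admissible_exponent\<close>), and any \<open>X\<close> close enough to \<open>2 z\<^sub>0\<close> will do.\<close>

section \<open>Partial derivatives and the divergence theorem for compactly supported fields\<close>

text \<open>Derivatives along single coordinate directions suffice, because every integration by parts below is a sum of
one-dimensional ones.\<close>

definition has_slope :: "'a::euclidean_space \<Rightarrow> ('a \<Rightarrow> real) \<Rightarrow> real \<Rightarrow> 'a \<Rightarrow> bool"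
  where "has_slope b f d x \<longleftrightarrow> ((\<lambda>t. f (x + t *\<^sub>R b)) has_real_derivative d) (at 0)"

definition cube :: "'a::euclidean_space \<Rightarrow> real \<Rightarrow> 'a set"
  where "cube c R = cbox (c - R *\<^sub>R One) (c + R *\<^sub>R One)"

text \<open>Powers of this truncated paraboloid serve as cut-off functions. Differentiating \<open>bump c R ^ n\<close> once or twice
costs one or two factors of the bump and one or two factors \<open>1 / R\<close>, so every error term is again a power of
the bump times a power of \<open>R\<close>.\<close>

definition bump :: "'a::euclidean_space \<Rightarrow> real \<Rightarrow> 'a \<Rightarrow> real"
  where "bump c R z = max 0 (1 - (norm (z - c))\<^sup>2 / R\<^sup>2)"

lemma bump_nonneg [simp]: "0 \<le> bump c R z"
  by (simp add: bump_def)

lemma bump_le_1: "bump c R z \<le> 1"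
  by (simp add: bump_def)

lemma bump_eq_0: "R > 0 \<Longrightarrow> z \<notin> cball c R \<Longrightarrow> bump c R z = 0"
  by (auto simp: bump_def dist_norm norm_minus_commute divide_simps power_mono)

lemma bump_pos_norm: "R > 0 \<Longrightarrow> bump c R z \<noteq> 0 \<Longrightarrow> (norm (z - c))\<^sup>2 = R\<^sup>2 * (1 - bump c R z)"
  by (auto simp: bump_def max_def divide_simps split: if_splits)

lemma continuous_bump [continuous_intros]:
  "continuous_on S f \<Longrightarrow> continuous_on S (\<lambda>z. bump c R (f z))"
  unfolding bump_def divide_inverse by (intro continuous_intros)

lemma mem_cube: "x \<in> cube c R \<longleftrightarrow> (\<forall>i\<in>Basis. \<bar>(x - c) \<bullet> i\<bar> \<le> R)"
proof -
  have "(c - R *\<^sub>R One) \<bullet> i \<le> x \<bullet> i \<and> x \<bullet> i \<le> (c + R *\<^sub>R One) \<bullet> i \<longleftrightarrow> \<bar>(x - c) \<bullet> i\<bar> \<le> R"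
    if "i \<in> Basis" for i
    using that by (simp add: inner_diff_left inner_add_left) arith
  then show ?thesis by (simp add: cube_def mem_box)
qed

lemma cball_subset_cube: "cball c R \<subseteq> cube c R"
  by (auto simp: mem_cube dist_norm norm_minus_commute intro: order_trans[OF Basis_le_norm])

lemma cube_mono: "r \<le> R \<Longrightarrow> cube c r \<subseteq> cube c R"
  by (fastforce simp: mem_cube)

lemma measure_cube: "R > 0 \<Longrightarrow> measure lborel (cube (c::'a::euclidean_space) R) = (2 * R) ^ DIM('a)"
  unfolding cube_def
  by (subst content_cbox) (auto simp: inner_diff_left inner_add_left prod_constant)

lemma compact_cube: "compact (cube c R)"
  by (simp add: cube_def)

lemma integrable_cube: "continuous_on (cube c R) (f::_ \<Rightarrow> real) \<Longrightarrow> f integrable_on cube c R"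
  unfolding cube_def by (rule integrable_continuous)

lemma integral_supported:
  fixes f :: "'a::euclidean_space \<Rightarrow> real"
  assumes "\<And>x. x \<notin> K \<Longrightarrow> f x = 0" "K \<subseteq> S"
  shows "integral S f = integral UNIV f"
proof -
  have "f = (\<lambda>x. if x \<in> S then f x else 0)"
    using assms by (intro ext) auto
  then show ?thesis by (metis integral_restrict_UNIV)
qed

lemma has_slope_line:
  assumes "\<And>x. has_slope b f (f' x) x"
  shows "((\<lambda>t. f (x + t *\<^sub>R b)) has_real_derivative f' (x + s *\<^sub>R b)) (at s)"
proof -
  have "((\<lambda>t. f ((x + s *\<^sub>R b) + t *\<^sub>R b)) has_real_derivative f' (x + s *\<^sub>R b)) (at (s + - s))"
    using assms[of "x + s *\<^sub>R b"] by (simp add: has_slope_def)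
  then have "((\<lambda>t. f ((x + s *\<^sub>R b) + (t + - s) *\<^sub>R b)) has_real_derivative f' (x + s *\<^sub>R b)) (at s)"
    by (subst (asm) DERIV_shift)
  then show ?thesis by (simp add: algebra_simps)
qed

text \<open>The integral of \<open>g (x + t b)\<close> over a slightly larger cube does not depend on \<open>t\<close>, by translation invariance;
its derivative at \<open>t = 0\<close>, taken under the integral sign, is the integral of the slope of \<open>g\<close>.\<close>

lemma integral_slope_eq_0_UNIV:
  fixes g :: "'a::euclidean_space \<Rightarrow> real"
  assumes R: "R > 0" and b: "b \<in> Basis"
    and g: "\<And>x. has_slope b g (g' x) x" and cont: "continuous_on UNIV g'" "continuous_on UNIV g"
    and z: "\<And>x. x \<notin> cube c R \<Longrightarrow> g x = 0" "\<And>x. x \<notin> cube c R \<Longrightarrow> g' x = 0"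
  shows "integral (cube c R) g' = 0"
proof -
  let ?Q = "cube c (R + 1)"
  define F where "F = (\<lambda>t. integral ?Q (\<lambda>x. g (x + t *\<^sub>R b)))"
  have const: "F t = integral UNIV g" if "t \<in> {-1..1}" for t
  proof -
    have "F t = integral (cbox (c - (R + 1) *\<^sub>R One) (c + (R + 1) *\<^sub>R One)) (g \<circ> (+) (t *\<^sub>R b))"
      by (simp add: F_def cube_def o_def add.commute)
    also have "\<dots> = integral (cbox (c - (R + 1) *\<^sub>R One + t *\<^sub>R b) (c + (R + 1) *\<^sub>R One + t *\<^sub>R b)) g"
      by (rule integral_shift_cbox_plus)
    also have "\<dots> = integral UNIV g"
    proof (rule integral_supported[OF z(1)])
      show "cube c R \<subseteq> cbox (c - (R + 1) *\<^sub>R One + t *\<^sub>R b) (c + (R + 1) *\<^sub>R One + t *\<^sub>R b)"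
      proof
        fix x assume x: "x \<in> cube c R"
        have "\<bar>(x - t *\<^sub>R b - c) \<bullet> i\<bar> \<le> R + 1" if i: "i \<in> Basis" for i
        proof -
          have "\<bar>(x - c) \<bullet> i\<bar> \<le> R" using x i by (simp add: mem_cube)
          moreover have "\<bar>(t *\<^sub>R b) \<bullet> i\<bar> \<le> 1"
            using \<open>t \<in> {-1..1}\<close> b i by (simp add: inner_Basis abs_le_iff)
          ultimately show ?thesis by (simp add: inner_diff_left)
        qed
        then have "x - t *\<^sub>R b \<in> cube c (R + 1)" by (simp add: mem_cube)
        then show "x \<in> cbox (c - (R + 1) *\<^sub>R One + t *\<^sub>R b) (c + (R + 1) *\<^sub>R One + t *\<^sub>R b)"
          unfolding cube_def mem_box
          by (auto simp: inner_diff_left inner_add_left)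
      qed
    qed
    finally show ?thesis .
  qed
  have "(F has_real_derivative integral ?Q (\<lambda>x. g' (x + 0 *\<^sub>R b))) (at 0 within {-1..1})"
    unfolding F_def cube_def
  proof (rule leibniz_rule_field_derivative)
    show "continuous_on ({-1..1} \<times> cbox (c - (R + 1) *\<^sub>R One) (c + (R + 1) *\<^sub>R One)) (\<lambda>(t, x). g' (x + t *\<^sub>R b))"
      unfolding case_prod_unfold
      by (rule continuous_on_compose2[OF cont(1) _ subset_UNIV]) (intro continuous_intros)
  next
    fix t x
    show "((\<lambda>t. g (x + t *\<^sub>R b)) has_real_derivative g' (x + t *\<^sub>R b)) (at t within {-1..1})"
      using has_slope_line[of b g g' x t, OF g] by (rule has_field_derivative_at_within)
  next
    fix t :: real
    show "(\<lambda>x. g (x + t *\<^sub>R b)) integrable_on cbox (c - (R + 1) *\<^sub>R One) (c + (R + 1) *\<^sub>R One)"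
      by (intro integrable_continuous continuous_on_compose2[OF cont(2) _ subset_UNIV])
        (intro continuous_intros)
  qed (simp_all add: convex_real_interval)
  then have D: "(F has_real_derivative integral ?Q g') (at 0)"
    by (subst (asm) at_within_interior) simp_all
  have "(F has_real_derivative 0) (at 0)"
  proof (rule has_field_derivative_transform_within[of "\<lambda>_. integral UNIV g" _ _ _ 1])
    fix t :: real assume "dist t 0 < 1"
    then show "integral UNIV g = F t" by (subst const) (auto simp: dist_real_def)
  qed auto
  with D have "integral ?Q g' = 0" by (rule DERIV_unique)
  moreover have "integral ?Q g' = integral UNIV g'"
    by (rule integral_supported[OF z(2) cube_mono[of R "R + 1"]]) simp_all
  moreover have "integral (cube c R) g' = integral UNIV g'"
    by (rule integral_supported[OF z(2) order_refl])
  ultimately show ?thesis by simp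
qed

text \<open>A field that vanishes with the bump is extended by zero. It then only needs to be differentiable near the cube,
which matters for quotients by functions that are defined and positive on \<open>\<Omega>\<close> alone.\<close>

lemma integral_slope_eq_0:
  fixes g :: "'a::euclidean_space \<Rightarrow> real"
  assumes R: "R > 0" and b: "b \<in> Basis" and \<Omega>: "open \<Omega>" "cube c R \<subseteq> \<Omega>"
    and g: "\<And>x. x \<in> \<Omega> \<Longrightarrow> has_slope b g (g' x) x" 
    and cont: "continuous_on \<Omega> g" "continuous_on \<Omega> g'"
    and z: "\<And>x. bump c R x = 0 \<Longrightarrow> g x = 0" "\<And>x. bump c R x = 0 \<Longrightarrow> g' x = 0"
  shows "integral (cube c R) g' = 0"
proof -
  (* g and g' vanish on the complement of the ball, which together with \<Omega> covers the space. *)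
  let ?V = "- cball c R"
  have V: "open ?V" by auto
  have U: "\<Omega> \<union> ?V = UNIV" using cball_subset_cube[of c R] R \<Omega> by auto
  have z': "g x = 0" "g' x = 0" if "x \<in> ?V" for x
    using z bump_eq_0[OF R, of x c] that by auto
  have c0: "continuous_on UNIV f" if "continuous_on \<Omega> f" "\<And>x. x \<in> ?V \<Longrightarrow> f x = 0" for f :: "'a \<Rightarrow> real"
  proof -
    have "continuous_on ?V f" using that(2) by (subst continuous_on_cong[OF refl, of _ _ "\<lambda>_. 0"]) auto
    then have "continuous_on (\<Omega> \<union> ?V) f"
      using that(1) \<Omega>(1) V by (intro continuous_on_open_Un) auto
    then show ?thesis by (simp add: U)
  qed
  have sl: "has_slope b g (g' x) x" for x
  proof (cases "x \<in> \<Omega>")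
    case False
    then have x: "x \<in> ?V" using U by auto
    then obtain e where e: "e > 0" "ball x e \<subseteq> ?V" using V open_contains_ball by blast
    have "((\<lambda>t. g (x + t *\<^sub>R b)) has_real_derivative 0) (at 0)"
    proof (rule has_field_derivative_transform_within[of "\<lambda>_. 0" _ _ _ e])
      fix t :: real assume "dist t 0 < e"
      then have "x + t *\<^sub>R b \<in> ball x e" using b by (simp add: dist_norm)
      then have "x + t *\<^sub>R b \<in> ?V" using e by blast
      then show "0 = g (x + t *\<^sub>R b)" by (metis z'(1))
    qed (use e in auto)
    then show ?thesis using z'(2)[OF x] by (simp add: has_slope_def)
  qed (use g in auto)
  show ?thesis
  proof (rule integral_slope_eq_0_UNIV[OF R b sl])
    fix x assume "x \<notin> cube c R"
    then have "x \<in> ?V" using cball_subset_cube[of c R] R by auto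
    then show "g x = 0" "g' x = 0" using z' by auto
  qed (use c0 cont z' in auto)
qed

lemma integral_divergence_eq_0:
  fixes F D :: "'a::euclidean_space \<Rightarrow> 'a \<Rightarrow> real"
  assumes R: "R > 0" and \<Omega>: "open \<Omega>" "cube c R \<subseteq> \<Omega>"
    and F: "\<And>i x. i \<in> Basis \<Longrightarrow> x \<in> \<Omega> \<Longrightarrow> has_slope i (F i) (D i x) x"
    and cont: "\<And>i. i \<in> Basis \<Longrightarrow> continuous_on \<Omega> (F i)" "\<And>i. i \<in> Basis \<Longrightarrow> continuous_on \<Omega> (D i)"
    and z: "\<And>i x. i \<in> Basis \<Longrightarrow> bump c R x = 0 \<Longrightarrow> F i x = 0"
           "\<And>i x. i \<in> Basis \<Longrightarrow> bump c R x = 0 \<Longrightarrow> D i x = 0"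
  shows "integral (cube c R) (\<lambda>x. \<Sum>i\<in>Basis. D i x) = 0"
proof -
  have cD: "continuous_on (cube c R) (D i)" if "i \<in> Basis" for i
    using cont(2)[OF that] \<Omega>(2) continuous_on_subset by blast
  have "integral (cube c R) (\<lambda>x. \<Sum>i\<in>Basis. D i x) = (\<Sum>i\<in>Basis. integral (cube c R) (D i))"
    by (intro integral_sum integrable_cube cD) auto
  also have "\<dots> = 0"
    using integral_slope_eq_0[OF R _ \<Omega> F cont z] by (intro sum.neutral) blast
  finally show ?thesis .
qed

text \<open>The form in which integration by parts is used: pointwise inequalities may be corrected by the divergence of a
field vanishing with the bump before they are integrated.\<close>

lemma integral_le_mod_divergence:
  fixes F D :: "'a::euclidean_space \<Rightarrow> 'a \<Rightarrow> real"
  assumes R: "R > 0" and \<Omega>: "open \<Omega>" "cube c R \<subseteq> \<Omega>"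
    and F: "\<And>i x. i \<in> Basis \<Longrightarrow> x \<in> \<Omega> \<Longrightarrow> has_slope i (F i) (D i x) x"
    and cont: "\<And>i. i \<in> Basis \<Longrightarrow> continuous_on \<Omega> (F i)" "\<And>i. i \<in> Basis \<Longrightarrow> continuous_on \<Omega> (D i)"
    and z: "\<And>i x. i \<in> Basis \<Longrightarrow> bump c R x = 0 \<Longrightarrow> F i x = 0"
           "\<And>i x. i \<in> Basis \<Longrightarrow> bump c R x = 0 \<Longrightarrow> D i x = 0"
    and h: "continuous_on (cube c R) h1" "continuous_on (cube c R) h2"
    and le: "\<And>x. x \<in> cube c R \<Longrightarrow> h1 x \<le> h2 x + (\<Sum>i\<in>Basis. D i x)"
  shows "integral (cube c R) h1 \<le> integral (cube c R) h2"
proof -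
  have cD: "continuous_on (cube c R) (D i)" if "i \<in> Basis" for i
    using cont(2)[OF that] \<Omega>(2) continuous_on_subset by blast
  have "integral (cube c R) h1 \<le> integral (cube c R) (\<lambda>x. h2 x + (\<Sum>i\<in>Basis. D i x))"
    by (intro integral_le integrable_cube continuous_intros h cD le)
  also have "\<dots> = integral (cube c R) h2 + integral (cube c R) (\<lambda>x. \<Sum>i\<in>Basis. D i x)"
    by (intro integral_add integrable_cube continuous_intros h cD)
  also have "integral (cube c R) (\<lambda>x. \<Sum>i\<in>Basis. D i x) = 0"
    by (rule integral_divergence_eq_0[OF R \<Omega> F cont z])
  finally show ?thesis by simp
qed

section \<open>Cut-off functions\<close>

text \<open>A vanishing derivative at \<open>0\<close> makes the truncation at \<open>0\<close> differentiable there.\<close>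

lemma DERIV_max0:
  fixes g g' :: "real \<Rightarrow> real"
  assumes g: "\<And>t. t \<ge> 0 \<Longrightarrow> (g has_real_derivative g' t) (at t)" and 0: "g' 0 = 0"
  shows "((\<lambda>t. g (max 0 t)) has_real_derivative g' (max 0 t)) (at t)"
proof -
  consider "t > 0" | "t < 0" | "t = 0" by linarith
  then show ?thesis
  proof cases
    case 1
    have "((\<lambda>t. g (max 0 t)) has_real_derivative g' t) (at t)"
      by (rule has_field_derivative_transform_within[OF g, of t t])
        (use 1 in \<open>auto simp: dist_real_def max_def\<close>)
    then show ?thesis using 1 by simp
  next
    case 2
    have "((\<lambda>t. g (max 0 t)) has_real_derivative 0) (at t)"
      by (rule has_field_derivative_transform_within[of "\<lambda>_. g 0" _ _ _ "-t"])
        (use 2 in \<open>auto simp: dist_real_def max_def\<close>)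
    then show ?thesis using 2 0 by simp
  next
    case 3
    have l: "((\<lambda>h. (g h - g 0) / h) \<longlongrightarrow> 0) (at 0)"
      using g[of 0] 0 by (simp add: DERIV_def)
    have "((\<lambda>h. (g (max 0 h) - g 0) / h) \<longlongrightarrow> 0) (at 0)"
    proof (rule Lim_null_comparison[OF _ tendsto_norm_zero[OF l]])
      show "\<forall>\<^sub>F h in at 0. norm ((g (max 0 h) - g 0) / h) \<le> norm ((g h - g 0) / h)"
        by (intro always_eventually) (simp add: max_def divide_nonneg_nonpos)
    qed
    then show ?thesis using 3 0 by (simp add: DERIV_def)
  qed
qed

lemma DERIV_max0_power:
  "2 \<le> n \<Longrightarrow> ((\<lambda>t. (max 0 t) ^ n) has_real_derivative real n * (max 0 t) ^ (n - 1)) (at t)"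
  using DERIV_max0[of "\<lambda>t. t ^ n" "\<lambda>t. real n * t ^ (n - 1)" t]
  by (auto intro!: derivative_eq_intros simp: power_0_left)

lemma slope_inner: "has_slope b (\<lambda>z. (z - c) \<bullet> i) (b \<bullet> i) x"
  unfolding has_slope_def by (auto intro!: derivative_eq_intros simp: inner_diff_left inner_add_left)

lemma slope_bump_power:
  assumes "2 \<le> n" "b \<in> Basis"
  shows "has_slope b (\<lambda>z. bump c R z ^ n) (real n * bump c R x ^ (n - 1) * (- 2 * ((x - c) \<bullet> b) / R\<^sup>2)) x"
proof -
  have y: "((\<lambda>t. 1 - (norm (x + t *\<^sub>R b - c))\<^sup>2 / R\<^sup>2) has_real_derivative - 2 * ((x - c) \<bullet> b) / R\<^sup>2) (at 0)"
    unfolding power2_norm_eq_inner inner_diff_left inner_diff_right inner_add_left inner_add_right divide_inverse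
    by (auto intro!: derivative_eq_intros simp: inner_commute algebra_simps)
  show ?thesis
    using DERIV_chain2[OF DERIV_max0_power[OF assms(1)] y]
    by (simp add: has_slope_def bump_def)
qed

text \<open>First and second partial derivatives of \<open>bump c R ^ n\<close>. Both formulas remain correct where the bump vanishes,
provided that \<open>n\<close> is at least \<open>2\<close> or \<open>3\<close>, respectively.\<close>

definition bump1 :: "nat \<Rightarrow> 'a::euclidean_space \<Rightarrow> real \<Rightarrow> 'a \<Rightarrow> 'a \<Rightarrow> real"
  where "bump1 n c R b x = real n * bump c R x ^ (n - 1) * (- 2 * ((x - c) \<bullet> b) / R\<^sup>2)"

definition bump2 :: "nat \<Rightarrow> 'a::euclidean_space \<Rightarrow> real \<Rightarrow> 'a \<Rightarrow> 'a \<Rightarrow> real"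
  where "bump2 n c R b x = real n * real (n - 1) * bump c R x ^ (n - 2) * (- 2 * ((x - c) \<bullet> b) / R\<^sup>2)\<^sup>2
    - 2 * real n * bump c R x ^ (n - 1) / R\<^sup>2"

lemma slope_bump1:
  assumes "3 \<le> n" "b \<in> Basis"
  shows "has_slope b (bump1 n c R b) (bump2 n c R b x) x"
proof -
  have 1: "((\<lambda>t. bump c R (x + t *\<^sub>R b) ^ (n - 1)) has_real_derivative
     real (n - 1) * bump c R x ^ (n - 2) * (- 2 * ((x - c) \<bullet> b) / R\<^sup>2)) (at 0)"
    using slope_bump_power[of "n - 1" b c R x] assms
    by (simp add: has_slope_def numeral_2_eq_2)
  have 2: "((\<lambda>t. (x + t *\<^sub>R b - c) \<bullet> b) has_real_derivative 1) (at 0)"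
    using slope_inner[of b c b x] assms by (simp add: has_slope_def)
  have n: "n - 2 = n - 1 - 1" by simp
  show ?thesis
    unfolding has_slope_def bump1_def bump2_def divide_inverse
    by (rule derivative_eq_intros 1 2 refl)+
      (simp add: algebra_simps power2_eq_square divide_inverse)
qed

lemma sum_inner_sq: "(\<Sum>b\<in>Basis. (x \<bullet> b)\<^sup>2) = (norm (x::'a::euclidean_space))\<^sup>2"
  unfolding power2_norm_eq_inner by (subst euclidean_inner) (simp add: power2_eq_square)

lemma continuous_bump12:
  "continuous_on S (bump1 n c R b)" "continuous_on S (bump2 n c R b)"
  unfolding bump1_def[abs_def] bump2_def[abs_def] divide_inverse by (intro continuous_intros)+

text \<open>On the support of the bump, \<open>\<bar>x - c\<bar>\<^sup>2 = R\<^sup>2 (1 - bump c R x)\<close>; a positive power of the bump extends this to all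
\<open>x\<close>. It turns the sums of squares of the derivatives into powers of the bump.\<close>

lemma bump_norm_sq:
  assumes "R > 0" "0 < k"
  shows "bump c R x ^ k * (norm (x - c))\<^sup>2 / R ^ 4 = bump c R x ^ k * (1 - bump c R x) / R\<^sup>2"
proof (cases "bump c R x = 0")
  case False
  have "bump c R x ^ k * (R\<^sup>2 * (1 - bump c R x)) / R ^ 4 = bump c R x ^ k * (1 - bump c R x) / R\<^sup>2"
    using assms by (simp add: field_simps power2_eq_square power4_eq_xxxx)
  then show ?thesis using bump_pos_norm[OF assms(1) False] by simp
qed (use assms in \<open>simp add: zero_power\<close>)

lemma sum_bump2:
  assumes "R > 0" "n \<ge> 3"
  shows "(\<Sum>b\<in>Basis. bump2 n (c::'a::euclidean_space) R b x)
    = (4 * real n * real (n - 1) * bump c R x ^ (n - 2) * (1 - bump c R x)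
       - 2 * real n * DIM('a) * bump c R x ^ (n - 1)) / R\<^sup>2"
proof -
  have "bump2 n c R b x = 4 * real n * real (n - 1) * (bump c R x ^ (n - 2) * ((x - c) \<bullet> b)\<^sup>2 / R^4)
     - 2 * real n * bump c R x ^ (n - 1) / R\<^sup>2" for b
    unfolding bump2_def power_mult_distrib power_divide by simp
  then have "(\<Sum>b\<in>Basis. bump2 n c R b x) =
    4 * real n * real (n - 1) * (bump c R x ^ (n - 2) * (\<Sum>b\<in>Basis. ((x - c) \<bullet> b)\<^sup>2) / R^4)
     - 2 * real n * DIM('a) * bump c R x ^ (n - 1) / R\<^sup>2"
    by (simp add: sum_subtractf flip: sum_distrib_left sum_divide_distrib)
  also have "\<dots> = 4 * real n * real (n - 1) * (bump c R x ^ (n - 2) * (1 - bump c R x) / R\<^sup>2)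
     - 2 * real n * DIM('a) * bump c R x ^ (n - 1) / R\<^sup>2"
    unfolding sum_inner_sq using bump_norm_sq[of R "n - 2" c x] assms by simp
  finally show ?thesis by (simp add: diff_divide_distrib)
qed

lemma sum_bump1_sq:
  assumes "R > 0" "n \<ge> 2"
  shows "(\<Sum>b\<in>Basis. (bump1 n c R b x)\<^sup>2)
    = 4 * (real n)\<^sup>2 * bump c R x ^ (2 * n - 2) * (1 - bump c R x) / R\<^sup>2"
proof -
  have "(bump c R x ^ (n - 1))\<^sup>2 = bump c R x ^ (2 * n - 2)"
    by (simp add: mult.commute right_diff_distrib' flip: power_mult)
  then have "(bump1 n c R b x)\<^sup>2 = 4 * (real n)\<^sup>2 * (bump c R x ^ (2 * n - 2) * ((x - c) \<bullet> b)\<^sup>2 / R^4)" for b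
    unfolding bump1_def power_mult_distrib power_divide by simp
  then have "(\<Sum>b\<in>Basis. (bump1 n c R b x)\<^sup>2) = 4 * (real n)\<^sup>2 * (bump c R x ^ (2 * n - 2) * (\<Sum>b\<in>Basis. ((x - c) \<bullet> b)\<^sup>2) / R^4)"
    by (simp flip: sum_distrib_left sum_divide_distrib)
  also have "\<dots> = 4 * (real n)\<^sup>2 * (bump c R x ^ (2 * n - 2) * (1 - bump c R x) / R\<^sup>2)"
    unfolding sum_inner_sq using bump_norm_sq[of R "2 * n - 2" c x] assms by simp
  finally show ?thesis by simp
qed

section \<open>Twice differentiable functions and weighted means\<close>

text \<open>The derivatives are carried as arguments \<open>f1\<close>, \<open>f2\<close>, because concrete formulas for them are needed. Only the pure
second derivatives are recorded, since they alone enter the Laplacian.\<close>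

definition C2_fun :: "'a::euclidean_space set \<Rightarrow> ('a \<Rightarrow> real) \<Rightarrow> ('a \<Rightarrow> 'a \<Rightarrow> real) \<Rightarrow> ('a \<Rightarrow> 'a \<Rightarrow> real) \<Rightarrow> bool"
  where "C2_fun S f f1 f2 \<longleftrightarrow> continuous_on S f \<and>
    (\<forall>i\<in>Basis. continuous_on S (f1 i) \<and> continuous_on S (f2 i) \<and>
      (\<forall>x\<in>S. has_slope i f (f1 i x) x \<and> has_slope i (f1 i) (f2 i x) x))"

lemma C2_funD:
  assumes "C2_fun S f f1 f2"
  shows "continuous_on S f" "i \<in> Basis \<Longrightarrow> continuous_on S (f1 i)" "i \<in> Basis \<Longrightarrow> continuous_on S (f2 i)"
    "i \<in> Basis \<Longrightarrow> x \<in> S \<Longrightarrow> has_slope i f (f1 i x) x"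
    "i \<in> Basis \<Longrightarrow> x \<in> S \<Longrightarrow> has_slope i (f1 i) (f2 i x) x"
  using assms unfolding C2_fun_def by auto

lemma C2_fun_if_C2_on:
  assumes "C2_on S f"
  shows "C2_fun S f (\<lambda>i. partial_deriv i f) (\<lambda>i. partial_deriv i (partial_deriv i f))"
proof -
  have "has_slope i g (partial_deriv i g x) x" if "has_partial_deriv_at i g x" for i x and g :: "'a \<Rightarrow> real"
    using that unfolding has_slope_def partial_deriv_def has_partial_deriv_at_def
    by (simp add: DERIV_deriv_iff_field_differentiable)
  then show ?thesis using assms unfolding C2_fun_def C2_on_def by blast
qed

lemma C2_fun_const: "C2_fun S (\<lambda>_. k) (\<lambda>_ _. 0) (\<lambda>_ _. 0)"
  by (auto simp: C2_fun_def has_slope_def intro!: derivative_eq_intros continuous_intros)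

lemma has_slope_cmult: "has_slope b f d x \<Longrightarrow> has_slope b (\<lambda>x. k * f x) (k * d) x"
  unfolding has_slope_def by (rule DERIV_cmult)

lemma has_slope_powr:
  assumes "has_slope b f d x" "f x > 0"
  shows "has_slope b (\<lambda>x. f x powr r) (r * f x powr (r - 1) * d) x"
proof -
  have p: "((\<lambda>y. y powr r) has_real_derivative r * f x powr (r - 1)) (at (f (x + 0 *\<^sub>R b)))"
    using assms(2) by (auto intro!: derivative_eq_intros)
  show ?thesis
    unfolding has_slope_def using DERIV_chain2[OF p assms(1)[unfolded has_slope_def]] by simp
qed

lemma
  assumes "has_slope b f d x" "has_slope b g e x"
  shows has_slope_mult: "has_slope b (\<lambda>x. f x * g x) (d * g x + f x * e) x"
    and has_slope_diff: "has_slope b (\<lambda>x. f x - g x) (d - e) x"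
    and has_slope_add: "has_slope b (\<lambda>x. f x + g x) (d + e) x"
    and has_slope_divide: "g x \<noteq> 0 \<Longrightarrow> has_slope b (\<lambda>x. f x / g x) ((d * g x - f x * e) / (g x * g x)) x"
proof -
  note d = assms[unfolded has_slope_def]
  show "has_slope b (\<lambda>x. f x * g x) (d * g x + f x * e) x"
    unfolding has_slope_def using DERIV_mult[OF d] by (simp add: algebra_simps)
  show "has_slope b (\<lambda>x. f x - g x) (d - e) x" "has_slope b (\<lambda>x. f x + g x) (d + e) x"
    unfolding has_slope_def using DERIV_diff[OF d] DERIV_add[OF d] by simp_all
  show "has_slope b (\<lambda>x. f x / g x) ((d * g x - f x * e) / (g x * g x)) x" if "g x \<noteq> 0"
    unfolding has_slope_def using DERIV_divide[OF d] that by simp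
qed

lemma has_slope_eq: "has_slope b f d x \<Longrightarrow> d = d' \<Longrightarrow> has_slope b f d' x"
  by simp

lemma green_bump:
  fixes f :: "'a::euclidean_space \<Rightarrow> real"
  assumes f: "C2_fun UNIV f f1 f2" and R: "R > 0" and n: "n \<ge> 3"
  shows "integral (cube c R) (\<lambda>x. bump c R x ^ n * (\<Sum>i\<in>Basis. f2 i x))
    = integral (cube c R) (\<lambda>x. f x * (\<Sum>i\<in>Basis. bump2 n c R i x))"
proof -
  note f' = C2_funD[OF f] 
  let ?D = "\<lambda>i x. bump c R x ^ n * f2 i x - f x * bump2 n c R i x"
  have c: "continuous_on S f" "i \<in> Basis \<Longrightarrow> continuous_on S (f1 i)" "i \<in> Basis \<Longrightarrow> continuous_on S (f2 i)" for S i
    using f'(1-3) continuous_on_subset by blast+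
  have b0: "bump1 n c R i x = 0" "bump2 n c R i x = 0" if "bump c R x = 0" for i x
    using that n by (auto simp: bump1_def bump2_def zero_power)
  have "integral (cube c R) (\<lambda>x. \<Sum>i\<in>Basis. ?D i x) = 0"
  proof (rule integral_divergence_eq_0[OF R, of UNIV _ "\<lambda>i x. bump c R x ^ n * f1 i x - f x * bump1 n c R i x"])
    fix i x :: 'a assume i: "i \<in> Basis"
    note d = f'(4,5)[OF i UNIV_I, of x] slope_bump1[OF n i, of c R x]
      slope_bump_power[of n i c R x, OF _ i, folded bump1_def]
    have "has_slope i (\<lambda>x. bump c R x ^ n * f1 i x - f x * bump1 n c R i x)
       ((bump1 n c R i x * f1 i x + bump c R x ^ n * f2 i x)
         - (f1 i x * bump1 n c R i x + f x * bump2 n c R i x)) x"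
      using n by (intro has_slope_diff has_slope_mult d) auto
    then show "has_slope i (\<lambda>x. bump c R x ^ n * f1 i x - f x * bump1 n c R i x) (?D i x) x"
      by (rule has_slope_eq) (simp add: algebra_simps)
  qed (use n in \<open>auto intro!: continuous_intros continuous_bump12 c simp: b0 zero_power\<close>)
  moreover have "integral (cube c R) (\<lambda>x. \<Sum>i\<in>Basis. ?D i x)
    = integral (cube c R) (\<lambda>x. bump c R x ^ n * (\<Sum>i\<in>Basis. f2 i x))
      - integral (cube c R) (\<lambda>x. f x * (\<Sum>i\<in>Basis. bump2 n c R i x))"
    unfolding sum_subtractf sum_distrib_left[symmetric]
    by (intro integral_diff integrable_cube continuous_intros continuous_bump12 c)
  ultimately show ?thesis by simp
qed

text \<open>The weight \<open>bump c s\<^sup>2\<close> plays the role of the indicator of a ball: the means are not normalised to total weight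
one, but their total weight does not depend on the radius.\<close>

definition wmean :: "'a::euclidean_space \<Rightarrow> real \<Rightarrow> ('a \<Rightarrow> real) \<Rightarrow> real"
  where "wmean c s f = integral (cube c s) (\<lambda>z. f z * bump c s z ^ 2) / s ^ DIM('a)"

lemma DERIV_bump_radius:
  assumes "s > 0"
  shows "((\<lambda>s. bump c s z ^ 2) has_real_derivative 4 * bump c s z * (norm (z - c))\<^sup>2 / s ^ 3) (at s)"
proof -
  have y: "((\<lambda>s. 1 - (norm (z - c))\<^sup>2 / s\<^sup>2) has_real_derivative 2 * (norm (z - c))\<^sup>2 / s ^ 3) (at s)"
    using assms by (auto intro!: derivative_eq_intros simp: field_simps power3_eq_cube power2_eq_square)
  show ?thesis
    using DERIV_chain2[OF DERIV_max0_power[of 2] y] by (simp add: bump_def mult.assoc)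
qed

lemma integral_cube_supported:
  fixes h :: "'a::euclidean_space \<Rightarrow> real"
  assumes t: "0 < t" "t \<le> S" and h: "\<And>z. bump c t z = 0 \<Longrightarrow> h z = 0"
  shows "integral (cube c t) h = integral (cube c S) h"
proof -
  have z: "h z = 0" if "z \<notin> cube c t" for z
    using that cball_subset_cube[of c t] by (intro h bump_eq_0[OF t(1)]) blast
  have "integral (cube c t) h = integral UNIV h" by (rule integral_supported[OF z order_refl])
  moreover have "integral (cube c S) h = integral UNIV h"
    by (rule integral_supported[OF z cube_mono[OF t(2)]])
  ultimately show ?thesis by simp
qed

lemma DERIV_integral_bump_radius:
  fixes f :: "'a::euclidean_space \<Rightarrow> real"
  assumes f: "continuous_on UNIV f" and s: "s > 0"
  shows "((\<lambda>t. integral (cube c S) (\<lambda>z. f z * bump c t z ^ 2)) has_real_derivative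
    integral (cube c S) (\<lambda>z. f z * (4 * bump c s z * (norm (z - c))\<^sup>2 / s ^ 3))) (at s)"
proof -
  let ?T = "{s/2..2 * s}"
  have cf: "continuous_on A f" for A using f continuous_on_subset by blast
  have "((\<lambda>t. integral (cube c S) (\<lambda>z. f z * bump c t z ^ 2)) has_real_derivative
    integral (cube c S) (\<lambda>z. f z * (4 * bump c s z * (norm (z - c))\<^sup>2 / s ^ 3))) (at s within ?T)"
    unfolding cube_def
  proof (rule leibniz_rule_field_derivative)
    fix t z assume "t \<in> ?T"
    then have "t > 0" using s by auto
    show "((\<lambda>t. f z * (bump c t z)\<^sup>2) has_real_derivative f z * (4 * bump c t z * (norm (z - c))\<^sup>2 / t ^ 3)) (at t within ?T)"
      by (rule has_field_derivative_at_within) (rule DERIV_cmult[OF DERIV_bump_radius[OF \<open>t > 0\<close>]])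
  next
    fix t
    show "(\<lambda>z. f z * (bump c t z)\<^sup>2) integrable_on cbox (c - S *\<^sub>R One) (c + S *\<^sub>R One)"
      by (intro integrable_continuous continuous_intros cf)
  next
    show "continuous_on (?T \<times> cbox (c - S *\<^sub>R One) (c + S *\<^sub>R One))
       (\<lambda>(t, z). f z * (4 * bump c t z * (norm (z - c))\<^sup>2 / t ^ 3))"
      unfolding case_prod_unfold bump_def
    proof (intro continuous_intros continuous_on_compose2[OF f _ subset_UNIV] ballI)
      fix y assume "y \<in> ?T \<times> cbox (c - S *\<^sub>R One) (c + S *\<^sub>R One)"
      then have "0 < fst y" using s by (auto simp: mem_Times_iff)
      then show "(fst y)\<^sup>2 \<noteq> 0" "fst y ^ 3 \<noteq> 0" by simp_all
    qed
  qed (use s in simp_all)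
  then show ?thesis
    using s by (subst (asm) at_within_interior) simp_all
qed

text \<open>The derivative of the rescaled weight \<open>s\<^bsup>-N\<^esup> bump c s\<^sup>2\<close> in \<open>s\<close> is, up to the factor \<open>s\<^bsup>1-N\<^esup> / 6\<close>, the Laplacian
of \<open>bump c s\<^sup>3\<close>. The derivative falls on the explicit weight only, so \<open>f\<close> may be merely continuous.\<close>

lemma wmean_deriv:
  fixes f :: "'a::euclidean_space \<Rightarrow> real"
  assumes f: "continuous_on UNIV f" and s: "s > 0"
  shows "((\<lambda>s. wmean c s f) has_real_derivative
    (s\<^sup>2 / (6 * s ^ Suc DIM('a))) * integral (cube c s) (\<lambda>z. f z * (\<Sum>i\<in>Basis. bump2 3 c s i z))) (at s)"
proof -
  let ?N = "DIM('a)"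
  define S where "S = 2 * s"
  have cf: "continuous_on A f" for A using f continuous_on_subset by blast
  define I where "I = (\<lambda>t. integral (cube c S) (\<lambda>z. f z * bump c t z ^ 2))"
  define A where "A = integral (cube c S) (\<lambda>z. f z * (4 * bump c s z * (norm (z - c))\<^sup>2 / s ^ 3))"
  define B where "B = integral (cube c S) (\<lambda>z. f z * (\<Sum>i\<in>Basis. bump2 3 c s i z))"
  have "(I has_real_derivative A) (at s)"
    unfolding I_def A_def by (rule DERIV_integral_bump_radius[OF f s])
  from DERIV_divide[OF this DERIV_pow[of ?N s]]
  have "((\<lambda>t. I t / t ^ ?N) has_real_derivative
      (A * s ^ ?N - I s * (real ?N * s ^ (?N - 1))) / (s ^ ?N * s ^ ?N)) (at s)"
    using s by simp
  moreover obtain M where "?N = Suc M"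
    using DIM_positive[where 'a='a] gr0_implies_Suc by blast
  then have "(A * s ^ ?N - I s * (real ?N * s ^ (?N - 1))) / (s ^ ?N * s ^ ?N) = (s * A - real ?N * I s) / s ^ Suc ?N"
    using s by (simp add: field_simps)
  moreover have "s * A - real ?N * I s = s\<^sup>2 / 6 * B"
  proof -
    have eq: "(s\<^sup>2 / 6) * (f z * (\<Sum>i\<in>Basis. bump2 3 c s i z)) =
       s * (f z * (4 * bump c s z * (norm (z - c))\<^sup>2 / s ^ 3)) - real ?N * (f z * bump c s z ^ 2)" for z
    proof -
      define b where "b = bump c s z"
      define g where "g = (\<Sum>i\<in>Basis. bump2 3 c s i z)"
      have e: "b * (norm (z - c))\<^sup>2 / s ^ 4 = b * (1 - b) / s\<^sup>2"
        using bump_norm_sq[of s 1 c z] s by (simp add: b_def)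
      have g: "s\<^sup>2 * g = 24 * b * (1 - b) - 6 * real ?N * b ^ 2"
        unfolding g_def b_def using sum_bump2[of s 3 c z] s by simp
      have "s * (f z * (4 * b * (norm (z - c))\<^sup>2 / s ^ 3)) = 4 * s\<^sup>2 * f z * (b * (norm (z - c))\<^sup>2 / s ^ 4)"
        using s by (simp add: field_simps power2_eq_square power3_eq_cube power4_eq_xxxx)
      also have "\<dots> = f z * (4 * b * (1 - b))"
        unfolding e using s by simp
      also have "\<dots> = f z * (s\<^sup>2 * g) / 6 + real ?N * (f z * b ^ 2)"
        unfolding g by (simp add: field_simps)
      finally show ?thesis unfolding b_def g_def by simp
    qed
    have "s\<^sup>2 / 6 * B
      = integral (cube c S) (\<lambda>z. s * (f z * (4 * bump c s z * (norm (z - c))\<^sup>2 / s ^ 3)) - real ?N * (f z * bump c s z ^ 2))"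
      unfolding eq[symmetric] B_def by (rule integral_mult_right[symmetric])
    also have "\<dots> = integral (cube c S) (\<lambda>z. s * (f z * (4 * bump c s z * (norm (z - c))\<^sup>2 / s ^ 3)))
       - integral (cube c S) (\<lambda>z. real ?N * (f z * bump c s z ^ 2))"
      unfolding divide_inverse by (intro integral_diff integrable_cube continuous_intros cf)
    finally show ?thesis
      unfolding I_def A_def integral_mult_right by simp
  qed
  moreover have "B = integral (cube c s) (\<lambda>z. f z * (\<Sum>i\<in>Basis. bump2 3 c s i z))"
    unfolding B_def using s
    by (intro integral_cube_supported[symmetric]) (auto simp: S_def bump2_def)
  ultimately have D': "((\<lambda>t. I t / t ^ ?N) has_real_derivative (s\<^sup>2 / (6 * s ^ Suc ?N)) *
     integral (cube c s) (\<lambda>z. f z * (\<Sum>i\<in>Basis. bump2 3 c s i z))) (at s)"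
    by simp
  show ?thesis
  proof (rule has_field_derivative_transform_within_open[OF D', of "{0<..<S}"])
    fix t assume "t \<in> {0<..<S}"
    then show "I t / t ^ ?N = wmean c t f"
      unfolding wmean_def I_def by (subst integral_cube_supported[of t S]) auto
  qed (use s in \<open>auto simp: S_def\<close>)
qed

lemma wmean_antimono:
  fixes f :: "'a::euclidean_space \<Rightarrow> real"
  assumes f: "continuous_on UNIV f"
    and le: "\<And>s. s > 0 \<Longrightarrow> integral (cube c s) (\<lambda>z. f z * (\<Sum>i\<in>Basis. bump2 3 c s i z)) \<le> 0"
    and ab: "0 < a" "a \<le> b"
  shows "wmean c b f \<le> wmean c a f"
proof (rule DERIV_nonpos_imp_nonincreasing[OF ab(2)])
  fix s assume "a \<le> s"
  then have "s > 0" using ab by simp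
  then show "\<exists>y. ((\<lambda>s. wmean c s f) has_real_derivative y) (at s) \<and> y \<le> 0"
    using wmean_deriv[OF f, of s c] le[of s] by (intro exI conjI) (assumption, simp add: mult_nonneg_nonpos divide_nonpos_pos)
qed

text \<open>The function \<open>1\<close> and the function \<open>-1\<close> are both superharmonic.\<close>

lemma wmean_const_eq:
  fixes c :: "'a::euclidean_space"
  assumes ab: "0 < a" "0 < b"
  shows "wmean c a (\<lambda>_. 1) = wmean c b (\<lambda>_. 1)"
proof -
  have z: "integral (cube c s) (\<lambda>z. k * (\<Sum>i\<in>Basis. bump2 3 c s i z)) = 0" if "s > 0" for s k
    using green_bump[OF C2_fun_const that, of 3 c k] by simp
  have m: "wmean c s (\<lambda>_. -1) = - wmean c s (\<lambda>_. 1)" for s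
    by (simp add: wmean_def)
  have "wmean c b (\<lambda>_. 1) \<le> wmean c a (\<lambda>_. 1) \<and> wmean c b (\<lambda>_. -1) \<le> wmean c a (\<lambda>_. -1)" if "0 < a" "a \<le> b" for a b
    using that z[of _ 1] z[of _ "-1"] by (intro conjI wmean_antimono continuous_intros) simp_all
  from this[of a b] this[of b a] show ?thesis using ab m by (metis linear neg_le_iff_le order_antisym)
qed

lemma wmean_mono:
  assumes "continuous_on (cube c s) f" "continuous_on (cube c s) g" "s > 0"
    "\<And>x. x \<in> cball c s \<Longrightarrow> f x \<le> g x"
  shows "wmean c s f \<le> wmean c s g"
proof -
  have "f x * (bump c s x)\<^sup>2 \<le> g x * (bump c s x)\<^sup>2" for x
    using assms(4)[of x] bump_eq_0[OF assms(3), of x c] by (cases "x \<in> cball c s") (auto intro!: mult_right_mono)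
  then show ?thesis
    unfolding wmean_def using assms
    by (intro divide_right_mono integral_le integrable_cube continuous_intros) auto
qed

text \<open>The mean value inequality for superharmonic functions, stated in the weak form that only involves the integrals
of \<open>f\<close> against the Laplacian of \<open>bump c s\<^sup>3\<close>. Means decrease in the radius and approach the value at the centre,
by continuity, as the radius shrinks.\<close>

lemma wmean_le_value:
  fixes f :: "'a::euclidean_space \<Rightarrow> real"
  assumes f: "continuous_on UNIV f"
    and le: "\<And>s. s > 0 \<Longrightarrow> integral (cube c s) (\<lambda>z. f z * (\<Sum>i\<in>Basis. bump2 3 c s i z)) \<le> 0"
    and s: "s > 0"
  shows "wmean c s f \<le> f c * wmean c s (\<lambda>_. 1)"
proof -
  define K where "K = wmean c s (\<lambda>_. 1)"
  have K: "0 \<le> K" unfolding K_def wmean_def using s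
    by (intro divide_nonneg_nonneg integral_nonneg integrable_cube continuous_intros) auto
  have *: "wmean c s f \<le> (f c + e) * K" if e: "e > 0" for e
  proof -
    obtain d where d: "d > 0" "\<And>x. dist x c < d \<Longrightarrow> dist (f x) (f c) < e"
      using f e unfolding continuous_on_iff by blast
    (* A radius inside the modulus of continuity d that is at most s, so that the means can be compared. *)
    define a where "a = min s (d / 2)"
    have a: "0 < a" "a \<le> s" "a < d" using d s by (auto simp: a_def)
    have "wmean c s f \<le> wmean c a f" using a by (intro wmean_antimono f le) auto
    also have "\<dots> \<le> wmean c a (\<lambda>_. (f c + e) * 1)"
    proof (rule wmean_mono)
      fix x assume "x \<in> cball c a"
      then have "dist (f x) (f c) < e" using a by (intro d) (auto simp: dist_commute)
      then show "f x \<le> (f c + e) * 1" by (simp add: dist_real_def)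
    qed (use a f continuous_on_subset in \<open>auto intro!: continuous_intros\<close>)
    also have "\<dots> = (f c + e) * wmean c a (\<lambda>_. 1)" by (simp add: wmean_def)
    also have "wmean c a (\<lambda>_. 1) = K" unfolding K_def by (rule wmean_const_eq) (use a s in auto)
    finally show ?thesis .
  qed
  have "wmean c s f \<le> f c * K + e" if e: "e > 0" for e
  proof -
    have "e / (K + 1) * K \<le> e" using K e by (simp add: field_simps)
    then show ?thesis using *[of "e / (K + 1)"] K e by (simp add: algebra_simps)
  qed
  then show ?thesis unfolding K_def[symmetric] by (rule field_le_epsilon)
qed

text \<open>The bump is at least \<open>1 / 2\<close> on the cube of half side \<open>s / (2 N)\<close>.\<close>

lemma integral_bump_power_ge:
  fixes c :: "'a::euclidean_space"
  assumes s: "s > 0"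
  shows "integral (cube c s) (\<lambda>z. bump c s z ^ k) \<ge> (1/2) ^ k * (s / DIM('a)) ^ DIM('a)"
proof -
  let ?r = "s / (2 * DIM('a))"
  have "real DIM('a) \<ge> 1" using DIM_positive[where 'a='a] by linarith
  then have "1 \<le> 2 * real DIM('a)" by linarith
  then have r: "0 < ?r" "?r \<le> s" using s by (simp_all add: field_simps)
  have b: "bump c s z \<ge> 1/2" if "z \<in> cube c ?r" for z
  proof -
    have "norm (z - c) \<le> (\<Sum>i\<in>Basis. \<bar>(z - c) \<bullet> i\<bar>)" by (rule norm_le_l1)
    also have "\<dots> \<le> (\<Sum>i\<in>(Basis::'a set). ?r)" using that by (intro sum_mono) (auto simp: mem_cube)
    also have "\<dots> = s / 2" by simp
    finally have "(norm (z - c))\<^sup>2 \<le> (s / 2)\<^sup>2" by (rule power_mono) simp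
    also have "(s/2)\<^sup>2 \<le> s\<^sup>2 / 2" by (simp add: power_divide)
    finally have "(norm (z - c))\<^sup>2 / s\<^sup>2 \<le> 1 / 2" using s by (simp add: field_simps)
    then show ?thesis by (simp add: bump_def le_max_iff_disj)
  qed
  have "(1/2) ^ k * (s / DIM('a)) ^ DIM('a) = integral (cube c ?r) (\<lambda>_. (1/2)^k)"
    using measure_cube[OF r(1), of c] by (simp add: cube_def)
  also have "\<dots> \<le> integral (cube c ?r) (\<lambda>z. bump c s z ^ k)"
    using b by (intro integral_le integrable_cube continuous_intros power_mono) auto
  also have "\<dots> \<le> integral (cube c s) (\<lambda>z. bump c s z ^ k)"
    using r by (intro integral_subset_le cube_mono integrable_cube continuous_intros) auto
  finally show ?thesis .
qed

lemma wmean_1_bounds: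
  fixes c :: "'a::euclidean_space"
  assumes s: "s > 0"
  shows "0 < wmean c s (\<lambda>_. 1)" "wmean c s (\<lambda>_. 1) \<le> 2 ^ DIM('a)"
proof -
  show "0 < wmean c s (\<lambda>_. 1)"
    using integral_bump_power_ge[OF s, where k = 2 and c = c] s unfolding wmean_def
    by (intro divide_pos_pos) (auto intro: less_le_trans[rotated])
  have "integral (cube c s) (\<lambda>z. 1 * bump c s z ^ 2) \<le> integral (cube c s) (\<lambda>_. 1)"
    by (intro integral_le integrable_cube continuous_intros) (auto simp: bump_le_1 power_le_one)
  also have "\<dots> = (2 * s) ^ DIM('a)" using measure_cube[OF s, of c] by (simp add: cube_def)
  finally show "wmean c s (\<lambda>_. 1) \<le> 2 ^ DIM('a)"
    unfolding wmean_def using s by (simp add: divide_simps power_mult_distrib)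
qed

lemma bump_superharmonic:
  fixes f :: "'a::euclidean_space \<Rightarrow> real"
  assumes f: "C2_fun UNIV f f1 f2" and le: "\<And>x. (\<Sum>i\<in>Basis. f2 i x) \<le> 0" and s: "s > 0"
  shows "integral (cube c s) (\<lambda>z. f z * (\<Sum>i\<in>Basis. bump2 3 c s i z)) \<le> 0"
proof -
  have c: "continuous_on S (f2 i)" if "i \<in> Basis" for i S using C2_funD(3)[OF f that] continuous_on_subset by blast
  have "integral (cube c s) (\<lambda>x. bump c s x ^ 3 * (\<Sum>i\<in>Basis. f2 i x)) \<le> integral (cube c s) (\<lambda>x. 0)"
    by (intro integral_le integrable_cube continuous_intros c mult_nonneg_nonpos le) auto
  then show ?thesis using green_bump[OF f s, of 3 c] by simp
qed

text \<open>The ball of radius \<open>3 s\<close> around \<open>x\<close> contains the ball of radius \<open>s\<close> around \<open>c\<close>, well inside where the weight is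
at least \<open>1 / 4\<close>; the mean value inequality at \<open>x\<close> therefore bounds \<open>f x\<close> below by the mean around \<open>c\<close>.\<close>

lemma weak_Harnack:
  fixes f :: "'a::euclidean_space \<Rightarrow> real"
  assumes f: "C2_fun UNIV f f1 f2" and le: "\<And>x. (\<Sum>i\<in>Basis. f2 i x) \<le> 0" and nonneg: "\<And>x. f x \<ge> 0"
    and s: "s > 0" and x: "x \<in> cball c s"
  shows "wmean c s f / (4 * 6 ^ DIM('a)) \<le> f x"
proof -
  have cf: "continuous_on S f" for S using C2_funD(1)[OF f] continuous_on_subset by blast
  have dx: "dist x c \<le> s" using x by (simp add: dist_commute)
  have "integral (cube c s) (\<lambda>z. f z * bump c s z ^ 2) \<le> integral (cube c s) (\<lambda>z. 4 * (f z * bump x (3 * s) z ^ 2))"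
  proof (intro integral_le integrable_cube continuous_intros cf)
    fix z
    show "f z * (bump c s z)\<^sup>2 \<le> 4 * (f z * (bump x (3 * s) z)\<^sup>2)"
    proof (cases "z \<in> cball c s")
      case True
      then have "dist z x \<le> 2 * s" using dx dist_triangle[of z x c] by (simp add: dist_commute)
      then have "(norm (z - x))\<^sup>2 \<le> (2 * s)\<^sup>2" by (intro power_mono) (auto simp: dist_norm)
      then have "(norm (z - x))\<^sup>2 / (3 * s)\<^sup>2 \<le> 1 / 2" using s
        by (simp add: power_mult_distrib divide_simps) (smt (verit) zero_le_power2)
      then have "bump x (3 * s) z \<ge> 1/2" by (simp add: bump_def le_max_iff_disj)
      then have "(bump x (3 * s) z)\<^sup>2 \<ge> (1/2)\<^sup>2" by (intro power_mono) auto
      moreover have "(bump c s z)\<^sup>2 \<le> 1" by (simp add: bump_le_1 power_le_one)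
      ultimately have "(bump c s z)\<^sup>2 \<le> 4 * (bump x (3 * s) z)\<^sup>2" by (simp add: power_divide)
      from mult_left_mono[OF this nonneg[of z]] show ?thesis by (simp add: algebra_simps)
    next
      case False
      then show ?thesis using nonneg[of z] bump_eq_0[OF s False] by simp
    qed
  qed
  also have "\<dots> = 4 * integral (cube c s) (\<lambda>z. f z * bump x (3 * s) z ^ 2)" by (rule integral_mult_right)
  also have "\<dots> \<le> 4 * integral (cube x (3 * s)) (\<lambda>z. f z * bump x (3 * s) z ^ 2)"
  proof (intro mult_left_mono integral_subset_le integrable_cube continuous_intros cf)
    show "cube c s \<subseteq> cube x (3 * s)"
    proof
      fix z assume z: "z \<in> cube c s"
      have "\<bar>(z - x) \<bullet> i\<bar> \<le> 3 * s" if i: "i \<in> Basis" for i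
      proof -
        have "\<bar>(z - c) \<bullet> i\<bar> \<le> s" using z i by (simp add: mem_cube)
        moreover have "\<bar>(x - c) \<bullet> i\<bar> \<le> s"
          using Basis_le_norm[OF i, of "x - c"] dx by (simp add: dist_norm)
        ultimately show ?thesis using s by (simp add: inner_diff_left)
      qed
      then show "z \<in> cube x (3 * s)" by (simp add: mem_cube)
    qed
  qed (use nonneg in auto)
  finally have "wmean c s f \<le> 4 * (3 ^ DIM('a) * wmean x (3 * s) f)"
    unfolding wmean_def using s by (simp add: divide_simps power_mult_distrib)
  also have "wmean x (3 * s) f \<le> f x * wmean x (3 * s) (\<lambda>_. 1)"
    using s by (intro wmean_le_value cf bump_superharmonic[OF f le]) auto
  also have "\<dots> \<le> f x * 2 ^ DIM('a)"
    using s nonneg by (intro mult_left_mono wmean_1_bounds) auto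
  finally show ?thesis
    using power_mult_distrib[of "2::real" 3 "DIM('a)"] by (simp add: field_simps)
qed

section \<open>Decay of the means and the comparison of the two components\<close>

text \<open>Green's formula against \<open>bump c s\<^sup>3\<close>: the Laplacian of the bump power is bounded below by
\<open>- 6 N bump c s\<^sup>2 / s\<^sup>2\<close>, the dropped term having the favourable sign.\<close>

lemma source_le_wmean:
  fixes f :: "'a::euclidean_space \<Rightarrow> real"
  assumes f: "C2_fun UNIV f f1 f2" and le: "\<And>x. (\<Sum>i\<in>Basis. f2 i x) \<le> 0" and nonneg: "\<And>x. f x \<ge> 0"
    and s: "s > 0" and m: "m \<ge> 0" "\<And>x. x \<in> cball c s \<Longrightarrow> m \<le> - (\<Sum>i\<in>Basis. f2 i x)"
  shows "m \<le> 48 * real DIM('a) ^ Suc DIM('a) * wmean c s f / s\<^sup>2"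
proof -
  let ?N = "DIM('a)"
  have cf: "continuous_on S f" for S using C2_funD(1)[OF f] continuous_on_subset by blast
  have c2: "continuous_on S (f2 i)" if "i \<in> Basis" for i S using C2_funD(3)[OF f that] continuous_on_subset by blast
  have "m * ((1/2)^3 * (s / ?N) ^ ?N) \<le> m * integral (cube c s) (\<lambda>z. bump c s z ^ 3)"
    using integral_bump_power_ge[OF s, where k = 3 and c = c] m(1) by (intro mult_left_mono) auto
  also have "\<dots> = integral (cube c s) (\<lambda>z. m * bump c s z ^ 3)" by (rule integral_mult_right[symmetric])
  also have "\<dots> \<le> integral (cube c s) (\<lambda>z. - (bump c s z ^ 3 * (\<Sum>i\<in>Basis. f2 i z)))"
  proof (intro integral_le integrable_cube continuous_intros c2)
    fix z
    show "m * bump c s z ^ 3 \<le> - (bump c s z ^ 3 * (\<Sum>i\<in>Basis. f2 i z))"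
      using mult_right_mono[OF m(2)[of z], of "bump c s z ^ 3"] bump_eq_0[OF s, of z c]
      by (cases "z \<in> cball c s") (auto simp: mult.commute)
  qed
  also have "\<dots> = integral (cube c s) (\<lambda>z. - (f z * (\<Sum>i\<in>Basis. bump2 3 c s i z)))"
    using green_bump[OF f s, of 3 c] by simp
  also have "\<dots> \<le> integral (cube c s) (\<lambda>z. (6 * real ?N / s\<^sup>2) * (f z * bump c s z ^ 2))"
  proof (intro integral_le integrable_cube continuous_intros continuous_bump12 cf)
    fix z
    have "- (6 * real ?N / s\<^sup>2) * bump c s z ^ 2 \<le> (\<Sum>i\<in>Basis. bump2 3 c s i z)"
    proof -
      have "- (6 * real ?N * bump c s z ^ 2) / s\<^sup>2
        \<le> (24 * bump c s z * (1 - bump c s z) - 6 * real ?N * bump c s z ^ 2) / s\<^sup>2"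
        using bump_le_1[of c s z] by (intro divide_right_mono) auto
      then show ?thesis using sum_bump2[of s 3 c z] s by simp
    qed
    then have "- (\<Sum>i\<in>Basis. bump2 3 c s i z) \<le> (6 * real ?N / s\<^sup>2) * bump c s z ^ 2" by simp
    from mult_left_mono[OF this nonneg[of z]]
    show "- (f z * (\<Sum>i\<in>Basis. bump2 3 c s i z)) \<le> (6 * real ?N / s\<^sup>2) * (f z * bump c s z ^ 2)"
      by (simp add: algebra_simps)
  qed
  also have "\<dots> = (6 * real ?N / s\<^sup>2) * (s ^ ?N * wmean c s f)"
    unfolding wmean_def integral_mult_right using s by simp
  finally have "m * ((1/2)^3 * (s / ?N) ^ ?N) \<le> (6 * real ?N / s\<^sup>2) * (s ^ ?N * wmean c s f)" .
  then have "m * s ^ ?N \<le> (48 * real ?N ^ Suc ?N * wmean c s f / s\<^sup>2) * s ^ ?N"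
    using s by (simp add: field_simps power_divide power3_eq_cube)
  then show ?thesis by (rule mult_right_le_imp_le) (use s in simp)
qed

locale lane_emden =
  fixes p q :: real and u v :: "'a::euclidean_space \<Rightarrow> real" and u1 u2 v1 v2 :: "'a \<Rightarrow> 'a \<Rightarrow> real"
  assumes pq: "p > 0" "q > 0" "p * q > 1"
    and Cu: "C2_fun UNIV u u1 u2" and Cv: "C2_fun UNIV v v1 v2"
    and u_pos: "\<And>x. u x > 0" and v_pos: "\<And>x. v x > 0"
    and eq_u: "\<And>x. - (\<Sum>i\<in>Basis. u2 i x) = v x powr p"
    and eq_v: "\<And>x. - (\<Sum>i\<in>Basis. v2 i x) = u x powr q"
begin

lemma cont_uv: "continuous_on S u" "continuous_on S v"
  using C2_funD(1)[OF Cu] C2_funD(1)[OF Cv] continuous_on_subset by blast+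

lemma cont_d: "i \<in> Basis \<Longrightarrow> continuous_on S (u1 i)" "i \<in> Basis \<Longrightarrow> continuous_on S (v1 i)"
  "i \<in> Basis \<Longrightarrow> continuous_on S (u2 i)" "i \<in> Basis \<Longrightarrow> continuous_on S (v2 i)"
  using C2_funD(2,3)[OF Cu] C2_funD(2,3)[OF Cv] continuous_on_subset by blast+

lemma cont_powr: "continuous_on S (\<lambda>x. u x powr r)" "continuous_on S (\<lambda>x. v x powr r)"
  using u_pos v_pos by (auto intro!: continuous_intros cont_uv) (metis less_irrefl)+

lemma superharmonic: "(\<Sum>i\<in>Basis. u2 i x) \<le> 0" "(\<Sum>i\<in>Basis. v2 i x) \<le> 0"
  using eq_u[of x] eq_v[of x] powr_ge_zero[of "v x" p] powr_ge_zero[of "u x" q] by linarith+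

text \<open>Let \<open>a\<close>, \<open>b\<close> be the means of \<open>u\<close>, \<open>v\<close> over a ball of radius \<open>s\<close>. The lower bounds of \<open>u\<close> and \<open>v\<close> by their means,
inserted in the two equations, give \<open>b\<^sup>p \<le> const a / s\<^sup>2\<close> and \<open>a\<^sup>q \<le> const b / s\<^sup>2\<close>, hence
\<open>b\<^bsup>pq-1\<^esup> \<le> const s\<^bsup>-2-2q\<^esup>\<close>. Working with lower bounds instead of Jensen's inequality allows \<open>q < 1\<close>.\<close>

lemma ex_small_wmean:
  assumes e: "e > 0"
  shows "\<exists>s>0. wmean c s v < e"
proof (rule ccontr)
  assume "\<not> ?thesis"
  then have b: "wmean c s v \<ge> e" if "s > 0" for s using that by force
  define K where "K = 48 * real DIM('a) ^ Suc DIM('a)"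
  define k where "k = 1 / (4 * 6 ^ DIM('a) :: real)"
  have K: "K > 0" and k: "k > 0" by (auto simp: K_def k_def)
  have key: "(k * e) powr (p * q - 1) * k \<le> (K / (k * T)) powr q * (K / T)" if T: "T > 0" for T
  proof -
    define s where "s = sqrt T"
    have s: "s > 0" "s\<^sup>2 = T" using T by (auto simp: s_def)
    define a where "a = wmean c s u"
    define b where "b = wmean c s v"
    have be: "b \<ge> e" using b[OF s(1)] by (simp add: b_def)
    have a0: "a \<ge> 0" unfolding a_def wmean_def using s u_pos
      by (intro divide_nonneg_nonneg integral_nonneg integrable_cube continuous_intros cont_uv) (auto simp: less_imp_le)
    have b0: "b > 0" using be e by simp
    have v: "k * b \<le> v x" if "x \<in> cball c s" for x
      using weak_Harnack[OF Cv superharmonic(2) less_imp_le[OF v_pos] s(1) that] by (simp add: k_def b_def)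
    have u: "k * a \<le> u x" if "x \<in> cball c s" for x
      using weak_Harnack[OF Cu superharmonic(1) less_imp_le[OF u_pos] s(1) that] by (simp add: k_def a_def)
    have 1: "(k * b) powr p \<le> K * a / T"
      unfolding K_def a_def s(2)[symmetric]
    proof (rule source_le_wmean[OF Cu superharmonic(1) less_imp_le[OF u_pos] s(1)])
      fix x assume "x \<in> cball c s"
      then show "(k * b) powr p \<le> - (\<Sum>i\<in>Basis. u2 i x)"
        unfolding eq_u using v k b0 pq by (intro powr_mono2) auto
    qed simp
    have 2: "(k * a) powr q \<le> K * b / T"
      unfolding K_def b_def s(2)[symmetric]
    proof (rule source_le_wmean[OF Cv superharmonic(2) less_imp_le[OF v_pos] s(1)])
      fix x assume "x \<in> cball c s"
      then show "(k * a) powr q \<le> - (\<Sum>i\<in>Basis. v2 i x)"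
        unfolding eq_v using u k a0 pq by (intro powr_mono2) auto
    qed simp
    have "(k * e) powr (p * q - 1) * (k * b) \<le> (k * b) powr (p * q - 1) * (k * b)"
      using k e be pq by (intro mult_right_mono powr_mono2) auto
    also have "\<dots> = (k * b) powr (p * q)"
      using k b0 powr_add[of "k * b" "p * q - 1" 1] by simp
    also have "\<dots> = ((k * b) powr p) powr q" by (simp add: powr_powr)
    also have "\<dots> \<le> (K * a / T) powr q" using 1 pq by (intro powr_mono2) auto
    also have "K * a / T = K / (k * T) * (k * a)" using k by simp
    also have "\<dots> powr q = (K / (k * T)) powr q * (k * a) powr q"
      using K k T a0 by (intro powr_mult)
    also have "\<dots> \<le> (K / (k * T)) powr q * (K * b / T)" by (intro mult_left_mono 2) auto
    finally have "((k * e) powr (p * q - 1) * k) * b \<le> ((K / (k * T)) powr q * (K / T)) * b" by (simp add: mult_ac)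
    then show ?thesis by (rule mult_right_le_imp_le) (rule b0)
  qed
  define M where "M = (k * e) powr (p * q - 1) * k"
  have M: "M > 0" using k e by (auto simp: M_def)
  (* A squared radius beyond which the right hand side of key is at most M / 2. *)
  define T where "T = max (K / k) (2 * K / M)"
  have T: "T > 0" "K / (k * T) \<le> 1" "K / T \<le> M / 2"
    using K k M by (auto simp: T_def field_simps max_def split: if_splits)
  have "M \<le> (K / (k * T)) powr q * (K / T)" using key[OF T(1)] by (simp add: M_def)
  also have "\<dots> \<le> 1 * (M / 2)"
    using T K k pq by (intro mult_mono powr_le1) auto
  finally show False using M by simp
qed

text \<open>The value of \<open>f\<close> at \<open>c\<close> is bounded by its means, and these are bounded by the means of \<open>v\<close>.\<close>

lemma subharmonic_below_v_nonpos:
  assumes f: "C2_fun UNIV f f1 f2" and ge: "\<And>x. (\<Sum>i\<in>Basis. f2 i x) \<ge> 0" and le: "\<And>x. f x \<le> v x"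
  shows "f c \<le> 0"
proof (rule ccontr)
  assume "\<not> f c \<le> 0"
  define K where "K = wmean c 1 (\<lambda>_::'a. 1)"
  have K: "K > 0" unfolding K_def by (rule wmean_1_bounds) simp
  have cf: "continuous_on S f" for S using C2_funD(1)[OF f] continuous_on_subset by blast
  obtain s where s: "s > 0" "wmean c s v < f c * K"
    using ex_small_wmean[of "f c * K" c] K \<open>\<not> f c \<le> 0\<close> by auto
  have neg: "C2_fun UNIV (\<lambda>x. - f x) (\<lambda>i x. - f1 i x) (\<lambda>i x. - f2 i x)"
    using f unfolding C2_fun_def has_slope_def by (auto intro!: continuous_intros DERIV_minus)
  have "wmean c s (\<lambda>x. - f x) \<le> - f c * wmean c s (\<lambda>_. 1)"
    using ge by (intro wmean_le_value bump_superharmonic[OF neg] continuous_intros cf s) (auto simp: sum_negf)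
  also have "wmean c s (\<lambda>_. 1) = K" unfolding K_def by (rule wmean_const_eq) (use s in auto)
  finally have "f c * K \<le> wmean c s f" by (simp add: wmean_def)
  also have "\<dots> \<le> wmean c s v" by (intro wmean_mono cf cont_uv le s)
  finally show False using s by simp
qed

end

lemma C2_fun_compose:
  assumes f: "C2_fun S f f1 f2" and g: "\<And>t. (g has_real_derivative g1 t) (at t)"
    "\<And>t. (g1 has_real_derivative g2 t) (at t)" and c: "continuous_on UNIV g2"
  shows "C2_fun S (\<lambda>x. g (f x)) (\<lambda>i x. g1 (f x) * f1 i x) (\<lambda>i x. g2 (f x) * (f1 i x)\<^sup>2 + g1 (f x) * f2 i x)"
proof -
  note f' = C2_funD[OF f]
  have cg: "continuous_on A (\<lambda>x. g (f x))" "continuous_on A (\<lambda>x. g1 (f x))" "continuous_on A (\<lambda>x. g2 (f x))"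
    if "A \<subseteq> S" for A
  proof -
    have "continuous_on UNIV h" if "\<And>t. (h has_real_derivative h' t) (at t)" for h h' :: "real \<Rightarrow> real"
      by (rule DERIV_continuous_on) (rule has_field_derivative_at_within[OF that])
    then have "continuous_on UNIV g" "continuous_on UNIV g1" using g by metis+
    then show "continuous_on A (\<lambda>x. g (f x))" "continuous_on A (\<lambda>x. g1 (f x))" "continuous_on A (\<lambda>x. g2 (f x))"
      using c by (simp_all add: continuous_on_compose2[OF _ continuous_on_subset[OF f'(1) that] subset_UNIV])
  qed
  have ch: "has_slope i (\<lambda>x. h (f x)) (h' (f x) * f1 i x) x"
    if "\<And>t. (h has_real_derivative h' t) (at t)" "i \<in> Basis" "x \<in> S" for h h' i x
    using DERIV_chain2[OF that(1) f'(4)[OF that(2,3), unfolded has_slope_def]] by (simp add: has_slope_def)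
  show ?thesis
    unfolding C2_fun_def
  proof (intro conjI ballI)
    fix i x :: 'a assume i: "i \<in> Basis" and x: "x \<in> S"
    show "has_slope i (\<lambda>x. g (f x)) (g1 (f x) * f1 i x) x" by (rule ch[OF g(1) i x])
    show "has_slope i (\<lambda>x. g1 (f x) * f1 i x) (g2 (f x) * (f1 i x)\<^sup>2 + g1 (f x) * f2 i x) x"
      by (rule has_slope_eq[OF has_slope_mult[OF ch[OF g(2) i x] f'(5)[OF i x]]]) (simp add: power2_eq_square)
  qed (auto intro!: continuous_intros cg f')
qed

text \<open>A convex, twice continuously differentiable substitute for the positive part: it is positive exactly on the
positive numbers and stays below the positive part, so that its value at \<open>w \<le> v\<close> is at most \<open>v\<close> for positive \<open>v\<close>.\<close>

definition pos_part :: "real \<Rightarrow> real" where "pos_part t = (max 0 t) ^ 3 / (1 + max 0 t)\<^sup>2"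
definition pos_part1 :: "real \<Rightarrow> real" where "pos_part1 t = ((max 0 t) ^ 3 + 3 * (max 0 t)\<^sup>2) / (1 + max 0 t) ^ 3"
definition pos_part2 :: "real \<Rightarrow> real" where "pos_part2 t = 6 * max 0 t / (1 + max 0 t) ^ 4"

lemma pos_part_deriv:
  "(pos_part has_real_derivative pos_part1 t) (at t)"
  "(pos_part1 has_real_derivative pos_part2 t) (at t)"
  "continuous_on UNIV pos_part2"
proof -
  have "((\<lambda>t. t ^ 3 / (1 + t)\<^sup>2) has_real_derivative (t ^ 3 + 3 * t\<^sup>2) / (1 + t) ^ 3) (at t)" if "t \<ge> 0" for t :: real
  proof -
    have "((\<lambda>t. t ^ 3 / (1 + t)\<^sup>2) has_real_derivative (3 * t\<^sup>2 * (1 + t)\<^sup>2 - t ^ 3 * (2 * (1 + t))) / ((1 + t)\<^sup>2 * (1 + t)\<^sup>2)) (at t)"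
      by (rule derivative_eq_intros refl)+ (use that in \<open>auto simp: numeral_2_eq_2\<close>)
    also have "(3 * t\<^sup>2 * (1 + t)\<^sup>2 - t ^ 3 * (2 * (1 + t))) = (t ^ 3 + 3 * t\<^sup>2) * (1 + t)"
      by (simp add: algebra_simps power2_eq_square power3_eq_cube)
    also have "(t ^ 3 + 3 * t\<^sup>2) * (1 + t) / ((1 + t)\<^sup>2 * (1 + t)\<^sup>2) = (t ^ 3 + 3 * t\<^sup>2) / (1 + t) ^ 3"
    proof -
      have "(1 + t)\<^sup>2 * (1 + t)\<^sup>2 = (1 + t) ^ 3 * (1 + t)" by algebra
      then show ?thesis
        using that by (simp only:) (subst nonzero_mult_divide_mult_cancel_right, simp_all)
    qed
    finally show ?thesis .
  qed
  from DERIV_max0[where g = "\<lambda>t. t ^ 3 / (1 + t)\<^sup>2" and g' = "\<lambda>t. (t ^ 3 + 3 * t\<^sup>2) / (1 + t) ^ 3", OF this]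
  show "(pos_part has_real_derivative pos_part1 t) (at t)"
    by (simp add: pos_part_def[abs_def] pos_part1_def)
  have "((\<lambda>t. (t ^ 3 + 3 * t\<^sup>2) / (1 + t) ^ 3) has_real_derivative 6 * t / (1 + t) ^ 4) (at t)" if "t \<ge> 0" for t :: real
  proof -
    have "((\<lambda>t. (t ^ 3 + 3 * t\<^sup>2) / (1 + t) ^ 3) has_real_derivative
      ((3 * t\<^sup>2 + 3 * (2 * t)) * (1 + t) ^ 3 - (t ^ 3 + 3 * t\<^sup>2) * (3 * (1 + t)\<^sup>2)) / ((1 + t) ^ 3 * (1 + t) ^ 3)) (at t)"
      by (rule derivative_eq_intros refl)+ (use that in \<open>auto simp: numeral_2_eq_2\<close>)
    also have "((3 * t\<^sup>2 + 3 * (2 * t)) * (1 + t) ^ 3 - (t ^ 3 + 3 * t\<^sup>2) * (3 * (1 + t)\<^sup>2)) = 6 * t * (1 + t)\<^sup>2"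
      by algebra
    also have "6 * t * (1 + t)\<^sup>2 / ((1 + t) ^ 3 * (1 + t) ^ 3) = 6 * t / (1 + t) ^ 4"
    proof -
      have "(1 + t) ^ 3 * (1 + t) ^ 3 = (1 + t) ^ 4 * (1 + t)\<^sup>2" by algebra
      then show ?thesis
        using that by (simp only:) (subst nonzero_mult_divide_mult_cancel_right, simp_all)
    qed
    finally show ?thesis .
  qed
  from DERIV_max0[where g = "\<lambda>t. (t ^ 3 + 3 * t\<^sup>2) / (1 + t) ^ 3" and g' = "\<lambda>t. 6 * t / (1 + t) ^ 4", OF this]
  show "(pos_part1 has_real_derivative pos_part2 t) (at t)"
    by (simp add: pos_part1_def[abs_def] pos_part2_def)
  show "continuous_on UNIV pos_part2"
    unfolding pos_part2_def[abs_def] by (intro continuous_intros) (auto simp: add_nonneg_eq_0_iff)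
qed

lemma pos_part_props:
  "pos_part t \<le> max 0 t" "t \<le> 0 \<Longrightarrow> pos_part1 t = 0" "pos_part1 t \<ge> 0" "pos_part2 t \<ge> 0" "t > 0 \<Longrightarrow> pos_part t > 0"
proof -
  have "T ^ 3 \<le> T * (1 + T)\<^sup>2" if "T \<ge> 0" for T :: real
    using that by (simp add: power2_eq_square power3_eq_cube algebra_simps)
  then show "pos_part t \<le> max 0 t"
    by (simp add: pos_part_def divide_le_eq)
qed (auto simp: pos_part_def pos_part1_def pos_part2_def)

context lane_emden
begin

text \<open>Put \<open>\<sigma> = (q + 1) / (p + 1) \<le> 1\<close> and \<open>w = v - l u\<^bsup>\<sigma>\<^esup>\<close>. As \<open>u\<^bsup>\<sigma>\<^esup>\<close> is a concave function of \<open>u\<close>, the gradient term in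
\<open>\<Delta>w\<close> is nonnegative, and \<open>l\<close> is chosen such that \<open>\<Delta>w \<ge> l \<sigma> u\<^bsup>\<sigma>-1\<^esup> (v\<^sup>p - (l u\<^bsup>\<sigma>\<^esup>)\<^sup>p)\<close>. So \<open>w\<close> is subharmonic
where it is positive.\<close>

lemma comparison:
  assumes qp: "q \<le> p" and l: "l > 0" "l powr (p + 1) = (p + 1) / (q + 1)"
  shows "v x \<le> l * u x powr ((q + 1) / (p + 1))"
proof -
  define \<sigma> where "\<sigma> = (q + 1) / (p + 1)"
  have \<sigma>: "0 < \<sigma>" "\<sigma> \<le> 1" "\<sigma> * (p + 1) = q + 1" using pq qp by (auto simp: \<sigma>_def)
  define w where "w = (\<lambda>x. v x - l * u x powr \<sigma>)"
  define w1 where "w1 = (\<lambda>i x. v1 i x - l * (\<sigma> * u x powr (\<sigma> - 1) * u1 i x))"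
  define w2 where "w2 = (\<lambda>i x. v2 i x - l * \<sigma> * ((\<sigma> - 1) * u x powr (\<sigma> - 2) * (u1 i x)\<^sup>2 + u x powr (\<sigma> - 1) * u2 i x))"
  note du = C2_funD(4,5)[OF Cu _ UNIV_I] and dv = C2_funD(4,5)[OF Cv _ UNIV_I]
  have C2w: "C2_fun UNIV w w1 w2"
    unfolding C2_fun_def
  proof (intro conjI ballI)
    fix i x :: 'a assume i: "i \<in> Basis"
    show "has_slope i w (w1 i x) x"
      unfolding w_def w1_def
      by (rule has_slope_diff[OF dv(1)[OF i] has_slope_cmult[OF has_slope_powr[OF du(1)[OF i] u_pos]]])
    have "has_slope i (w1 i) (v2 i x - l * (\<sigma> * ((\<sigma> - 1) * u x powr (\<sigma> - 1 - 1) * u1 i x * u1 i x + u x powr (\<sigma> - 1) * u2 i x))) x"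
      unfolding w1_def mult.assoc[of \<sigma>]
      by (rule has_slope_diff[OF dv(2)[OF i] has_slope_cmult[OF has_slope_cmult[OF
            has_slope_mult[OF has_slope_powr[OF du(1)[OF i] u_pos] du(2)[OF i]]]]])
    then show "has_slope i (w1 i) (w2 i x) x"
      by (rule has_slope_eq) (simp add: w2_def power2_eq_square mult.assoc)
  qed (auto simp: w_def[abs_def] w1_def[abs_def] w2_def[abs_def] intro!: continuous_intros cont_uv cont_d cont_powr)
  have sub: "(\<Sum>i\<in>Basis. w2 i x) \<ge> 0" if "w x > 0" for x
  proof -
    have "(\<Sum>i\<in>Basis. w2 i x) = (\<Sum>i\<in>Basis. v2 i x) - l * \<sigma> * ((\<sigma> - 1) * u x powr (\<sigma> - 2) * (\<Sum>i\<in>Basis. (u1 i x)\<^sup>2) + u x powr (\<sigma> - 1) * (\<Sum>i\<in>Basis. u2 i x))"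
      by (simp add: w2_def sum_subtractf sum.distrib flip: sum_distrib_left)
    also have "\<dots> = - (u x powr q) + l * \<sigma> * (1 - \<sigma>) * u x powr (\<sigma> - 2) * (\<Sum>i\<in>Basis. (u1 i x)\<^sup>2) + l * \<sigma> * u x powr (\<sigma> - 1) * v x powr p"
      unfolding eq_u[of x, symmetric] eq_v[of x, symmetric] by (simp add: algebra_simps)
    also have "\<dots> \<ge> - (u x powr q) + l * \<sigma> * u x powr (\<sigma> - 1) * v x powr p"
      using \<sigma> l by (simp add: sum_nonneg)
    finally have 1: "(\<Sum>i\<in>Basis. w2 i x) \<ge> - (u x powr q) + l * \<sigma> * u x powr (\<sigma> - 1) * v x powr p" .
    have "u x powr q = (l powr (p + 1) * \<sigma>) * u x powr (\<sigma> - 1 + \<sigma> * p)"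
    proof -
      have "\<sigma> - 1 + \<sigma> * p = q" using \<sigma>(3) by (simp add: algebra_simps)
      moreover have "l powr (p + 1) * \<sigma> = 1" unfolding l(2) \<sigma>_def using pq by simp
      ultimately show ?thesis by simp
    qed
    also have "\<dots> = l * \<sigma> * u x powr (\<sigma> - 1) * (l * u x powr \<sigma>) powr p"
    proof -
      have 1: "l powr (p + 1) = l powr p * l" using l(1) by (simp add: powr_add)
      have 2: "(l * u x powr \<sigma>) powr p = l powr p * u x powr (\<sigma> * p)"
        using l(1) by (simp add: powr_mult powr_powr)
      show ?thesis unfolding 1 2 powr_add[of "u x"] by (simp only: mult_ac)
    qed
    also have "\<dots> \<le> l * \<sigma> * u x powr (\<sigma> - 1) * v x powr p"
      using that l \<sigma> pq by (intro mult_left_mono powr_mono2) (auto simp: w_def)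
    finally show ?thesis using 1 by simp
  qed
  have "pos_part (w x) \<le> 0"
  proof (rule subharmonic_below_v_nonpos[OF C2_fun_compose[OF C2w pos_part_deriv]])
    fix x
    have "(\<Sum>i\<in>Basis. pos_part2 (w x) * (w1 i x)\<^sup>2 + pos_part1 (w x) * w2 i x)
      = pos_part2 (w x) * (\<Sum>i\<in>Basis. (w1 i x)\<^sup>2) + pos_part1 (w x) * (\<Sum>i\<in>Basis. w2 i x)"
      by (simp add: sum.distrib flip: sum_distrib_left)
    also have "\<dots> \<ge> 0"
    proof (intro add_nonneg_nonneg)
      show "0 \<le> pos_part2 (w x) * (\<Sum>i\<in>Basis. (w1 i x)\<^sup>2)"
        by (intro mult_nonneg_nonneg sum_nonneg pos_part_props) simp
      show "0 \<le> pos_part1 (w x) * (\<Sum>i\<in>Basis. w2 i x)"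
      proof (cases "w x > 0")
        case True
        show ?thesis by (intro mult_nonneg_nonneg sub[OF True] pos_part_props)
      qed (simp add: pos_part_props)
    qed
    finally show "0 \<le> (\<Sum>i\<in>Basis. pos_part2 (w x) * (w1 i x)\<^sup>2 + pos_part1 (w x) * w2 i x)" .
    have "w x \<le> v x" using l by (simp add: w_def)
    then show "pos_part (w x) \<le> v x" using pos_part_props(1)[of "w x"] v_pos[of x] by simp
  qed
  then have "w x \<le> 0" using pos_part_props(5)[of "w x"] by linarith
  then show ?thesis by (simp add: w_def \<sigma>_def)
qed

end

section \<open>The stability inequality\<close>

text \<open>An open set has no nonempty relatively open null subset.\<close>

lemma AE_nonneg_imp_nonneg:
  fixes g :: "'a::euclidean_space \<Rightarrow> real"
  assumes "open S" "continuous_on S g" "AE x\<in>S in lebesgue. 0 \<le> g x" "x \<in> S"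
  shows "0 \<le> g x"
proof -
  have "closedin (top_of_set S) (S \<inter> g -` {0..})"
    using assms(2) by (rule continuous_closedin_preimage) simp
  then obtain T where T: "closed T" "S \<inter> g -` {0..} = S \<inter> T"
    unfolding closedin_closed by auto
  have "AE x\<in>S in lebesgue. x \<in> T" using assms(3) by (rule AE_mp) (use T(2) in \<open>auto intro!: AE_I2\<close>)
  from mem_closed_if_AE_lebesgue_open[OF assms(1) T(1) this assms(4)] show ?thesis
    using T(2) assms(4) by auto
qed

text \<open>Test the supersolution \<open>\<xi>\<close> with \<open>f\<^sup>2 / \<xi>\<close> and complete the square:
\<open>\<bar>\<nabla>f\<bar>\<^sup>2 - \<nabla>\<xi> \<bullet> \<nabla>(f\<^sup>2 / \<xi>) = \<bar>\<nabla>f - f \<nabla>\<xi> / \<xi>\<bar>\<^sup>2 \<ge> 0\<close>.\<close>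

lemma supersolution_inequality:
  fixes f \<xi> :: "'a::euclidean_space \<Rightarrow> real"
  assumes \<Omega>: "open \<Omega>" "cube c R \<subseteq> \<Omega>" and R: "R > 0"
    and \<xi>: "C2_fun \<Omega> \<xi> \<xi>1 \<xi>2" "\<And>x. x \<in> \<Omega> \<Longrightarrow> \<xi> x > 0"
    and f: "continuous_on UNIV f" "\<And>i. i \<in> Basis \<Longrightarrow> continuous_on UNIV (f1 i)"
      "\<And>i x. i \<in> Basis \<Longrightarrow> has_slope i f (f1 i x) x" "\<And>x. bump c R x = 0 \<Longrightarrow> f x = 0"
  shows "integral (cube c R) (\<lambda>x. - (\<Sum>i\<in>Basis. \<xi>2 i x) / \<xi> x * (f x)\<^sup>2)
    \<le> integral (cube c R) (\<lambda>x. \<Sum>i\<in>Basis. (f1 i x)\<^sup>2)"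
proof -
  note \<xi>' = C2_funD[OF \<xi>(1)]
  have cf: "continuous_on A f" "i \<in> Basis \<Longrightarrow> continuous_on A (f1 i)" for A i
    using f(1,2) continuous_on_subset by blast+
  have c\<xi>: "continuous_on A \<xi>" "i \<in> Basis \<Longrightarrow> continuous_on A (\<xi>1 i)" "i \<in> Basis \<Longrightarrow> continuous_on A (\<xi>2 i)"
    if "A \<subseteq> \<Omega>" for A i
    using \<xi>'(1-3) continuous_on_subset that by blast+
  have nz: "\<And>x. x \<in> \<Omega> \<Longrightarrow> \<xi> x \<noteq> 0" using \<xi>(2) by force
  define F where "F = (\<lambda>i x. - 1 * (\<xi>1 i x / \<xi> x * (f x * f x)))"
  define D where "D = (\<lambda>i x. - 1 * ((\<xi>2 i x * \<xi> x - \<xi>1 i x * \<xi>1 i x) / (\<xi> x * \<xi> x) * (f x * f x)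
      + \<xi>1 i x / \<xi> x * (f1 i x * f x + f x * f1 i x)))"
  show ?thesis
  proof (rule integral_le_mod_divergence[OF R \<Omega>, where F = F and D = D])
    fix i x :: 'a assume i: "i \<in> Basis" and x: "x \<in> \<Omega>"
    show "has_slope i (F i) (D i x) x"
      unfolding F_def D_def
      by (rule has_slope_cmult[OF has_slope_mult[OF has_slope_divide[OF \<xi>'(5,4)[OF i x] nz[OF x]]
            has_slope_mult[OF f(3)[OF i] f(3)[OF i]]]])
  next
    fix x assume "x \<in> cube c R"
    then have x: "\<xi> x > 0" using \<Omega>(2) \<xi>(2) by auto
    have "(f1 i x)\<^sup>2 + D i x = - \<xi>2 i x / \<xi> x * (f x)\<^sup>2 + (f1 i x - f x * \<xi>1 i x / \<xi> x)\<^sup>2" for i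
      using x by (simp add: D_def field_simps power2_eq_square)
    then have "(f1 i x)\<^sup>2 + D i x \<ge> - \<xi>2 i x / \<xi> x * (f x)\<^sup>2" for i by simp
    then have "(\<Sum>i\<in>Basis. - \<xi>2 i x / \<xi> x * (f x)\<^sup>2) \<le> (\<Sum>i\<in>Basis. (f1 i x)\<^sup>2 + D i x)"
      by (intro sum_mono)
    then show "- (\<Sum>i\<in>Basis. \<xi>2 i x) / \<xi> x * (f x)\<^sup>2 \<le> (\<Sum>i\<in>Basis. (f1 i x)\<^sup>2) + (\<Sum>i\<in>Basis. D i x)"
      by (simp add: sum.distrib sum_negf sum_divide_distrib sum_distrib_right)
  next
    show "continuous_on (cube c R) (\<lambda>x. - (\<Sum>i\<in>Basis. \<xi>2 i x) / \<xi> x * (f x)\<^sup>2)"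
      using nz \<Omega>(2) by (intro continuous_intros c\<xi> cf) auto
    show "continuous_on (cube c R) (\<lambda>x. \<Sum>i\<in>Basis. (f1 i x)\<^sup>2)"
      by (intro continuous_intros cf)
  next
    fix i :: 'a assume i: "i \<in> Basis"
    show "continuous_on \<Omega> (F i)" unfolding F_def
      using nz by (intro continuous_intros c\<xi> cf i) auto
    show "continuous_on \<Omega> (D i)" unfolding D_def
      using nz by (intro continuous_intros c\<xi> cf i) auto
  qed (auto simp: F_def D_def f(4))
qed

text \<open>The functions \<open>\<xi>\<close> and \<open>\<zeta>\<close> give the potentials \<open>p v\<^bsup>p-1\<^esup> \<zeta> / \<xi>\<close> and \<open>q u\<^bsup>q-1\<^esup> \<xi> / \<zeta>\<close>. In their geometric mean
\<open>\<xi>\<close> and \<open>\<zeta>\<close> cancel.\<close>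

lemma stable_in_inequality:
  fixes u v f :: "'a::euclidean_space \<Rightarrow> real"
  assumes st: "stable_in p q u v \<Omega>" and pq: "p > 0" "q > 0"
    and uv: "continuous_on UNIV u" "continuous_on UNIV v" "\<And>x. u x > 0" "\<And>x. v x > 0"
    and \<Omega>: "open \<Omega>" "cube c R \<subseteq> \<Omega>" and R: "R > 0"
    and f: "continuous_on UNIV f" "\<And>i. i \<in> Basis \<Longrightarrow> continuous_on UNIV (f1 i)"
      "\<And>i x. i \<in> Basis \<Longrightarrow> has_slope i f (f1 i x) x" "\<And>x. bump c R x = 0 \<Longrightarrow> f x = 0"
  shows "sqrt (p * q) * integral (cube c R) (\<lambda>x. u x powr ((q - 1) / 2) * v x powr ((p - 1) / 2) * (f x)\<^sup>2)
    \<le> integral (cube c R) (\<lambda>x. \<Sum>i\<in>Basis. (f1 i x)\<^sup>2)"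
proof -
  obtain \<xi> \<zeta> where C2: "C2_on \<Omega> \<xi>" "C2_on \<Omega> \<zeta>" and pos: "\<And>x. x \<in> \<Omega> \<Longrightarrow> \<xi> x > 0" "\<And>x. x \<in> \<Omega> \<Longrightarrow> \<zeta> x > 0"
    and ae: "AE x\<in>\<Omega> in lebesgue. - laplacian \<xi> x \<ge> p * v x powr (p - 1) * \<zeta> x"
      "AE x\<in>\<Omega> in lebesgue. - laplacian \<zeta> x \<ge> q * u x powr (q - 1) * \<xi> x"
    using st unfolding stable_in_def by blast
  note C\<xi> = C2_fun_if_C2_on[OF C2(1)] and C\<zeta> = C2_fun_if_C2_on[OF C2(2)]
  have cl: "continuous_on \<Omega> (laplacian \<xi>)" "continuous_on \<Omega> (laplacian \<zeta>)"
    unfolding laplacian_def[abs_def] by (intro continuous_intros C2_funD(3)[OF C\<xi>] C2_funD(3)[OF C\<zeta>]; assumption)+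
  have cuv: "continuous_on A u" "continuous_on A v" for A using uv continuous_on_subset by blast+
  have nz: "u x \<noteq> 0" "v x \<noteq> 0" for x using uv(3,4)[of x] by auto
  have c: "continuous_on A (\<lambda>x. u x powr r)" "continuous_on A (\<lambda>x. v x powr r)" for A r
    using nz by (auto intro!: continuous_intros cuv)
  have 1: "p * v x powr (p - 1) * \<zeta> x \<le> - laplacian \<xi> x" if "x \<in> \<Omega>" for x
  proof -
    have "0 \<le> - laplacian \<xi> x - p * v x powr (p - 1) * \<zeta> x"
      by (rule AE_nonneg_imp_nonneg[OF \<Omega>(1) _ _ that])
        (use ae(1) in \<open>auto intro!: continuous_intros cl c C2_funD(1)[OF C\<zeta>]\<close>)
    then show ?thesis by simp
  qed
  have 2: "q * u x powr (q - 1) * \<xi> x \<le> - laplacian \<zeta> x" if "x \<in> \<Omega>" for x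
  proof -
    have "0 \<le> - laplacian \<zeta> x - q * u x powr (q - 1) * \<xi> x"
      by (rule AE_nonneg_imp_nonneg[OF \<Omega>(1) _ _ that])
        (use ae(2) in \<open>auto intro!: continuous_intros cl c C2_funD(1)[OF C\<xi>]\<close>)
    then show ?thesis by simp
  qed
  let ?Q = "cube c R"
  let ?E = "integral ?Q (\<lambda>x. \<Sum>i\<in>Basis. (f1 i x)\<^sup>2)"
  let ?h1 = "\<lambda>x. - laplacian \<xi> x / \<xi> x * (f x)\<^sup>2" and ?h2 = "\<lambda>x. - laplacian \<zeta> x / \<zeta> x * (f x)\<^sup>2"
  have E: "integral ?Q ?h1 \<le> ?E" "integral ?Q ?h2 \<le> ?E"
    unfolding laplacian_def
    by (rule supersolution_inequality[OF \<Omega> R C\<xi> pos(1) f] supersolution_inequality[OF \<Omega> R C\<zeta> pos(2) f]; assumption)+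
  have cf: "continuous_on A f" for A using f(1) continuous_on_subset by blast
  have nz': "\<xi> x \<noteq> 0" "\<zeta> x \<noteq> 0" if "x \<in> ?Q" for x using pos[of x] that \<Omega>(2) by auto
  have ch: "continuous_on ?Q ?h1" "continuous_on ?Q ?h2"
    using nz' \<Omega>(2)
    by (auto intro!: continuous_intros cf continuous_on_subset[OF cl(1)] continuous_on_subset[OF cl(2)]
        continuous_on_subset[OF C2_funD(1)[OF C\<xi>]] continuous_on_subset[OF C2_funD(1)[OF C\<zeta>]])
  have "integral ?Q (\<lambda>x. 2 * sqrt (p * q) * (u x powr ((q - 1) / 2) * v x powr ((p - 1) / 2) * (f x)\<^sup>2))
    \<le> integral ?Q (\<lambda>x. ?h1 x + ?h2 x)"
  proof (intro integral_le integrable_cube c cf ch continuous_on_mult continuous_on_add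
      continuous_on_const continuous_on_power)
    fix x assume "x \<in> ?Q"
    then have x: "x \<in> \<Omega>" using \<Omega>(2) by auto
    let ?A = "p * v x powr (p - 1) * \<zeta> x / \<xi> x" and ?B = "q * u x powr (q - 1) * \<xi> x / \<zeta> x"
    have AB: "?A \<ge> 0" "?B \<ge> 0" using pos[OF x] pq by auto
    have sq: "sqrt (a powr r) = a powr (r / 2)" if "a > 0" for a r :: real
      using powr_half_sqrt[of "a powr r"] that by (simp add: powr_powr)
    have "?A * ?B = (p * q) * (u x powr (q - 1) * v x powr (p - 1))" using pos[OF x] by simp
    then have "sqrt (?A * ?B) = sqrt (p * q) * (u x powr ((q - 1) / 2) * v x powr ((p - 1) / 2))"
      using uv(3,4)[of x] by (simp add: real_sqrt_mult sq)
    then have "2 * (sqrt (p * q) * (u x powr ((q - 1) / 2) * v x powr ((p - 1) / 2))) \<le> ?A + ?B"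
      using arith_geo_mean_sqrt[OF AB] by simp
    also have "\<dots> \<le> - laplacian \<xi> x / \<xi> x + - laplacian \<zeta> x / \<zeta> x"
      using 1[OF x] 2[OF x] pos[OF x] by (intro add_mono divide_right_mono) auto
    finally have "2 * (sqrt (p * q) * (u x powr ((q - 1) / 2) * v x powr ((p - 1) / 2))) * (f x)\<^sup>2
      \<le> (- laplacian \<xi> x / \<xi> x + - laplacian \<zeta> x / \<zeta> x) * (f x)\<^sup>2"
      by (rule mult_right_mono) simp
    then show "2 * sqrt (p * q) * (u x powr ((q - 1) / 2) * v x powr ((p - 1) / 2) * (f x)\<^sup>2) \<le> ?h1 x + ?h2 x"
      by (simp add: algebra_simps)
  qed
  also have "\<dots> = integral ?Q ?h1 + integral ?Q ?h2"
    by (intro integral_add integrable_cube ch)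
  finally show ?thesis using E unfolding integral_mult_right by simp
qed

section \<open>Energy estimates\<close>

lemma abs_sum_bump2_le:
  assumes "R > 0" "n \<ge> 3"
  shows "\<bar>\<Sum>b\<in>Basis. bump2 n (c::'a::euclidean_space) R b x\<bar>
    \<le> (4 * (real n)\<^sup>2 + 2 * real n * DIM('a)) * bump c R x ^ (n - 2) / R\<^sup>2"
proof -
  let ?b = "bump c R x"
  have "n - 1 = Suc (n - 2)" using assms by simp
  then have p: "?b ^ (n - 1) \<le> ?b ^ (n - 2)" by (simp add: mult_left_le_one_le bump_le_1)
  have "real n * real (n - 1) * (?b ^ (n - 2) * (1 - ?b)) \<le> (real n * real n) * (?b ^ (n - 2) * 1)"
    by (intro mult_mono) (auto simp: bump_le_1)
  then have 1: "4 * real n * real (n - 1) * ?b ^ (n - 2) * (1 - ?b) \<le> 4 * (real n)\<^sup>2 * ?b ^ (n - 2)"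
    by (simp add: power2_eq_square)
  have 2: "2 * real n * DIM('a) * ?b ^ (n - 1) \<le> 2 * real n * DIM('a) * ?b ^ (n - 2)"
    using p by (intro mult_left_mono) auto
  have "0 \<le> 4 * real n * real (n - 1) * ?b ^ (n - 2) * (1 - ?b)" "0 \<le> 2 * real n * DIM('a) * ?b ^ (n - 1)"
    by (auto simp: bump_le_1)
  then have "\<bar>4 * real n * real (n - 1) * ?b ^ (n - 2) * (1 - ?b) - 2 * real n * DIM('a) * ?b ^ (n - 1)\<bar>
    \<le> (4 * (real n)\<^sup>2 + 2 * real n * DIM('a)) * ?b ^ (n - 2)"
    using 1 2 unfolding distrib_right by linarith
  then show ?thesis
    unfolding sum_bump2[OF assms] using assms(1) by (simp add: divide_right_mono)
qed

lemma sum_bump1_sq_le: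
  assumes "R > 0" "n \<ge> 2"
  shows "(\<Sum>b\<in>Basis. (bump1 n c R b x)\<^sup>2) \<le> 4 * (real n)\<^sup>2 * bump c R x ^ (2 * n - 2) / R\<^sup>2"
proof -
  have "4 * (real n)\<^sup>2 * bump c R x ^ (2 * n - 2) * (1 - bump c R x) \<le> 4 * (real n)\<^sup>2 * bump c R x ^ (2 * n - 2) * 1"
    by (intro mult_left_mono) auto
  then show ?thesis unfolding sum_bump1_sq[OF assms] using assms(1) by (simp add: divide_right_mono)
qed

text \<open>Expanding \<open>\<bar>\<nabla>(f\<^bsup>X/2\<^esup> \<phi>\<^sup>k)\<bar>\<^sup>2\<close> gives \<open>X\<^sup>2/4 f\<^bsup>X-2\<^esup> \<bar>\<nabla>f\<bar>\<^sup>2 \<phi>\<^bsup>2k\<^esup>\<close>, a cross term and \<open>f\<^sup>X \<bar>\<nabla>\<phi>\<^sup>k\<bar>\<^sup>2\<close>. Testing \<open>- \<Delta>f\<close> with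
\<open>f\<^bsup>X-1\<^esup> \<phi>\<^bsup>2k\<^esup>\<close> trades the first for \<open>X\<^sup>2/(4(X-1))\<close> times the reaction term, and the cross terms are gradients of
\<open>f\<^sup>X\<close>, so that a second integration by parts moves their derivatives to the cut-off function.\<close>

lemma energy_estimate:
  fixes f :: "'a::euclidean_space \<Rightarrow> real"
  assumes f: "C2_fun UNIV f f1 f2" "\<And>x. f x > 0" and X: "X > 1" and k: "k \<ge> 2"
  obtains K where "K \<ge> 0"
    "\<And>R. R > 0 \<Longrightarrow>
      integral (cube c R) (\<lambda>x. \<Sum>i\<in>Basis. (X / 2 * f x powr (X / 2 - 1) * f1 i x * bump c R x ^ k + f x powr (X / 2) * bump1 k c R i x)\<^sup>2)
      \<le> X\<^sup>2 / (4 * (X - 1)) * integral (cube c R) (\<lambda>x. - (\<Sum>i\<in>Basis. f2 i x) * f x powr (X - 1) * bump c R x ^ (2 * k))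
        + K * (integral (cube c R) (\<lambda>x. f x powr X * bump c R x ^ (2 * k - 2)) / R\<^sup>2)"
proof -
  let ?N = "DIM('a)"
  define A where "A = X\<^sup>2 / (4 * (X - 1))"
  define e where "e = (X / 2 - A) / X"
  define K where "K = \<bar>e\<bar> * (4 * (real (2 * k))\<^sup>2 + 2 * real (2 * k) * ?N) + 4 * (real k)\<^sup>2"
  have "A = X\<^sup>2 / 4 / (X - 1)" unfolding A_def by (simp only: divide_divide_eq_left)
  then have A: "A * (X - 1) = X\<^sup>2 / 4"
    using X nonzero_divide_eq_eq[of "X - 1" "X\<^sup>2 / 4" A] by linarith
  have e: "e * X = X / 2 - A" using X by (simp add: e_def)
  have K: "K \<ge> 0" unfolding K_def by (intro add_nonneg_nonneg mult_nonneg_nonneg) auto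
  note f' = C2_funD[OF f(1)]
  have c: "continuous_on S f" "i \<in> Basis \<Longrightarrow> continuous_on S (f1 i)" "i \<in> Basis \<Longrightarrow> continuous_on S (f2 i)" for S i
    using f'(1-3) continuous_on_subset by blast+
  have cp: "continuous_on S (\<lambda>x. f x powr r)" for S r
    using f(2) by (intro continuous_intros c) (metis less_irrefl)
  have main: "integral (cube c R) (\<lambda>x. \<Sum>i\<in>Basis. (X / 2 * f x powr (X / 2 - 1) * f1 i x * bump c R x ^ k + f x powr (X / 2) * bump1 k c R i x)\<^sup>2)
      \<le> A * integral (cube c R) (\<lambda>x. - (\<Sum>i\<in>Basis. f2 i x) * f x powr (X - 1) * bump c R x ^ (2 * k))
        + K * (integral (cube c R) (\<lambda>x. f x powr X * bump c R x ^ (2 * k - 2)) / R\<^sup>2)" if R: "R > 0" for R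
  proof -
    let ?Q = "cube c R" and ?b = "bump c R"
    let ?B1 = "bump1 (2 * k) c R" and ?B2 = "bump2 (2 * k) c R"
    define t where "t = (\<lambda>i x. X / 2 * f x powr (X / 2 - 1) * f1 i x * ?b x ^ k + f x powr (X / 2) * bump1 k c R i x)"
    (* The two integrations by parts at once; e is the coefficient that removes the cross term. *)
    define F where "F = (\<lambda>i x. A * (f x powr (X - 1) * (f1 i x * ?b x ^ (2 * k))) + e * (f x powr X * ?B1 i x))"
    define D where "D = (\<lambda>i x. A * (((X - 1) * f x powr (X - 1 - 1) * f1 i x) * (f1 i x * ?b x ^ (2 * k))
        + f x powr (X - 1) * (f2 i x * ?b x ^ (2 * k) + f1 i x * ?B1 i x))
      + e * ((X * f x powr (X - 1) * f1 i x) * ?B1 i x + f x powr X * ?B2 i x))"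
    define h where "h = (\<lambda>x. A * (- (\<Sum>i\<in>Basis. f2 i x) * f x powr (X - 1) * ?b x ^ (2 * k)) + K / R\<^sup>2 * (f x powr X * ?b x ^ (2 * k - 2)))"
    have b0: "?B1 i x = 0" "?B2 i x = 0" "?b x ^ (2 * k) = 0" if "bump c R x = 0" for i x
      using that k by (auto simp: bump1_def bump2_def zero_power)
    have "integral ?Q (\<lambda>x. \<Sum>i\<in>Basis. (t i x)\<^sup>2) \<le> integral ?Q h"
    proof (rule integral_le_mod_divergence[OF R open_UNIV subset_UNIV, where F = F and D = D])
      fix i x :: 'a assume i: "i \<in> Basis"
      show "has_slope i (F i) (D i x) x"
        unfolding F_def D_def
        using slope_bump_power[of "2 * k" i c R x] k i
        by (intro has_slope_add[OF has_slope_cmult[OF has_slope_mult[OF has_slope_powr[OF f'(4)[OF i UNIV_I] f(2)]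
             has_slope_mult[OF f'(5)[OF i UNIV_I]]]]
             has_slope_cmult[OF has_slope_mult[OF has_slope_powr[OF f'(4)[OF i UNIV_I] f(2)] slope_bump1[OF _ i]]]])
          (simp_all add: bump1_def)
    next
      fix x
      have pt: "(t i x)\<^sup>2 = D i x - A * (f x powr (X - 1) * ?b x ^ (2 * k) * f2 i x) - e * f x powr X * ?B2 i x + f x powr X * (bump1 k c R i x)\<^sup>2" for i
      proof -
        have p1: "f x powr (X / 2 - 1) * f x powr (X / 2 - 1) = f x powr (X - 1 - 1)" by (simp flip: powr_add)
        have p2: "f x powr (X / 2 - 1) * f x powr (X / 2) = f x powr (X - 1)" by (simp flip: powr_add)
        have p3: "f x powr (X / 2) * f x powr (X / 2) = f x powr X" by (simp flip: powr_add)
        have p4: "?b x ^ k * ?b x ^ k = ?b x ^ (2 * k)" by (simp add: mult_2 flip: power_add)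
        have p5: "?b x ^ k * bump1 k c R i x = ?B1 i x / 2"
        proof -
          have "k + (k - 1) = 2 * k - 1" using k by simp
          then have "?b x ^ k * ?b x ^ (k - 1) = ?b x ^ (2 * k - 1)" by (metis power_add)
          moreover have "?b x ^ k * bump1 k c R i x = (?b x ^ k * ?b x ^ (k - 1)) * (real k * (- 2 * ((x - c) \<bullet> i) / R\<^sup>2))"
            unfolding bump1_def by (simp only: mult_ac)
          ultimately show ?thesis by (simp add: bump1_def)
        qed
        have "(t i x)\<^sup>2 = X\<^sup>2 / 4 * (f x powr (X / 2 - 1) * f x powr (X / 2 - 1)) * (f1 i x)\<^sup>2 * (?b x ^ k * ?b x ^ k)
          + X * (f x powr (X / 2 - 1) * f x powr (X / 2)) * f1 i x * (?b x ^ k * bump1 k c R i x)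
          + (f x powr (X / 2) * f x powr (X / 2)) * (bump1 k c R i x)\<^sup>2"
          unfolding t_def by (simp add: power2_eq_square algebra_simps)
        also have "\<dots> = A * (X - 1) * f x powr (X - 1 - 1) * (f1 i x)\<^sup>2 * ?b x ^ (2 * k)
          + (e * X + A) * f x powr (X - 1) * f1 i x * ?B1 i x
          + f x powr X * (bump1 k c R i x)\<^sup>2"
          unfolding p1 p2 p3 p4 p5 A e by simp
        also have "\<dots> = D i x - A * (f x powr (X - 1) * ?b x ^ (2 * k) * f2 i x) - e * f x powr X * ?B2 i x + f x powr X * (bump1 k c R i x)\<^sup>2"
          by (simp add: D_def algebra_simps power2_eq_square)
        finally show ?thesis .
      qed
      have "- e * (\<Sum>i\<in>Basis. ?B2 i x) + (\<Sum>i\<in>Basis. (bump1 k c R i x)\<^sup>2) \<le> K / R\<^sup>2 * ?b x ^ (2 * k - 2)"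
      proof -
        have "- e * (\<Sum>i\<in>Basis. ?B2 i x) \<le> \<bar>e\<bar> * \<bar>\<Sum>i\<in>Basis. ?B2 i x\<bar>"
          by (metis abs_ge_self abs_minus_cancel abs_mult)
        also have "\<dots> \<le> \<bar>e\<bar> * ((4 * (real (2 * k))\<^sup>2 + 2 * real (2 * k) * ?N) * ?b x ^ (2 * k - 2) / R\<^sup>2)"
          using k by (intro mult_left_mono abs_sum_bump2_le R) auto
        finally show ?thesis
          using sum_bump1_sq_le[OF R k, of c x] by (simp add: K_def algebra_simps add_divide_distrib)
      qed
      from mult_left_mono[OF this, of "f x powr X"]
      have "f x powr X * (- e * (\<Sum>i\<in>Basis. ?B2 i x) + (\<Sum>i\<in>Basis. (bump1 k c R i x)\<^sup>2)) \<le> f x powr X * (K / R\<^sup>2 * ?b x ^ (2 * k - 2))"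
        by simp
      moreover have "(\<Sum>i\<in>Basis. (t i x)\<^sup>2) = (\<Sum>i\<in>Basis. D i x) - A * (f x powr (X - 1) * ?b x ^ (2 * k) * (\<Sum>i\<in>Basis. f2 i x))
        + f x powr X * (- e * (\<Sum>i\<in>Basis. ?B2 i x) + (\<Sum>i\<in>Basis. (bump1 k c R i x)\<^sup>2))"
        unfolding pt
        by (simp add: sum.distrib sum_subtractf sum_distrib_left sum_distrib_right sum_negf algebra_simps)
      ultimately show "(\<Sum>i\<in>Basis. (t i x)\<^sup>2) \<le> h x + (\<Sum>i\<in>Basis. D i x)"
        unfolding h_def by (simp add: algebra_simps)
    qed (use k R in \<open>auto simp: F_def D_def h_def t_def b0 zero_power
        intro!: continuous_intros c cp continuous_bump12\<close>)
    also have "integral ?Q h = integral ?Q (\<lambda>x. A * (- (\<Sum>i\<in>Basis. f2 i x) * f x powr (X - 1) * ?b x ^ (2 * k)))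
      + integral ?Q (\<lambda>x. K / R\<^sup>2 * (f x powr X * ?b x ^ (2 * k - 2)))"
      unfolding h_def by (intro integral_add integrable_cube continuous_intros c cp)
    finally show ?thesis unfolding t_def integral_mult_right by simp
  qed
  show ?thesis by (rule that[OF K main[unfolded A_def]])
qed

section \<open>Absorption and decay of the reaction integral\<close>

text \<open>Put \<open>\<delta> = q - (q + 1) / (p + 1) = 2 / \<alpha> > 0\<close>. The left hand sides are at most \<open>l a\<^bsup>-\<delta>\<^esup> / L\<^sup>2\<close> times the expressions
that \<open>e\<close> multiplies on the right. If this factor exceeds \<open>e\<close>, then \<open>a\<close> is at most a constant times \<open>L\<^bsup>-\<alpha>\<^esup>\<close> and the last term takes over.
The assumption \<open>X > q + 1\<close> makes the exponents of \<open>a\<close> positive in that case.\<close>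

lemma scaled_pointwise_bounds:
  fixes p q X l e :: real
  assumes pq: "p > 0" "q > 0" "p * q > 1" and X: "X > q + 1" and l: "l > 0" and e: "e > 0"
  obtains C where "C \<ge> 0"
    "\<And>L a b. L > 0 \<Longrightarrow> a > 0 \<Longrightarrow> b > 0 \<Longrightarrow> b \<le> l * a powr ((q + 1) / (p + 1)) \<Longrightarrow>
      b * a powr (X - q) / L ^ 4 \<le> e * (a powr X / L\<^sup>2) + C * L powr (- 2 - alpha p q * X)"
    "\<And>L a b. L > 0 \<Longrightarrow> a > 0 \<Longrightarrow> b > 0 \<Longrightarrow> b \<le> l * a powr ((q + 1) / (p + 1)) \<Longrightarrow>
      b powr (p + 1) * a powr (X - q - 1) / L\<^sup>2 \<le> e * (b powr p * a powr (X - 1)) + C * L powr (- 2 - alpha p q * X)"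
proof -
  define \<sigma> where "\<sigma> = (q + 1) / (p + 1)"
  define \<delta> where "\<delta> = q - \<sigma>"
  define \<alpha> where "\<alpha> = alpha p q"
  have \<delta>: "\<delta> = (p * q - 1) / (p + 1)" using pq by (simp add: \<delta>_def \<sigma>_def field_simps)
  have \<delta>0: "\<delta> > 0" using pq unfolding \<delta> by simp
  have \<alpha>: "\<alpha> = 2 / \<delta>" unfolding \<alpha>_def alpha_def \<delta> by simp
  have \<alpha>\<delta>: "\<alpha> * \<delta> = 2" using \<delta>0 by (simp add: \<alpha>)
  have \<sigma>: "\<sigma> > 0" "\<sigma> * (p + 1) = q + 1" using pq by (auto simp: \<sigma>_def)
  define M where "M = (l / e) powr (1 / \<delta>)"
  define C where "C = l * M powr (X - \<delta>) + l powr (p + 1) * M powr X"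
  have C: "C \<ge> 0" using l by (auto simp: C_def)
  have C1: "l * M powr (X - \<delta>) \<le> C" and C2: "l powr (p + 1) * M powr X \<le> C" using l by (auto simp: C_def)
  have X\<delta>: "X - \<delta> > 0" using X \<sigma> by (simp add: \<delta>_def)
  have small: "a \<le> M * L powr (- \<alpha>)" if L: "L > 0" and a: "a > 0" and n: "\<not> l * a powr (- \<delta>) / L\<^sup>2 \<le> e" for L a
  proof -
    have "e * L\<^sup>2 < l * a powr (- \<delta>)" using n L by (simp add: field_simps)
    also have "\<dots> = l / a powr \<delta>" by (simp add: powr_minus divide_inverse)
    finally have "a powr \<delta> \<le> (l / e) * L powr (- 2)"
      using L a e by (simp add: field_simps powr_minus)
    then have "(a powr \<delta>) powr (1 / \<delta>) \<le> ((l / e) * L powr (- 2)) powr (1 / \<delta>)"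
      using \<delta>0 by (intro powr_mono2) auto
    also have "(a powr \<delta>) powr (1 / \<delta>) = a" using \<delta>0 a by (simp add: powr_powr)
    also have "((l / e) * L powr (- 2)) powr (1 / \<delta>) = M * (L powr (- 2)) powr (1 / \<delta>)"
      unfolding M_def by (rule powr_mult)
    also have "(L powr (- 2)) powr (1 / \<delta>) = L powr (- \<alpha>)" by (simp add: powr_powr \<alpha>)
    finally show ?thesis .
  qed
  have pw: "a powr r \<le> M powr r * L powr (- \<alpha> * r)" if "a \<le> M * L powr (- \<alpha>)" "a > 0" "r > 0" for a L r
  proof -
    have "a powr r \<le> (M * L powr (- \<alpha>)) powr r" using that by (intro powr_mono2) auto
    then show ?thesis by (simp add: powr_mult powr_powr M_def)
  qed
  show ?thesis
  proof (rule that[OF C])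
    fix L a b :: real assume L: "L > 0" and a: "a > 0" and b: "b > 0" and ba: "b \<le> l * a powr ((q + 1) / (p + 1))"
    have ba': "b \<le> l * a powr \<sigma>" using ba by (simp add: \<sigma>_def)
    have "b * a powr (X - q) \<le> (l * a powr \<sigma>) * a powr (X - q)" using ba' by (intro mult_right_mono) auto
    also have "\<dots> = l * a powr (X - \<delta>)" by (simp add: \<delta>_def flip: powr_add) (simp add: algebra_simps)
    finally have le: "b * a powr (X - q) \<le> l * a powr (X - \<delta>)" .
    show "b * a powr (X - q) / L ^ 4 \<le> e * (a powr X / L\<^sup>2) + C * L powr (- 2 - alpha p q * X)"
    proof (cases "l * a powr (- \<delta>) / L\<^sup>2 \<le> e")
      case True
      have "b * a powr (X - q) / L ^ 4 \<le> l * a powr (X - \<delta>) / L ^ 4"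
        by (intro divide_right_mono le) simp
      also have "\<dots> = (l * a powr (- \<delta>) / L\<^sup>2) * (a powr X / L\<^sup>2)"
        using powr_add[of a "- \<delta>" X] by (simp add: power4_eq_xxxx power2_eq_square)
      also have "\<dots> \<le> e * (a powr X / L\<^sup>2)" using True by (intro mult_right_mono) auto
      finally show ?thesis using C by (simp add: add_increasing2)
    next
      case False
      have "b * a powr (X - q) / L ^ 4 \<le> l * a powr (X - \<delta>) / L ^ 4"
        by (intro divide_right_mono le) simp
      also have "\<dots> \<le> l * (M powr (X - \<delta>) * L powr (- \<alpha> * (X - \<delta>))) / L ^ 4"
        using l by (intro divide_right_mono mult_left_mono pw small L a False X\<delta>) auto
      also have "\<dots> = l * M powr (X - \<delta>) * L powr (- 2 - \<alpha> * X)"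
      proof -
        have "- \<alpha> * (X - \<delta>) = (- 2 - \<alpha> * X) + 4" using \<alpha>\<delta> by (simp add: algebra_simps)
        then have "L powr (- \<alpha> * (X - \<delta>)) = L powr ((- 2 - \<alpha> * X) + 4)" by (rule arg_cong)
        also have "\<dots> = L powr (- 2 - \<alpha> * X) * L powr 4" by (rule powr_add)
        finally have "L powr (- \<alpha> * (X - \<delta>)) = L powr (- 2 - \<alpha> * X) * L ^ 4" using L by simp
        then show ?thesis using L by simp
      qed
      also have "\<dots> \<le> C * L powr (- 2 - \<alpha> * X)" by (intro mult_right_mono C1) simp
      finally show ?thesis using e by (simp add: \<alpha>_def add_increasing)
    qed
    have "b powr (p + 1) * a powr (X - q - 1) \<le> l powr (p + 1) * a powr X"
    proof -
      have "b powr (p + 1) \<le> (l * a powr \<sigma>) powr (p + 1)" using ba' b pq by (intro powr_mono2) auto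
      also have "\<dots> = l powr (p + 1) * a powr (q + 1)" using l \<sigma>(2) by (simp add: powr_mult powr_powr)
      finally have "b powr (p + 1) * a powr (X - q - 1) \<le> l powr (p + 1) * a powr (q + 1) * a powr (X - q - 1)"
        by (rule mult_right_mono) simp
      then show ?thesis by (simp add: mult.assoc flip: powr_add)
    qed
    note le2 = this
    have le1: "b powr (p + 1) * a powr (X - q - 1) \<le> l * a powr (- \<delta>) * (b powr p * a powr (X - 1))"
    proof -
      have "b powr (p + 1) * a powr (X - q - 1) = b * (b powr p * a powr (X - q - 1))"
        using b by (simp add: powr_add)
      also have "\<dots> \<le> (l * a powr \<sigma>) * (b powr p * a powr (X - q - 1))" using ba' by (intro mult_right_mono) auto
      also have "\<dots> = l * b powr p * (a powr \<sigma> * a powr (X - q - 1))" by simp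
      also have "a powr \<sigma> * a powr (X - q - 1) = a powr (- \<delta>) * a powr (X - 1)"
        by (simp add: \<delta>_def flip: powr_add) (simp add: algebra_simps)
      finally show ?thesis by (simp add: mult_ac)
    qed
    show "b powr (p + 1) * a powr (X - q - 1) / L\<^sup>2 \<le> e * (b powr p * a powr (X - 1)) + C * L powr (- 2 - alpha p q * X)"
    proof (cases "l * a powr (- \<delta>) / L\<^sup>2 \<le> e")
      case True
      have "b powr (p + 1) * a powr (X - q - 1) / L\<^sup>2 \<le> (l * a powr (- \<delta>) * (b powr p * a powr (X - 1))) / L\<^sup>2"
        by (intro divide_right_mono le1) simp
      also have "\<dots> = (l * a powr (- \<delta>) / L\<^sup>2) * (b powr p * a powr (X - 1))" by simp
      also have "\<dots> \<le> e * (b powr p * a powr (X - 1))" using True by (intro mult_right_mono) auto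
      finally show ?thesis using C by (simp add: add_increasing2)
    next
      case False
      have "b powr (p + 1) * a powr (X - q - 1) / L\<^sup>2 \<le> (l powr (p + 1) * a powr X) / L\<^sup>2"
        by (intro divide_right_mono le2) simp
      also have "\<dots> \<le> (l powr (p + 1) * (M powr X * L powr (- \<alpha> * X))) / L\<^sup>2"
        using X pq by (intro divide_right_mono mult_left_mono pw small L a False) auto
      also have "\<dots> = l powr (p + 1) * M powr X * L powr (- 2 - \<alpha> * X)"
      proof -
        have "L powr (- \<alpha> * X) = L powr ((- 2 - \<alpha> * X) + 2)" by simp
        also have "\<dots> = L powr (- 2 - \<alpha> * X) * L powr 2" by (rule powr_add)
        finally have "L powr (- \<alpha> * X) = L powr (- 2 - \<alpha> * X) * L\<^sup>2" using L by simp
        then show ?thesis using L by simp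
      qed
      also have "\<dots> \<le> C * L powr (- 2 - \<alpha> * X)" by (intro mult_right_mono C2) simp
      finally show ?thesis using e by (simp add: \<alpha>_def add_increasing)
    qed
  qed
qed

text \<open>The preceding bounds at the scale \<open>L = R y\<close>, where \<open>y\<close> will be the value of the bump: using a length adapted to the
point distributes the powers of the cut-off function correctly over all terms. The factor
\<open>y\<^bsup>2k-2-\<alpha>X\<^esup>\<close> left over in the last term is at most \<open>1\<close>.\<close>

lemma cutoff_pointwise_bounds:
  fixes p q X l e :: real
  assumes pq: "p > 0" "q > 0" "p * q > 1" and X: "X > q + 1" and l: "l > 0" and e: "e > 0"
    and k: "k \<ge> 3" "2 * real k \<ge> 2 + alpha p q * X"
  obtains C where "C \<ge> 0"
    "\<And>R y a b. R > 0 \<Longrightarrow> 0 \<le> y \<Longrightarrow> y \<le> 1 \<Longrightarrow> a > 0 \<Longrightarrow> b > 0 \<Longrightarrow> b \<le> l * a powr ((q + 1) / (p + 1)) \<Longrightarrow>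
      b * a powr (X - q) * y ^ (2 * k - 4) / R ^ 4 \<le> e * (a powr X * y ^ (2 * k - 2) / R\<^sup>2) + C * R powr (- 2 - alpha p q * X)"
    "\<And>R y a b. R > 0 \<Longrightarrow> 0 \<le> y \<Longrightarrow> y \<le> 1 \<Longrightarrow> a > 0 \<Longrightarrow> b > 0 \<Longrightarrow> b \<le> l * a powr ((q + 1) / (p + 1)) \<Longrightarrow>
      b powr (p + 1) * a powr (X - q - 1) * y ^ (2 * k - 2) / R\<^sup>2 \<le> e * (b powr p * a powr (X - 1) * y ^ (2 * k)) + C * R powr (- 2 - alpha p q * X)"
proof -
  obtain C where C: "C \<ge> 0"
    and 1: "\<And>L a b. L > 0 \<Longrightarrow> a > 0 \<Longrightarrow> b > 0 \<Longrightarrow> b \<le> l * a powr ((q + 1) / (p + 1)) \<Longrightarrow>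
      b * a powr (X - q) / L ^ 4 \<le> e * (a powr X / L\<^sup>2) + C * L powr (- 2 - alpha p q * X)"
    and 2: "\<And>L a b. L > 0 \<Longrightarrow> a > 0 \<Longrightarrow> b > 0 \<Longrightarrow> b \<le> l * a powr ((q + 1) / (p + 1)) \<Longrightarrow>
      b powr (p + 1) * a powr (X - q - 1) / L\<^sup>2 \<le> e * (b powr p * a powr (X - 1)) + C * L powr (- 2 - alpha p q * X)"
    using scaled_pointwise_bounds[OF pq X l e] by metis
  define r where "r = - 2 - alpha p q * X"
  have pw: "y ^ (2 * k) / (R * y)\<^sup>2 = y ^ (2 * k - 2) / R\<^sup>2" "y ^ (2 * k) / (R * y) ^ 4 = y ^ (2 * k - 4) / R ^ 4"
    "(R * y) powr r * y ^ (2 * k) \<le> R powr r" if "R > 0" "0 < y" "y \<le> 1" for R y :: real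
  proof -
    obtain j where j: "2 * k = j + 4" using k(1) by (intro that[of "2 * k - 4"]) auto
    then have j': "2 * k - 2 = j + 2" "2 * k - 4 = j" by auto
    show "y ^ (2 * k) / (R * y)\<^sup>2 = y ^ (2 * k - 2) / R\<^sup>2" "y ^ (2 * k) / (R * y) ^ 4 = y ^ (2 * k - 4) / R ^ 4"
      unfolding j' unfolding j using that by (simp_all add: power_add power_mult_distrib power4_eq_xxxx power2_eq_square)
    have "(R * y) powr r * y ^ (2 * k) = R powr r * (y powr r * y powr (2 * k))"
      using that by (simp add: powr_mult flip: powr_realpow)
    also have "y powr r * y powr (2 * k) = y powr (r + 2 * k)" by (simp add: powr_add)
    also have "R powr r * y powr (r + 2 * k) \<le> R powr r * 1"
      using that k(2) by (intro mult_left_mono powr_le1) (auto simp: r_def)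
    finally show "(R * y) powr r * y ^ (2 * k) \<le> R powr r" by simp
  qed
  show ?thesis
  proof (rule that[OF C])
    fix R y a b :: real
    assume R: "R > 0" and y: "0 \<le> y" "y \<le> 1" and ab: "a > 0" "b > 0" "b \<le> l * a powr ((q + 1) / (p + 1))"
    have "b * a powr (X - q) * y ^ (2 * k - 4) / R ^ 4 \<le> e * (a powr X * y ^ (2 * k - 2) / R\<^sup>2) + C * R powr r
      \<and> b powr (p + 1) * a powr (X - q - 1) * y ^ (2 * k - 2) / R\<^sup>2 \<le> e * (b powr p * a powr (X - 1) * y ^ (2 * k)) + C * R powr r"
    proof (cases "y = 0")
      case True
      then show ?thesis using k(1) C by (simp add: zero_power)
    next
      case False
      with y have y0: "0 < y" by simp
      note pw = pw[OF R y0 y(2)]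
      have Cr: "C * (R * y) powr r * y ^ (2 * k) \<le> C * R powr r"
        using mult_left_mono[OF pw(3) C] by (simp add: mult.assoc)
      have "b * a powr (X - q) / (R * y) ^ 4 * y ^ (2 * k) \<le> (e * (a powr X / (R * y)\<^sup>2) + C * (R * y) powr r) * y ^ (2 * k)"
        unfolding r_def using R y0 by (intro mult_right_mono 1 ab) auto
      then have A: "b * a powr (X - q) * (y ^ (2 * k) / (R * y) ^ 4) \<le> e * (a powr X * (y ^ (2 * k) / (R * y)\<^sup>2)) + C * (R * y) powr r * y ^ (2 * k)"
        by (simp add: distrib_right)
      have "b powr (p + 1) * a powr (X - q - 1) / (R * y)\<^sup>2 * y ^ (2 * k)
        \<le> (e * (b powr p * a powr (X - 1)) + C * (R * y) powr r) * y ^ (2 * k)"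
        unfolding r_def using R y0 by (intro mult_right_mono 2 ab) auto
      then have B: "b powr (p + 1) * a powr (X - q - 1) * (y ^ (2 * k) / (R * y)\<^sup>2)
        \<le> e * (b powr p * a powr (X - 1) * y ^ (2 * k)) + C * (R * y) powr r * y ^ (2 * k)"
        by (simp add: distrib_right)
      show ?thesis using A B Cr unfolding pw(1,2) by simp
    qed
    then show "b * a powr (X - q) * y ^ (2 * k - 4) / R ^ 4 \<le> e * (a powr X * y ^ (2 * k - 2) / R\<^sup>2) + C * R powr (- 2 - alpha p q * X)"
      "b powr (p + 1) * a powr (X - q - 1) * y ^ (2 * k - 2) / R\<^sup>2 \<le> e * (b powr p * a powr (X - 1) * y ^ (2 * k)) + C * R powr (- 2 - alpha p q * X)"
      by (auto simp: r_def)
  qed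
qed

locale stable_lane_emden = lane_emden +
  assumes qp: "q \<le> p"
    and stab: "\<And>R f f1. R > 0 \<Longrightarrow> continuous_on UNIV f \<Longrightarrow> (\<And>i. i \<in> Basis \<Longrightarrow> continuous_on UNIV (f1 i)) \<Longrightarrow>
      (\<And>i x. i \<in> Basis \<Longrightarrow> has_slope i f (f1 i x) x) \<Longrightarrow> (\<And>x. bump 0 R x = 0 \<Longrightarrow> f x = 0) \<Longrightarrow>
      sqrt (p * q) * integral (cube 0 R) (\<lambda>x. u x powr ((q - 1) / 2) * v x powr ((p - 1) / 2) * (f x)\<^sup>2)
        \<le> integral (cube 0 R) (\<lambda>x. \<Sum>i\<in>Basis. (f1 i x)\<^sup>2)"
begin

definition comparison_const :: real where "comparison_const = ((p + 1) / (q + 1)) powr (1 / (p + 1))"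

lemma comparison_const_pos: "comparison_const > 0" and v_le: "v x \<le> comparison_const * u x powr ((q + 1) / (p + 1))"
proof -
  show "comparison_const > 0" using pq by (simp add: comparison_const_def)
  then show "v x \<le> comparison_const * u x powr ((q + 1) / (p + 1))"
    using pq by (intro comparison qp) (auto simp: comparison_const_def powr_powr)
qed

lemma stable_energy:
  assumes f: "C2_fun UNIV f f1 f2" "\<And>x. f x > 0" and X: "X > 1" and k: "k \<ge> 2"
  obtains K where "K \<ge> 0"
    "\<And>R. R > 0 \<Longrightarrow>
      sqrt (p * q) * integral (cube 0 R) (\<lambda>x. u x powr ((q - 1) / 2) * v x powr ((p - 1) / 2) * f x powr X * bump 0 R x ^ (2 * k))
      \<le> X\<^sup>2 / (4 * (X - 1)) * integral (cube 0 R) (\<lambda>x. - (\<Sum>i\<in>Basis. f2 i x) * f x powr (X - 1) * bump 0 R x ^ (2 * k))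
        + K * (integral (cube 0 R) (\<lambda>x. f x powr X * bump 0 R x ^ (2 * k - 2)) / R\<^sup>2)"
proof -
  obtain K where K: "K \<ge> 0" "\<And>R. R > 0 \<Longrightarrow>
      integral (cube 0 R) (\<lambda>x. \<Sum>i\<in>Basis. (X / 2 * f x powr (X / 2 - 1) * f1 i x * bump 0 R x ^ k + f x powr (X / 2) * bump1 k 0 R i x)\<^sup>2)
      \<le> X\<^sup>2 / (4 * (X - 1)) * integral (cube 0 R) (\<lambda>x. - (\<Sum>i\<in>Basis. f2 i x) * f x powr (X - 1) * bump 0 R x ^ (2 * k))
        + K * (integral (cube 0 R) (\<lambda>x. f x powr X * bump 0 R x ^ (2 * k - 2)) / R\<^sup>2)"
    using energy_estimate[OF f X k, of 0] by blast
  note f' = C2_funD[OF f(1)]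
  have nz: "f x \<noteq> 0" for x using f(2)[of x] by simp
  show ?thesis
  proof (rule that[OF K(1)])
    fix R :: real assume R: "R > 0"
    have "sqrt (p * q) * integral (cube 0 R) (\<lambda>x. u x powr ((q - 1) / 2) * v x powr ((p - 1) / 2) * (f x powr (X / 2) * bump 0 R x ^ k)\<^sup>2)
      \<le> integral (cube 0 R) (\<lambda>x. \<Sum>i\<in>Basis. (X / 2 * f x powr (X / 2 - 1) * f1 i x * bump 0 R x ^ k + f x powr (X / 2) * bump1 k 0 R i x)\<^sup>2)"
    proof (rule stab[OF R])
      fix i x :: 'a assume i: "i \<in> Basis"
      show "has_slope i (\<lambda>x. f x powr (X / 2) * bump 0 R x ^ k)
        (X / 2 * f x powr (X / 2 - 1) * f1 i x * bump 0 R x ^ k + f x powr (X / 2) * bump1 k 0 R i x) x"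
        unfolding bump1_def by (rule has_slope_mult[OF has_slope_powr[OF f'(4)[OF i UNIV_I] f(2)] slope_bump_power[OF k i]])
    qed (use nz k in \<open>auto intro!: continuous_intros f' continuous_bump12 simp: zero_power\<close>)
    also note K(2)[OF R]
    also have "(\<lambda>x. u x powr ((q - 1) / 2) * v x powr ((p - 1) / 2) * (f x powr (X / 2) * bump 0 R x ^ k)\<^sup>2)
      = (\<lambda>x. u x powr ((q - 1) / 2) * v x powr ((p - 1) / 2) * f x powr X * bump 0 R x ^ (2 * k))"
    proof
      fix x
      have "(f x powr (X / 2))\<^sup>2 = f x powr X" by (simp add: power2_eq_square flip: powr_add)
      then show "u x powr ((q - 1) / 2) * v x powr ((p - 1) / 2) * (f x powr (X / 2) * bump 0 R x ^ k)\<^sup>2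
        = u x powr ((q - 1) / 2) * v x powr ((p - 1) / 2) * f x powr X * bump 0 R x ^ (2 * k)"
        by (simp add: power_mult_distrib power_mult mult.commute[of 2 k])
    qed
    finally show "sqrt (p * q) * integral (cube 0 R) (\<lambda>x. u x powr ((q - 1) / 2) * v x powr ((p - 1) / 2) * f x powr X * bump 0 R x ^ (2 * k))
      \<le> X\<^sup>2 / (4 * (X - 1)) * integral (cube 0 R) (\<lambda>x. - (\<Sum>i\<in>Basis. f2 i x) * f x powr (X - 1) * bump 0 R x ^ (2 * k))
        + K * (integral (cube 0 R) (\<lambda>x. f x powr X * bump 0 R x ^ (2 * k - 2)) / R\<^sup>2)" .
  qed
qed

text \<open>With \<open>J\<^sub>1\<close>, \<open>J\<^sub>2\<close> the left hand sides of the stability inequality for \<open>u\<^bsup>X/2\<^esup> \<phi>\<^sup>k\<close> and \<open>v\<^bsup>mX/2\<^esup> \<phi>\<^sup>k\<close>, the reaction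
integrands are \<open>a\<^bsup>1-\<theta>\<^esup> b\<^bsup>\<theta>\<^esup>\<close> and \<open>a\<^bsup>\<theta>\<^esup> b\<^bsup>1-\<theta>\<^esup>\<close> times the stability weight, where \<open>a = u\<^sup>X\<close>, \<open>b = v\<^bsup>mX\<^esup>\<close> and
\<open>\<theta> = (q + 1) / (2 X)\<close>. Weighting the second inequality by a suitable \<open>\<mu>\<close> equalises both coefficients to
\<open>\<surd>(A B) < \<surd>(p q)\<close>, and the reaction terms are absorbed into \<open>J\<^sub>1 + \<mu> J\<^sub>2\<close>.\<close>

lemma reaction_estimate:
  assumes X: "X > q + 1" and k: "k \<ge> 2"
    and adm: "((p + 1) / (q + 1))\<^sup>2 * X ^ 4 < 16 * p * q * (X - 1) * ((p + 1) / (q + 1) * X - 1)"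
  obtains C where "C \<ge> 0"
    "\<And>R. R > 0 \<Longrightarrow> integral (cube 0 R) (\<lambda>x. v x powr p * u x powr (X - 1) * bump 0 R x ^ (2 * k))
      \<le> C * (integral (cube 0 R) (\<lambda>x. u x powr X * bump 0 R x ^ (2 * k - 2)) / R\<^sup>2)"
proof -
  define m where "m = (p + 1) / (q + 1)"
  have m: "m \<ge> 1" "m * (q + 1) = p + 1" using pq qp by (auto simp: m_def)
  have X1: "X > 1" using X pq by simp
  have "1 * X \<le> m * X" using m X1 by (intro mult_right_mono) auto
  then have mX: "m * X > 1" using X1 by linarith
  define A where "A = X\<^sup>2 / (4 * (X - 1))"
  define B where "B = (m * X)\<^sup>2 / (4 * (m * X - 1))"
  have AB: "A > 0" "B > 0" using X1 mX m by (auto simp: A_def B_def)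
  have "A * B < p * q"
  proof -
    have "A * B = (m\<^sup>2 * X ^ 4) / (16 * (X - 1) * (m * X - 1))"
    proof -
      have n: "X\<^sup>2 * (m * X)\<^sup>2 = m\<^sup>2 * X ^ 4" by (simp add: power_mult_distrib power4_eq_xxxx power2_eq_square)
      have d: "4 * (X - 1) * (4 * (m * X - 1)) = 16 * (X - 1) * (m * X - 1)" by algebra
      show ?thesis unfolding A_def B_def times_divide_times_eq n d ..
    qed
    also have "\<dots> < p * q"
    proof -
      have "0 < 16 * (X - 1) * (m * X - 1)" using X1 mX by (intro mult_pos_pos) auto
      then show ?thesis using adm unfolding m_def[symmetric] by (simp add: divide_less_eq mult_ac)
    qed
    finally show ?thesis .
  qed
  define \<rho> where "\<rho> = sqrt (A * B)"
  have \<rho>: "\<rho> \<ge> 0" "\<rho> < sqrt (p * q)" using \<open>A * B < p * q\<close> AB by (auto simp: \<rho>_def)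
  obtain K1 where K1: "K1 \<ge> 0" "\<And>R. R > 0 \<Longrightarrow>
      sqrt (p * q) * integral (cube 0 R) (\<lambda>x. u x powr ((q - 1) / 2) * v x powr ((p - 1) / 2) * u x powr X * bump 0 R x ^ (2 * k))
      \<le> A * integral (cube 0 R) (\<lambda>x. v x powr p * u x powr (X - 1) * bump 0 R x ^ (2 * k))
        + K1 * (integral (cube 0 R) (\<lambda>x. u x powr X * bump 0 R x ^ (2 * k - 2)) / R\<^sup>2)"
    using stable_energy[OF Cu u_pos X1 k] unfolding eq_u A_def by blast
  obtain K2 where K2: "K2 \<ge> 0" "\<And>R. R > 0 \<Longrightarrow>
      sqrt (p * q) * integral (cube 0 R) (\<lambda>x. u x powr ((q - 1) / 2) * v x powr ((p - 1) / 2) * v x powr (m * X) * bump 0 R x ^ (2 * k))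
      \<le> B * integral (cube 0 R) (\<lambda>x. u x powr q * v x powr (m * X - 1) * bump 0 R x ^ (2 * k))
        + K2 * (integral (cube 0 R) (\<lambda>x. v x powr (m * X) * bump 0 R x ^ (2 * k - 2)) / R\<^sup>2)"
    using stable_energy[OF Cv v_pos mX k] unfolding eq_v B_def by blast
  define \<theta> where "\<theta> = (q + 1) / (2 * X)"
  have \<theta>: "0 < \<theta>" "\<theta> < 1" "\<theta> * X = (q + 1) / 2" using X pq by (auto simp: \<theta>_def)
  have \<theta>m: "\<theta> * (m * X) = (p + 1) / 2" using arg_cong[OF \<theta>(3), of "(*) m"] m(2) by (simp add: mult_ac)
  (* The weight for which A = rho mu^theta and B mu = rho mu^(1 - theta). *)
  define \<mu> where "\<mu> = (A / B) powr (1 / (2 * \<theta>))"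
  have \<mu>: "\<mu> > 0" using AB by (simp add: \<mu>_def)
  have \<mu>\<theta>: "\<mu> powr \<theta> = sqrt (A / B)"
    using AB \<theta> powr_half_sqrt[of "A / B"] by (simp add: \<mu>_def powr_powr)
  have A\<mu>: "A = \<rho> * \<mu> powr \<theta>"
    using AB by (simp add: \<mu>\<theta> \<rho>_def real_sqrt_divide real_sqrt_mult)
  have B\<mu>: "B * \<mu> = \<rho> * \<mu> powr (1 - \<theta>)"
  proof -
    have "B * \<mu> powr \<theta> = \<rho>"
      using AB real_sqrt_mult_self[of B] by (simp add: \<mu>\<theta> \<rho>_def real_sqrt_divide real_sqrt_mult field_simps)
    moreover have "\<mu> powr \<theta> * \<mu> powr (1 - \<theta>) = \<mu>" using \<mu> by (simp flip: powr_add)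
    ultimately show ?thesis by (metis mult.assoc)
  qed
  define w where "w = (\<lambda>x. u x powr ((q - 1) / 2) * v x powr ((p - 1) / 2))"
  have w: "w x \<ge> 0" for x by (simp add: w_def)
  have uv0: "u x powr r > 0" "v x powr r > 0" for x r using u_pos[of x] v_pos[of x] by simp_all
  have T1: "v x powr p * u x powr (X - 1) = w x * ((u x powr X) powr (1 - \<theta>) * (v x powr (m * X)) powr \<theta>)" for x
  proof -
    have "(q - 1) / 2 + X * (1 - \<theta>) = X - 1" using \<theta>(3) by (simp add: algebra_simps) (simp add: field_simps)
    moreover have "(p - 1) / 2 + m * X * \<theta> = p" using \<theta>m by (simp add: algebra_simps) (simp add: field_simps)
    ultimately show ?thesis
      using powr_add[of "u x" "(q - 1) / 2" "X * (1 - \<theta>)"] powr_add[of "v x" "(p - 1) / 2" "m * X * \<theta>"]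
      unfolding w_def powr_powr by (simp only: mult_ac)
  qed
  have T2: "u x powr q * v x powr (m * X - 1) = w x * ((u x powr X) powr \<theta> * (v x powr (m * X)) powr (1 - \<theta>))" for x
  proof -
    have "(q - 1) / 2 + X * \<theta> = q" using \<theta>(3) by (simp add: algebra_simps) (simp add: field_simps)
    moreover have "(p - 1) / 2 + m * X * (1 - \<theta>) = m * X - 1" using \<theta>m by (simp add: algebra_simps) (simp add: field_simps)
    ultimately show ?thesis
      using powr_add[of "u x" "(q - 1) / 2" "X * \<theta>"] powr_add[of "v x" "(p - 1) / 2" "m * X * (1 - \<theta>)"]
      unfolding w_def powr_powr by (simp only: mult_ac)
  qed
  have young: "a powr (1 - \<theta>) * b powr \<theta> \<le> (1 - \<theta>) * a + \<theta> * b" if "a > 0" "b > 0" for a b :: real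
    using Youngs_inequality_0[of "1 - \<theta>" \<theta> a b] \<theta> that by simp
  have Y1: "A * (a powr (1 - \<theta>) * b powr \<theta>) + \<mu> * (B * (a powr \<theta> * b powr (1 - \<theta>))) \<le> \<rho> * (a + \<mu> * b)" if "a > 0" "b > 0" for a b :: real
  proof -
    have 1: "A * (a powr (1 - \<theta>) * b powr \<theta>) = \<rho> * (a powr (1 - \<theta>) * (\<mu> * b) powr \<theta>)"
      unfolding A\<mu> using \<mu> that by (simp add: powr_mult)
    have 2: "\<mu> * (B * (a powr \<theta> * b powr (1 - \<theta>))) = \<rho> * ((\<mu> * b) powr (1 - \<theta>) * a powr \<theta>)"
    proof -
      have "\<mu> * (B * (a powr \<theta> * b powr (1 - \<theta>))) = (B * \<mu>) * (a powr \<theta> * b powr (1 - \<theta>))" by simp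
      then show ?thesis unfolding B\<mu> using \<mu> that by (simp add: powr_mult)
    qed
    have 3: "a powr (1 - \<theta>) * (\<mu> * b) powr \<theta> + (\<mu> * b) powr (1 - \<theta>) * a powr \<theta> \<le> a + \<mu> * b"
      using young[of a "\<mu> * b"] young[of "\<mu> * b" a] that \<mu> by (simp add: algebra_simps)
    show ?thesis
      unfolding 1 2 distrib_left[symmetric, of \<rho>] by (rule mult_left_mono[OF 3 \<rho>(1)])
  qed
  define g where "g = sqrt (p * q) - \<rho>"
  have g: "g > 0" using \<rho> by (simp add: g_def)
  define C where "C = (1 + 1 / \<mu>) * ((K1 + \<mu> * (K2 * comparison_const powr (m * X))) / g)"
  have C: "C \<ge> 0" using K1 K2 \<mu> g by (simp add: C_def)
  show ?thesis
  proof (rule that[OF C])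
    fix R :: real assume R: "R > 0"
    let ?Q = "cube 0 R" and ?b = "\<lambda>x. bump 0 R x ^ (2 * k)"
    define J1 where "J1 = integral ?Q (\<lambda>x. w x * u x powr X * ?b x)"
    define J2 where "J2 = integral ?Q (\<lambda>x. w x * v x powr (m * X) * ?b x)"
    define I1 where "I1 = integral ?Q (\<lambda>x. v x powr p * u x powr (X - 1) * ?b x)"
    define I2 where "I2 = integral ?Q (\<lambda>x. u x powr q * v x powr (m * X - 1) * ?b x)"
    define F where "F = integral ?Q (\<lambda>x. u x powr X * bump 0 R x ^ (2 * k - 2)) / R\<^sup>2"
    define F2 where "F2 = integral ?Q (\<lambda>x. v x powr (m * X) * bump 0 R x ^ (2 * k - 2)) / R\<^sup>2"
    have cw: "continuous_on S w" for S unfolding w_def by (intro continuous_on_mult cont_powr)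
    have cb: "continuous_on S (\<lambda>x. bump 0 R x ^ j)" for S :: "'a set" and j by (intro continuous_intros)
    have E1: "sqrt (p * q) * J1 \<le> A * I1 + K1 * F" using K1(2)[OF R] by (simp add: J1_def I1_def F_def w_def)
    have E2: "sqrt (p * q) * J2 \<le> B * I2 + K2 * F2" using K2(2)[OF R] by (simp add: J2_def I2_def F2_def w_def)
    have F2: "F2 \<le> comparison_const powr (m * X) * F"
    proof -
      have "v x powr (m * X) \<le> comparison_const powr (m * X) * u x powr X" for x
      proof -
        have "v x powr (m * X) \<le> (comparison_const * u x powr ((q + 1) / (p + 1))) powr (m * X)"
          using v_le[of x] v_pos[of x] mX by (intro powr_mono2) auto
        also have "\<dots> = comparison_const powr (m * X) * u x powr X"
          using comparison_const_pos pq by (simp add: powr_mult powr_powr m_def)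
        finally show ?thesis .
      qed
      then have "integral ?Q (\<lambda>x. v x powr (m * X) * bump 0 R x ^ (2 * k - 2))
        \<le> integral ?Q (\<lambda>x. (comparison_const powr (m * X) * u x powr X) * bump 0 R x ^ (2 * k - 2))"
        by (intro integral_le integrable_cube continuous_on_mult continuous_on_const cont_powr cb mult_right_mono) auto
      also have "\<dots> = comparison_const powr (m * X) * integral ?Q (\<lambda>x. u x powr X * bump 0 R x ^ (2 * k - 2))"
        unfolding mult.assoc by (rule integral_mult_right)
      finally show ?thesis using R by (simp add: F2_def F_def divide_right_mono)
    qed
    have "A * I1 + \<mu> * (B * I2) \<le> \<rho> * (J1 + \<mu> * J2)"
    proof -
      have "A * I1 + \<mu> * (B * I2) = integral ?Q (\<lambda>x. A * (v x powr p * u x powr (X - 1) * ?b x) + \<mu> * B * (u x powr q * v x powr (m * X - 1) * ?b x))"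
        unfolding I1_def I2_def mult.assoc[symmetric, of \<mu>] integral_mult_right[symmetric]
        by (intro integral_add[symmetric] integrable_cube continuous_on_mult continuous_on_const cont_powr cb)
      also have "\<dots> \<le> integral ?Q (\<lambda>x. \<rho> * (w x * u x powr X * ?b x) + \<rho> * \<mu> * (w x * v x powr (m * X) * ?b x))"
      proof (intro integral_le integrable_cube continuous_on_add continuous_on_mult continuous_on_const cont_powr cb cw)
        fix x
        have "w x * ?b x * (A * ((u x powr X) powr (1 - \<theta>) * (v x powr (m * X)) powr \<theta>) + \<mu> * (B * ((u x powr X) powr \<theta> * (v x powr (m * X)) powr (1 - \<theta>))))
          \<le> w x * ?b x * (\<rho> * (u x powr X + \<mu> * v x powr (m * X)))"
          using w[of x] by (intro mult_left_mono Y1 uv0) auto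
        then show "A * (v x powr p * u x powr (X - 1) * ?b x) + \<mu> * B * (u x powr q * v x powr (m * X - 1) * ?b x)
          \<le> \<rho> * (w x * u x powr X * ?b x) + \<rho> * \<mu> * (w x * v x powr (m * X) * ?b x)"
          unfolding T1 T2 by (simp add: algebra_simps)
      qed
      also have "\<dots> = \<rho> * J1 + \<rho> * \<mu> * J2"
        unfolding J1_def J2_def integral_mult_right[symmetric]
        by (intro integral_add integrable_cube continuous_on_mult continuous_on_const cont_powr cb cw)
      finally show ?thesis by (simp add: algebra_simps)
    qed
    moreover have "sqrt (p * q) * (J1 + \<mu> * J2) \<le> (A * I1 + K1 * F) + \<mu> * (B * I2 + K2 * (comparison_const powr (m * X) * F))"
    proof -
      have "sqrt (p * q) * J2 \<le> B * I2 + K2 * (comparison_const powr (m * X) * F)"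
        using E2 mult_left_mono[OF F2 K2(1)] by simp
      from mult_left_mono[OF this, of \<mu>] E1 \<mu> show ?thesis by (simp add: algebra_simps)
    qed
    ultimately have "g * (J1 + \<mu> * J2) \<le> (K1 + \<mu> * (K2 * comparison_const powr (m * X))) * F"
      by (simp add: g_def algebra_simps)
    then have J: "J1 + \<mu> * J2 \<le> (K1 + \<mu> * (K2 * comparison_const powr (m * X))) / g * F"
      using g by (simp add: field_simps)
    have J0: "J1 \<ge> 0" "J2 \<ge> 0" unfolding J1_def J2_def
      by (intro integral_nonneg integrable_cube continuous_on_mult cont_powr cb cw; simp add: w)+
    have "I1 \<le> J1 + J2"
    proof -
      have "I1 \<le> integral ?Q (\<lambda>x. w x * u x powr X * ?b x + w x * v x powr (m * X) * ?b x)"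
        unfolding I1_def
      proof (intro integral_le integrable_cube continuous_on_add continuous_on_mult cont_powr cb cw)
        fix x
        have "(u x powr X) powr (1 - \<theta>) * (v x powr (m * X)) powr \<theta> \<le> (1 - \<theta>) * u x powr X + \<theta> * v x powr (m * X)"
          by (intro young uv0)
        also have "\<dots> \<le> 1 * u x powr X + 1 * v x powr (m * X)" using \<theta> by (intro add_mono mult_right_mono) auto
        finally have "w x * ?b x * ((u x powr X) powr (1 - \<theta>) * (v x powr (m * X)) powr \<theta>) \<le> w x * ?b x * (u x powr X + v x powr (m * X))"
          using w[of x] by (intro mult_left_mono) auto
        then show "v x powr p * u x powr (X - 1) * ?b x \<le> w x * u x powr X * ?b x + w x * v x powr (m * X) * ?b x"
          unfolding T1 by (simp add: algebra_simps)
      qed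
      also have "\<dots> = J1 + J2" unfolding J1_def J2_def
        by (intro integral_add integrable_cube continuous_on_mult cont_powr cb cw)
      finally show ?thesis .
    qed
    also have "J1 + J2 \<le> (1 + 1 / \<mu>) * (J1 + \<mu> * J2)"
    proof -
      have "(1 + 1 / \<mu>) * (J1 + \<mu> * J2) = J1 + J2 + (\<mu> * J2 + J1 / \<mu>)" using \<mu> by (simp add: field_simps)
      then show ?thesis using J0 \<mu> by simp
    qed
    also have "\<dots> \<le> (1 + 1 / \<mu>) * ((K1 + \<mu> * (K2 * comparison_const powr (m * X))) / g * F)"
      using \<mu> by (intro mult_left_mono J) auto
    also have "\<dots> = C * F" by (simp add: C_def)
    finally show "integral ?Q (\<lambda>x. v x powr p * u x powr (X - 1) * ?b x) \<le> C * (integral ?Q (\<lambda>x. u x powr X * bump 0 R x ^ (2 * k - 2)) / R\<^sup>2)"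
      unfolding I1_def F_def .
  qed
qed

end

text \<open>It is \<open>\<gamma> / (\<gamma> - 1) ((\<gamma> - 1) s + t)\<^sup>2\<close>.\<close>

lemma completed_square_nonneg:
  fixes \<gamma> s t :: real
  assumes g: "\<gamma> > 1"
  shows "0 \<le> \<gamma> * (\<gamma> - 1) * s\<^sup>2 + 2 * \<gamma> * s * t + \<gamma> / (\<gamma> - 1) * t\<^sup>2"
proof -
  have n: "\<gamma> - 1 \<noteq> 0" using g by simp
  have "\<gamma> * (\<gamma> - 1) * s\<^sup>2 + 2 * \<gamma> * s * t + \<gamma> / (\<gamma> - 1) * t\<^sup>2
    = \<gamma> / (\<gamma> - 1) * ((\<gamma> - 1) * s + t)\<^sup>2"
  proof -
    define e where "e = \<gamma> - 1"
    have "e \<noteq> 0" "\<gamma> = e + 1" using n by (auto simp: e_def)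
    then show ?thesis unfolding e_def[symmetric] by (simp add: field_simps power2_eq_square)
  qed
  then show ?thesis using g by simp
qed

context lane_emden
begin

text \<open>Green's formula for \<open>v\<close> and \<open>u\<^bsup>\<gamma>\<^esup> \<phi>\<^sup>n\<close>. For \<open>\<gamma> > 1\<close> the term \<open>- \<gamma> (\<gamma> - 1) v u\<^bsup>\<gamma>-2\<^esup> \<bar>\<nabla>u\<bar>\<^sup>2 \<phi>\<^sup>n\<close> has a good sign and
absorbs the mixed term \<open>2 \<gamma> v u\<^bsup>\<gamma>-1\<^esup> \<nabla>u \<bullet> \<nabla>\<phi>\<^sup>n\<close>.\<close>

lemma power_estimate:
  assumes g: "\<gamma> > 1" and l: "n \<ge> 3"
  obtains K where "K \<ge> 0"
    "\<And>R. R > 0 \<Longrightarrow> integral (cube c R) (\<lambda>x. u x powr (\<gamma> + q) * bump c R x ^ n)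
      \<le> \<gamma> * integral (cube c R) (\<lambda>x. v x powr (p + 1) * u x powr (\<gamma> - 1) * bump c R x ^ n)
        + K * (integral (cube c R) (\<lambda>x. v x * u x powr \<gamma> * bump c R x ^ (n - 2)) / R\<^sup>2)"
proof -
  define K where "K = \<gamma> / (\<gamma> - 1) * (4 * (real n)\<^sup>2) + (4 * (real n)\<^sup>2 + 2 * real n * DIM('a))"
  have K: "K \<ge> 0" unfolding K_def using g by (intro add_nonneg_nonneg mult_nonneg_nonneg) auto
  note u' = C2_funD(4,5)[OF Cu _ UNIV_I] and v' = C2_funD(4,5)[OF Cv _ UNIV_I]
  show ?thesis
  proof (rule that[OF K])
    fix R :: real assume R: "R > 0"
    let ?Q = "cube c R" and ?b = "bump c R" and ?B1 = "bump1 n c R" and ?B2 = "bump2 n c R"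
    define G1 where "G1 = (\<lambda>i x. \<gamma> * (u x powr (\<gamma> - 1) * (u1 i x * ?b x ^ n)) + u x powr \<gamma> * ?B1 i x)"
    define G2 where "G2 = (\<lambda>i x. \<gamma> * (((\<gamma> - 1) * u x powr (\<gamma> - 1 - 1) * u1 i x) * (u1 i x * ?b x ^ n)
        + u x powr (\<gamma> - 1) * (u2 i x * ?b x ^ n + u1 i x * ?B1 i x))
      + ((\<gamma> * u x powr (\<gamma> - 1) * u1 i x) * ?B1 i x + u x powr \<gamma> * ?B2 i x))"
    (* G1 and G2 are the first and second derivatives of u^gamma bump^n. *)
    define F where "F = (\<lambda>i x. v x * G1 i x - u x powr \<gamma> * ?b x ^ n * v1 i x)"
    define D where "D = (\<lambda>i x. v x * G2 i x - u x powr \<gamma> * ?b x ^ n * v2 i x)"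
    define h where "h = (\<lambda>x. \<gamma> * (v x powr (p + 1) * u x powr (\<gamma> - 1) * ?b x ^ n) + K / R\<^sup>2 * (v x * u x powr \<gamma> * ?b x ^ (n - 2)))"
    have b0: "?B1 i x = 0" "?B2 i x = 0" if "?b x = 0" for i x
      using that l by (auto simp: bump1_def bump2_def zero_power)
    have sb: "has_slope i (\<lambda>x. ?b x ^ n) (?B1 i x) x" if "i \<in> Basis" for i x
      unfolding bump1_def using l by (intro slope_bump_power that) simp
    have cts: "continuous_on UNIV (G1 i)" "continuous_on UNIV (G2 i)" if "i \<in> Basis" for i
      unfolding G1_def G2_def
      by (intro continuous_on_add continuous_on_mult continuous_on_const cont_powr cont_d that continuous_bump12 continuous_on_power continuous_bump continuous_on_id)+
    have "integral ?Q (\<lambda>x. u x powr (\<gamma> + q) * ?b x ^ n) \<le> integral ?Q h"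
    proof (rule integral_le_mod_divergence[OF R open_UNIV subset_UNIV, where F = F and D = D])
      fix i x :: 'a assume i: "i \<in> Basis"
      have 1: "has_slope i (\<lambda>x. u x powr \<gamma> * ?b x ^ n) (G1 i x) x"
        by (rule has_slope_eq[OF has_slope_mult[OF has_slope_powr[OF u'(1)[OF i] u_pos] sb[OF i]]])
          (simp add: G1_def mult_ac)
      have 2: "has_slope i (G1 i) (G2 i x) x"
        unfolding G1_def G2_def
        by (rule has_slope_add[OF has_slope_cmult[OF has_slope_mult[OF has_slope_powr[OF u'(1)[OF i] u_pos]
                has_slope_mult[OF u'(2)[OF i] sb[OF i]]]]
              has_slope_mult[OF has_slope_powr[OF u'(1)[OF i] u_pos] slope_bump1[OF l i]]])
      show "has_slope i (F i) (D i x) x"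
        unfolding F_def
        by (rule has_slope_eq[OF has_slope_diff[OF has_slope_mult[OF v'(1)[OF i] 2] has_slope_mult[OF 1 v'(2)[OF i]]]])
          (simp add: D_def algebra_simps)
    next
      fix x
      have pt: "D i x \<ge> \<gamma> * v x * u x powr (\<gamma> - 1) * ?b x ^ n * u2 i x + v x * u x powr \<gamma> * ?B2 i x
          - \<gamma> / (\<gamma> - 1) * v x * u x powr \<gamma> * (?b x ^ (n - 2) * (real n * (- 2 * ((x - c) \<bullet> i) / R\<^sup>2))\<^sup>2)
          - u x powr \<gamma> * ?b x ^ n * v2 i x" for i
      proof -
        define d where "d = real n * (- 2 * ((x - c) \<bullet> i) / R\<^sup>2)"
        define y where "y = ?b x"
        define A where "A = u x powr (\<gamma> - 2)"
        define U where "U = u x"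
        have "\<exists>j. n = Suc (Suc j)" using l by presburger
        then obtain j where j: "n = Suc (Suc j)" by blast
        have B1: "?B1 i x = y ^ j * y * d" unfolding bump1_def d_def y_def j by (simp add: mult_ac)
        have yn: "?b x ^ n = y ^ j * y\<^sup>2" unfolding j y_def by (simp add: power2_eq_square mult_ac)
        have yj: "?b x ^ (n - 2) = y ^ j" unfolding j y_def by simp
        have A1: "u x powr (\<gamma> - 1) = A * U" and A2: "u x powr \<gamma> = A * U\<^sup>2"
          unfolding A_def U_def
          using u_pos[of x] powr_add[of "u x" "\<gamma> - 2" 1] powr_add[of "u x" "\<gamma> - 2" 2] by simp_all
        have A3: "u x powr (\<gamma> - 1 - 1) = A" by (simp add: A_def)
        have "D i x - (\<gamma> * v x * u x powr (\<gamma> - 1) * ?b x ^ n * u2 i x + v x * u x powr \<gamma> * ?B2 i x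
          - \<gamma> / (\<gamma> - 1) * v x * u x powr \<gamma> * (?b x ^ (n - 2) * d\<^sup>2) - u x powr \<gamma> * ?b x ^ n * v2 i x)
          = v x * A * y ^ j * (\<gamma> * (\<gamma> - 1) * (u1 i x * y)\<^sup>2 + 2 * \<gamma> * (u1 i x * y) * (U * d) + \<gamma> / (\<gamma> - 1) * (U * d)\<^sup>2)"
          unfolding D_def G2_def B1 yn yj A1 A2 A3
          by (simp add: distrib_left distrib_right right_diff_distrib left_diff_distrib power2_eq_square mult_ac)
        also have "\<dots> \<ge> 0"
          using v_pos[of x] by (intro mult_nonneg_nonneg completed_square_nonneg g) (auto simp: A_def y_def)
        finally show ?thesis unfolding d_def by linarith
      qed
      have s1: "(\<Sum>i\<in>Basis. ?b x ^ (n - 2) * (real n * (- 2 * ((x - c) \<bullet> i) / R\<^sup>2))\<^sup>2) \<le> 4 * (real n)\<^sup>2 * ?b x ^ (n - 2) / R\<^sup>2"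
      proof -
        have "?b x ^ (n - 2) * (real n * (- 2 * ((x - c) \<bullet> i) / R\<^sup>2))\<^sup>2 = 4 * (real n)\<^sup>2 * (?b x ^ (n - 2) * ((x - c) \<bullet> i)\<^sup>2 / R ^ 4)" for i
          unfolding power_mult_distrib power_divide by simp
        then have "(\<Sum>i\<in>Basis. ?b x ^ (n - 2) * (real n * (- 2 * ((x - c) \<bullet> i) / R\<^sup>2))\<^sup>2)
          = 4 * (real n)\<^sup>2 * (?b x ^ (n - 2) * (\<Sum>i\<in>Basis. ((x - c) \<bullet> i)\<^sup>2) / R ^ 4)"
          by (simp flip: sum_distrib_left sum_divide_distrib)
        also have "\<dots> = 4 * (real n)\<^sup>2 * (?b x ^ (n - 2) * (1 - ?b x) / R\<^sup>2)"
          unfolding sum_inner_sq using bump_norm_sq[OF R, of "n - 2" c x] l by simp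
        also have "\<dots> \<le> 4 * (real n)\<^sup>2 * (?b x ^ (n - 2) * 1 / R\<^sup>2)"
          by (intro mult_left_mono divide_right_mono) auto
        finally show ?thesis by simp
      qed
      have s2: "- (\<Sum>i\<in>Basis. ?B2 i x) \<le> (4 * (real n)\<^sup>2 + 2 * real n * DIM('a)) * ?b x ^ (n - 2) / R\<^sup>2"
        using abs_sum_bump2_le[OF R l, of c x] by linarith
      define S1 where "S1 = (\<Sum>i\<in>Basis. ?b x ^ (n - 2) * (real n * (- 2 * ((x - c) \<bullet> i) / R\<^sup>2))\<^sup>2)"
      define S2 where "S2 = (\<Sum>i\<in>Basis. ?B2 i x)"
      have "(\<Sum>i\<in>Basis. D i x) \<ge> (\<Sum>i\<in>Basis. \<gamma> * v x * u x powr (\<gamma> - 1) * ?b x ^ n * u2 i x + v x * u x powr \<gamma> * ?B2 i x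
          - \<gamma> / (\<gamma> - 1) * v x * u x powr \<gamma> * (?b x ^ (n - 2) * (real n * (- 2 * ((x - c) \<bullet> i) / R\<^sup>2))\<^sup>2)
          - u x powr \<gamma> * ?b x ^ n * v2 i x)"
        by (intro sum_mono pt)
      also have "(\<Sum>i\<in>Basis. \<gamma> * v x * u x powr (\<gamma> - 1) * ?b x ^ n * u2 i x + v x * u x powr \<gamma> * ?B2 i x
          - \<gamma> / (\<gamma> - 1) * v x * u x powr \<gamma> * (?b x ^ (n - 2) * (real n * (- 2 * ((x - c) \<bullet> i) / R\<^sup>2))\<^sup>2)
          - u x powr \<gamma> * ?b x ^ n * v2 i x)
        = \<gamma> * v x * u x powr (\<gamma> - 1) * ?b x ^ n * (\<Sum>i\<in>Basis. u2 i x) + v x * u x powr \<gamma> * S2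
          - \<gamma> / (\<gamma> - 1) * v x * u x powr \<gamma> * S1 - u x powr \<gamma> * ?b x ^ n * (\<Sum>i\<in>Basis. v2 i x)"
        unfolding S1_def S2_def by (simp only: sum.distrib sum_subtractf sum_distrib_left)
      also have "(\<Sum>i\<in>Basis. u2 i x) = - (v x powr p)" using eq_u[of x] by simp
      also have "(\<Sum>i\<in>Basis. v2 i x) = - (u x powr q)" using eq_v[of x] by simp
      finally have D: "(\<Sum>i\<in>Basis. D i x) \<ge> - \<gamma> * (v x powr (p + 1) * u x powr (\<gamma> - 1) * ?b x ^ n)
          - v x * u x powr \<gamma> * (\<gamma> / (\<gamma> - 1) * S1 - S2) + u x powr (\<gamma> + q) * ?b x ^ n"
        using v_pos[of x] by (simp add: powr_add algebra_simps)
      have "\<gamma> / (\<gamma> - 1) * S1 - S2 \<le> K / R\<^sup>2 * ?b x ^ (n - 2)"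
      proof -
        have "\<gamma> / (\<gamma> - 1) * S1 \<le> \<gamma> / (\<gamma> - 1) * (4 * (real n)\<^sup>2 * ?b x ^ (n - 2) / R\<^sup>2)"
          using s1 g unfolding S1_def by (intro mult_left_mono) auto
        moreover have "K / R\<^sup>2 * ?b x ^ (n - 2) = \<gamma> / (\<gamma> - 1) * (4 * (real n)\<^sup>2 * ?b x ^ (n - 2) / R\<^sup>2) + (4 * (real n)\<^sup>2 + 2 * real n * DIM('a)) * ?b x ^ (n - 2) / R\<^sup>2"
          unfolding K_def by (simp add: add_divide_distrib distrib_right)
        ultimately show ?thesis using s2 unfolding S2_def by linarith
      qed
      then have "v x * u x powr \<gamma> * (\<gamma> / (\<gamma> - 1) * S1 - S2) \<le> v x * u x powr \<gamma> * (K / R\<^sup>2 * ?b x ^ (n - 2))"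
        using v_pos[of x] by (intro mult_left_mono) auto
      with D show "u x powr (\<gamma> + q) * ?b x ^ n \<le> h x + (\<Sum>i\<in>Basis. D i x)"
        unfolding h_def by (simp add: mult_ac)
    next
      fix i :: 'a assume i: "i \<in> Basis"
      show "continuous_on UNIV (F i)" "continuous_on UNIV (D i)"
        unfolding F_def D_def
        by (intro continuous_on_diff continuous_on_mult cts i cont_uv cont_powr cont_d continuous_on_power continuous_bump continuous_on_id)+
    next
      show "continuous_on ?Q (\<lambda>x. u x powr (\<gamma> + q) * ?b x ^ n)" "continuous_on ?Q h"
        unfolding h_def
        by (intro continuous_on_add continuous_on_mult continuous_on_const cont_uv cont_powr continuous_on_power continuous_bump continuous_on_id)+
    qed (use l in \<open>auto simp: F_def D_def G1_def G2_def b0 zero_power\<close>)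
    also have "integral ?Q h = integral ?Q (\<lambda>x. \<gamma> * (v x powr (p + 1) * u x powr (\<gamma> - 1) * ?b x ^ n))
      + integral ?Q (\<lambda>x. K / R\<^sup>2 * (v x * u x powr \<gamma> * ?b x ^ (n - 2)))"
      unfolding h_def
      by (intro integral_add integrable_cube continuous_on_mult continuous_on_const cont_uv cont_powr continuous_on_power continuous_bump continuous_on_id)
    finally show "integral ?Q (\<lambda>x. u x powr (\<gamma> + q) * ?b x ^ n)
      \<le> \<gamma> * integral ?Q (\<lambda>x. v x powr (p + 1) * u x powr (\<gamma> - 1) * ?b x ^ n)
        + K * (integral ?Q (\<lambda>x. v x * u x powr \<gamma> * ?b x ^ (n - 2)) / R\<^sup>2)"
      unfolding integral_mult_right by simp
  qed
qed

end

context stable_lane_emden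
begin

text \<open>The estimates of \<open>T\<close> by \<open>F = R\<^sup>-\<^sup>2 \<integral> u\<^sup>X \<phi>\<^bsup>2k-2\<^esup>\<close> and of \<open>F\<close> by small multiples of \<open>T\<close> and \<open>F\<close> close up.\<close>

lemma reaction_decay:
  assumes X: "X > q + 1"
    and adm: "((p + 1) / (q + 1))\<^sup>2 * X ^ 4 < 16 * p * q * (X - 1) * ((p + 1) / (q + 1) * X - 1)"
    and k: "k \<ge> 3" "2 * real k \<ge> 2 + alpha p q * X"
  obtains C where "C \<ge> 0"
    "\<And>R. R > 0 \<Longrightarrow> integral (cube 0 R) (\<lambda>x. v x powr p * u x powr (X - 1) * bump 0 R x ^ (2 * k))
      \<le> C * (R powr (- 2 - alpha p q * X) * (2 * R) ^ DIM('a))"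
proof -
  let ?r = "- 2 - alpha p q * X"
  have k2: "k \<ge> 2" and k3: "2 * k - 2 \<ge> 3" "2 * k - 2 - 2 = 2 * k - 4" using k(1) by auto
  define \<gamma> where "\<gamma> = X - q"
  have g: "\<gamma> > 1" "\<gamma> + q = X" "\<gamma> - 1 = X - q - 1" using X by (auto simp: \<gamma>_def)
  obtain C0 where C0: "C0 \<ge> 0" "\<And>R. R > 0 \<Longrightarrow> integral (cube 0 R) (\<lambda>x. v x powr p * u x powr (X - 1) * bump 0 R x ^ (2 * k))
      \<le> C0 * (integral (cube 0 R) (\<lambda>x. u x powr X * bump 0 R x ^ (2 * k - 2)) / R\<^sup>2)"
    using reaction_estimate[OF X k2 adm] by blast
  obtain K where K: "K \<ge> 0" "\<And>R. R > 0 \<Longrightarrow> integral (cube 0 R) (\<lambda>x. u x powr X * bump 0 R x ^ (2 * k - 2))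
      \<le> \<gamma> * integral (cube 0 R) (\<lambda>x. v x powr (p + 1) * u x powr (X - q - 1) * bump 0 R x ^ (2 * k - 2))
        + K * (integral (cube 0 R) (\<lambda>x. v x * u x powr (X - q) * bump 0 R x ^ (2 * k - 4)) / R\<^sup>2)"
    using power_estimate[OF g(1) k3(1), of 0] unfolding g(2,3) k3(2) unfolding \<gamma>_def by blast
  (* Small enough that the absorbed terms add up to at most 3/4 F. *)
  define e1 where "e1 = 1 / (4 * \<gamma> * (C0 + 1))"
  define e2 where "e2 = 1 / (2 * (K + 1))"
  have e: "e1 > 0" "e2 > 0" using g C0 K by (auto simp: e1_def e2_def)
  obtain C1 where C1: "C1 \<ge> 0" "\<And>R y a b. R > 0 \<Longrightarrow> 0 \<le> y \<Longrightarrow> y \<le> 1 \<Longrightarrow> a > 0 \<Longrightarrow> b > 0 \<Longrightarrow> b \<le> comparison_const * a powr ((q + 1) / (p + 1)) \<Longrightarrow>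
      b powr (p + 1) * a powr (X - q - 1) * y ^ (2 * k - 2) / R\<^sup>2 \<le> e1 * (b powr p * a powr (X - 1) * y ^ (2 * k)) + C1 * R powr ?r"
    using cutoff_pointwise_bounds[OF pq X comparison_const_pos e(1) k] by metis
  obtain C2 where C2: "C2 \<ge> 0" "\<And>R y a b. R > 0 \<Longrightarrow> 0 \<le> y \<Longrightarrow> y \<le> 1 \<Longrightarrow> a > 0 \<Longrightarrow> b > 0 \<Longrightarrow> b \<le> comparison_const * a powr ((q + 1) / (p + 1)) \<Longrightarrow>
      b * a powr (X - q) * y ^ (2 * k - 4) / R ^ 4 \<le> e2 * (a powr X * y ^ (2 * k - 2) / R\<^sup>2) + C2 * R powr ?r"
    using cutoff_pointwise_bounds[OF pq X comparison_const_pos e(2) k] by metis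
  define C where "C = C0 * (4 * (\<gamma> * C1 + K * C2))"
  have C: "C \<ge> 0" using C0 C1 C2 K g by (simp add: C_def)
  show ?thesis
  proof (rule that[OF C])
    fix R :: real assume R: "R > 0"
    let ?Q = "cube (0::'a) R" and ?b = "\<lambda>j x. bump 0 R x ^ j"
    define V where "V = R powr ?r * (2 * R) ^ DIM('a)"
    define T where "T = integral ?Q (\<lambda>x. v x powr p * u x powr (X - 1) * ?b (2 * k) x)"
    define F where "F = integral ?Q (\<lambda>x. u x powr X * ?b (2 * k - 2) x) / R\<^sup>2"
    define P where "P = integral ?Q (\<lambda>x. v x powr (p + 1) * u x powr (X - q - 1) * ?b (2 * k - 2) x) / R\<^sup>2"
    define S where "S = integral ?Q (\<lambda>x. v x * u x powr (X - q) * ?b (2 * k - 4) x) / R ^ 4"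
    have cb: "continuous_on A (?b j)" for A :: "'a set" and j by (intro continuous_intros)
    have const: "integral ?Q (\<lambda>_. c * R powr ?r) = c * V" for c
      using measure_cube[OF R, of "0::'a"] by (simp add: cube_def V_def)
    have F0: "F \<ge> 0" unfolding F_def using R
      by (intro divide_nonneg_nonneg integral_nonneg integrable_cube continuous_on_mult cont_powr cb) auto
    have T0: "T \<ge> 0" unfolding T_def
      by (intro integral_nonneg integrable_cube continuous_on_mult cont_powr cb) auto
    have V0: "V \<ge> 0" using R by (simp add: V_def)
    have TF: "T \<le> C0 * F" using C0(2)[OF R] by (simp add: T_def F_def)
    have FPS: "F \<le> \<gamma> * P + K * S"
    proof -
      have "F \<le> (\<gamma> * integral (cube 0 R) (\<lambda>x. v x powr (p + 1) * u x powr (X - q - 1) * bump 0 R x ^ (2 * k - 2))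
        + K * (integral (cube 0 R) (\<lambda>x. v x * u x powr (X - q) * bump 0 R x ^ (2 * k - 4)) / R\<^sup>2)) / R\<^sup>2"
        unfolding F_def by (intro divide_right_mono K(2) R) simp
      also have "\<dots> = \<gamma> * P + K * S"
        by (simp add: P_def S_def add_divide_distrib power4_eq_xxxx power2_eq_square)
      finally show ?thesis .
    qed
    have PT: "P \<le> e1 * T + C1 * V"
    proof -
      have "P = integral ?Q (\<lambda>x. v x powr (p + 1) * u x powr (X - q - 1) * ?b (2 * k - 2) x / R\<^sup>2)"
        unfolding P_def by simp
      also have "\<dots> \<le> integral ?Q (\<lambda>x. e1 * (v x powr p * u x powr (X - 1) * ?b (2 * k) x) + C1 * R powr ?r)"
        unfolding divide_inverse
        by (intro integral_le integrable_cube continuous_on_add continuous_on_mult continuous_on_const cont_powr cb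
            C1(2)[unfolded divide_inverse] R bump_nonneg bump_le_1 u_pos v_pos v_le[unfolded divide_inverse])
      also have "\<dots> = integral ?Q (\<lambda>x. e1 * (v x powr p * u x powr (X - 1) * ?b (2 * k) x)) + integral ?Q (\<lambda>_. C1 * R powr ?r)"
        by (intro integral_add integrable_cube continuous_on_mult continuous_on_const cont_powr cb)
      also have "\<dots> = e1 * T + C1 * V" using const[of C1] by (simp add: T_def)
      finally show ?thesis .
    qed
    have SF: "S \<le> e2 * F + C2 * V"
    proof -
      have "S = integral ?Q (\<lambda>x. v x * u x powr (X - q) * ?b (2 * k - 4) x / R ^ 4)"
        unfolding S_def by simp
      also have "\<dots> \<le> integral ?Q (\<lambda>x. e2 * (u x powr X * ?b (2 * k - 2) x / R\<^sup>2) + C2 * R powr ?r)"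
        unfolding divide_inverse
        by (intro integral_le integrable_cube continuous_on_add continuous_on_mult continuous_on_const cont_uv cont_powr cb
            C2(2)[unfolded divide_inverse] R bump_nonneg bump_le_1 u_pos v_pos v_le[unfolded divide_inverse])
      also have "\<dots> = integral ?Q (\<lambda>x. e2 * (u x powr X * ?b (2 * k - 2) x / R\<^sup>2)) + integral ?Q (\<lambda>_. C2 * R powr ?r)"
        unfolding divide_inverse
        by (intro integral_add integrable_cube continuous_on_mult continuous_on_const cont_powr cb)
      also have "\<dots> = e2 * F + C2 * V" using const[of C2] by (simp add: F_def)
      finally show ?thesis .
    qed
    have a: "K * (e2 * F) \<le> F / 2"
    proof -
      have "K * e2 \<le> 1 / 2" using K(1) by (simp add: e2_def field_simps)
      from mult_right_mono[OF this F0] show ?thesis by simp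
    qed
    have b: "\<gamma> * (e1 * T) \<le> F / 4"
    proof -
      have "\<gamma> * (e1 * T) = T / (4 * (C0 + 1))" using g(1) by (simp add: e1_def)
      also have "\<dots> \<le> C0 * F / (4 * (C0 + 1))" using TF C0 by (intro divide_right_mono) auto
      also have "\<dots> \<le> F / 4" using C0(1) F0 by (simp add: field_simps)
      finally show ?thesis .
    qed
    have "F \<le> \<gamma> * (e1 * T + C1 * V) + K * (e2 * F + C2 * V)"
    proof -
      have "\<gamma> * P \<le> \<gamma> * (e1 * T + C1 * V)" using g(1) by (intro mult_left_mono PT) simp
      moreover have "K * S \<le> K * (e2 * F + C2 * V)" by (intro mult_left_mono SF K(1))
      ultimately show ?thesis using FPS by linarith
    qed
    also have "\<dots> = \<gamma> * (e1 * T) + K * (e2 * F) + (\<gamma> * C1 + K * C2) * V" by (simp add: algebra_simps)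
    finally have "F \<le> 4 * ((\<gamma> * C1 + K * C2) * V)" using a b by linarith
    then have "C0 * F \<le> C0 * (4 * ((\<gamma> * C1 + K * C2) * V))" by (rule mult_left_mono) (rule C0(1))
    then show "integral ?Q (\<lambda>x. v x powr p * u x powr (X - 1) * ?b (2 * k) x) \<le> C * (R powr ?r * (2 * R) ^ DIM('a))"
      using TF unfolding T_def[symmetric] V_def[symmetric] C_def by (simp add: mult_ac)
  qed
qed

lemma dimension_bound:
  assumes X: "X > q + 1"
    and adm: "((p + 1) / (q + 1))\<^sup>2 * X ^ 4 < 16 * p * q * (X - 1) * ((p + 1) / (q + 1) * X - 1)"
  shows "2 + alpha p q * X \<le> real DIM('a)"
proof (rule ccontr)
  let ?N = "DIM('a)"
  assume "\<not> ?thesis"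
  then have N: "real ?N - 2 - alpha p q * X < 0" by simp
  obtain k0 where k0: "2 + alpha p q * X \<le> real k0" using real_arch_simple by blast
  define k where "k = k0 + 3"
  have k: "k \<ge> 3" "2 * real k \<ge> 2 + alpha p q * X" using k0 by (auto simp: k_def)
  obtain C where C: "C \<ge> 0" "\<And>R. R > 0 \<Longrightarrow> integral (cube 0 R) (\<lambda>x. v x powr p * u x powr (X - 1) * bump 0 R x ^ (2 * k))
      \<le> C * (R powr (- 2 - alpha p q * X) * (2 * R) ^ ?N)"
    using reaction_decay[OF X adm k] by blast
  let ?h = "\<lambda>x. v x powr p * u x powr (X - 1)"
  let ?Q = "cube (0::'a) 1"
  have hpos: "?h x > 0" for x using u_pos[of x] v_pos[of x] by simp
  have ch: "continuous_on A ?h" for A by (intro continuous_on_mult cont_powr)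
  have chb: "continuous_on A (\<lambda>x. ?h x * bump 0 R x ^ (2 * k))" for A R
    by (intro continuous_on_mult cont_powr continuous_on_power continuous_bump continuous_on_id)
  have "0 \<in> ?Q" by (simp add: mem_cube)
  then have ne: "?Q \<noteq> {}" by blast
  obtain x0 where x0: "\<And>x. x \<in> ?Q \<Longrightarrow> ?h x0 \<le> ?h x"
    using continuous_attains_inf[OF compact_cube ne ch] by blast
  define c where "c = ?h x0 * (1/2) ^ (2 * k) * 2 ^ ?N"
  have c: "c > 0" unfolding c_def by (intro mult_pos_pos hpos) auto
  have lower: "c \<le> integral (cube 0 R) (\<lambda>x. ?h x * bump 0 R x ^ (2 * k))" if R: "R \<ge> 2 * ?N" for R :: real
  proof -
    have N1: "real ?N \<ge> 1" using DIM_positive[where 'a='a] by linarith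
    have R1: "R > 0" "1 \<le> R" using R N1 by linarith+
    have b: "bump 0 R x \<ge> 1/2" if x: "x \<in> ?Q" for x
    proof -
      have "norm x \<le> (\<Sum>i\<in>Basis. \<bar>x \<bullet> i\<bar>)" by (rule norm_le_l1)
      also have "\<dots> \<le> (\<Sum>i\<in>(Basis::'a set). 1)" using x by (intro sum_mono) (auto simp: mem_cube)
      also have "\<dots> = real ?N" by simp
      finally have "norm x \<le> R / 2" using R by simp
      then have "(norm x)\<^sup>2 \<le> (R / 2)\<^sup>2" by (rule power_mono) simp
      also have "(R / 2)\<^sup>2 \<le> R\<^sup>2 / 2" by (simp add: power_divide)
      finally have "(norm x)\<^sup>2 / R\<^sup>2 \<le> 1/2" using R1 by (simp add: field_simps)
      then show ?thesis by (simp add: bump_def le_max_iff_disj)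
    qed
    have "c = integral ?Q (\<lambda>_. ?h x0 * (1/2) ^ (2 * k))"
      using measure_cube[of 1 "0::'a"] by (simp add: cube_def c_def)
    also have "\<dots> \<le> integral ?Q (\<lambda>x. ?h x * bump 0 R x ^ (2 * k))"
    proof (intro integral_le integrable_cube chb continuous_on_const)
      fix x assume x: "x \<in> ?Q"
      have "?h x \<ge> 0" using hpos[of x] by simp
      then show "?h x0 * (1/2) ^ (2 * k) \<le> ?h x * bump 0 R x ^ (2 * k)"
        by (intro mult_mono[OF x0[OF x]] power_mono b x) auto
    qed
    also have "\<dots> \<le> integral (cube 0 R) (\<lambda>x. ?h x * bump 0 R x ^ (2 * k))"
    proof -
      have nn: "0 \<le> ?h x * bump 0 R x ^ (2 * k)" for x
        using hpos[of x] by (intro mult_nonneg_nonneg) (auto simp: less_imp_le)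
      show ?thesis by (intro integral_subset_le cube_mono R1 integrable_cube chb ballI nn)
    qed
    finally show ?thesis .
  qed
  have "((\<lambda>R. C * 2 ^ ?N * R powr (real ?N - 2 - alpha p q * X)) \<longlongrightarrow> C * 2 ^ ?N * 0) at_top"
    by (intro tendsto_mult tendsto_const tendsto_neg_powr N filterlim_ident)
  then have "eventually (\<lambda>R. C * 2 ^ ?N * R powr (real ?N - 2 - alpha p q * X) < c) at_top"
    using c by (intro order_tendstoD(2)) auto
  then obtain R where R: "R \<ge> max 1 (2 * real ?N)" "C * 2 ^ ?N * R powr (real ?N - 2 - alpha p q * X) < c"
    unfolding eventually_at_top_linorder by (metis max.cobounded1 max.cobounded2 order_refl)
  have R0: "R > 0" using R by simp
  have "c \<le> C * (R powr (- 2 - alpha p q * X) * (2 * R) ^ ?N)"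
    using lower[of R] C(2)[OF R0] R by simp
  also have "\<dots> = C * 2 ^ ?N * R powr (real ?N - 2 - alpha p q * X)"
  proof -
    have "real ?N - 2 - alpha p q * X = (- 2 - alpha p q * X) + real ?N" by simp
    then have "R powr (real ?N - 2 - alpha p q * X) = R powr ((- 2 - alpha p q * X) + real ?N)" by (rule arg_cong)
    also have "\<dots> = R powr (- 2 - alpha p q * X) * R powr (real ?N)" by (rule powr_add)
    also have "R powr (real ?N) = R ^ ?N" using R0 by (rule powr_realpow)
    finally show ?thesis by (simp add: power_mult_distrib)
  qed
  finally show False using R(2) by simp
qed

end

section \<open>The quartic polynomial\<close>

text \<open>The logarithm of the function is a sum of logarithms of affine functions, hence concave.\<close>

lemma log_concave_between:
  fixes m y0 y1 y :: real
  assumes m: "1 \<le> m" and y: "0 < y0" "y0 < y" "y < y1" "y1 < 1" and K: "K > 0"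
    and f0: "1 \<le> K * (y0\<^sup>2 * (1 - y0) * (m - y0))" and f1: "1 < K * (y1\<^sup>2 * (1 - y1) * (m - y1))"
  shows "1 < K * (y\<^sup>2 * (1 - y) * (m - y))"
proof -
  define g where "g = (\<lambda>y. ln K + (2 * ln y + ln (1 - y) + ln (m - y)))"
  have g: "ln (K * (y\<^sup>2 * (1 - y) * (m - y))) = g y" if "0 < y" "y < 1" for y
    using that m K by (simp add: g_def ln_mult ln_realpow)
  define t where "t = (y - y0) / (y1 - y0)"
  have t: "0 < t" "t < 1" using y by (auto simp: t_def)
  have yt: "y = (1 - t) * y0 + t * y1"
  proof -
    have "t * (y1 - y0) = y - y0" using y by (simp add: t_def)
    then show ?thesis by (simp add: algebra_simps)
  qed
  have cc: "(1 - t) * ln a + t * ln b \<le> ln ((1 - t) * a + t * b)" if "a > 0" "b > 0" for a b :: real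
    using ln_concave t that unfolding concave_on_iff by auto
  have "(1 - t) * ln y0 + t * ln y1 \<le> ln y" using cc[of y0 y1] y unfolding yt by simp
  moreover have "(1 - t) * ln (1 - y0) + t * ln (1 - y1) \<le> ln (1 - y)"
    using cc[of "1 - y0" "1 - y1"] y unfolding yt by (simp add: algebra_simps)
  moreover have "(1 - t) * ln (m - y0) + t * ln (m - y1) \<le> ln (m - y)"
    using cc[of "m - y0" "m - y1"] y m unfolding yt by (simp add: algebra_simps)
  ultimately have "(1 - t) * g y0 + t * g y1 \<le> g y" unfolding g_def by (simp add: algebra_simps)
  moreover have "g y0 \<ge> 0" using g[of y0] f0 y by (metis less_trans ln_ge_zero)
  moreover have "g y1 > 0" using g[of y1] f1 y by (metis less_trans ln_gt_zero)
  ultimately have "g y > 0" using t by (smt (verit) mult_nonneg_nonneg mult_pos_pos)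
  then have "0 < ln (K * (y\<^sup>2 * (1 - y) * (m - y)))" using g[of y] y by simp
  moreover have "0 < K * (y\<^sup>2 * (1 - y) * (m - y))" using y m K by simp
  ultimately show ?thesis by (simp add: ln_gt_zero_iff)
qed

lemma poly_G_poly:
  assumes "p > 0" "q > 0"
  shows "poly (G_poly p q) (X / 2) * (16 * ((p + 1) / (q + 1))\<^sup>2)
    = ((p + 1) / (q + 1))\<^sup>2 * X ^ 4 - 16 * p * q * (X - 1) * ((p + 1) / (q + 1) * X - 1)"
proof -
  define a b where "a = p + 1" and "b = q + 1"
  have ab: "a \<noteq> 0" "b \<noteq> 0" "p + q + 2 = a + b" using assms by (auto simp: a_def b_def)
  have "poly (G_poly p q) (X / 2) = X ^ 4 / 16 - 4 * p * q * b / a * (X / 2)\<^sup>2 + 2 * p * q * b * (a + b) / a\<^sup>2 * (X / 2) - p * q * b\<^sup>2 / a\<^sup>2"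
    unfolding G_poly_def ab(3) a_def[symmetric] b_def[symmetric] by (simp add: poly_monom power_divide)
  also have "\<dots> * (16 * (a / b)\<^sup>2) = (a / b)\<^sup>2 * X ^ 4 - 16 * p * q * (X - 1) * (a / b * X - 1)"
    using ab(1,2) by (simp add: field_simps power2_eq_square power4_eq_xxxx)
  finally show ?thesis unfolding a_def b_def .
qed

text \<open>The last hypothesis says \<open>p + q + 1 < 3 p q\<close>. With \<open>s = \<surd>(p q)\<close> and \<open>2 s \<le> p + q\<close> this gives \<open>(3 s + 1) (s - 1) > 0\<close>.\<close>

lemma product_gt_1:
  fixes p q :: real
  assumes "q \<le> p" "q > 1 / 3" "p > (q + 1) / (3 * q - 1)"
  shows "p * q > 1" "(p + 1) * (q + 1) < 4 * p * q"
proof -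
  have "q + 1 < p * (3 * q - 1)" using assms by (simp add: divide_less_eq)
  then have h: "p + q + 1 < 3 * (p * q)" by (simp add: algebra_simps)
  then show "(p + 1) * (q + 1) < 4 * p * q" by (simp add: algebra_simps)
  have pos: "p > 0" "q > 0" using assms by auto
  define s where "s = sqrt (p * q)"
  have s: "s > 0" "s\<^sup>2 = p * q" using pos by (auto simp: s_def)
  have "2 * s \<le> p + q" unfolding s_def using arith_geo_mean_sqrt[of p q] pos by simp
  then have "0 < (3 * s + 1) * (s - 1)" using h s by (simp add: algebra_simps power2_eq_square)
  then have "s > 1" using s(1) by (simp add: zero_less_mult_iff)
  then have "s\<^sup>2 > 1" by (simp add: one_less_power)
  then show "p * q > 1" using s by simp
qed

text \<open>\<open>D X\<close> is a positive multiple of \<open>G_poly p q\<close> at \<open>X / 2\<close>. It is negative at \<open>q + 1\<close>, so there is a root beyond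
\<open>(q + 1) / 2\<close> and \<open>2 z > q + 1\<close>; log-concavity in \<open>1 / X\<close> makes it negative on the whole interval between \<open>q + 1\<close> and
\<open>2 z\<close>.\<close>

lemma admissible_exponent:
  fixes p q z :: real
  assumes qp: "q \<le> p" "q > 1 / 3" "p > (q + 1) / (3 * q - 1)"
    and z: "poly (G_poly p q) z = 0" "\<And>x. poly (G_poly p q) x = 0 \<Longrightarrow> x \<le> z"
    and N: "N < 2 * alpha p q * z + 2"
  obtains X where "X > q + 1" "((p + 1) / (q + 1))\<^sup>2 * X ^ 4 < 16 * p * q * (X - 1) * ((p + 1) / (q + 1) * X - 1)"
    "N < 2 + alpha p q * X"
proof -
  have pos: "p > 0" "q > 0" using qp by auto
  define m where "m = (p + 1) / (q + 1)"
  have m: "m \<ge> 1" "m * (q + 1) = p + 1" using pos qp by (auto simp: m_def)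
  define D where "D = (\<lambda>X. m\<^sup>2 * X ^ 4 - 16 * p * q * (X - 1) * (m * X - 1))"
  have G: "poly (G_poly p q) (X / 2) * (16 * m\<^sup>2) = D X" for X
    using poly_G_poly[OF pos] by (simp add: m_def D_def)
  have m2: "16 * m\<^sup>2 > 0" using m by simp
  have D1: "D (q + 1) < 0"
  proof -
    have "m\<^sup>2 * (q + 1) ^ 4 = ((m * (q + 1)) * (q + 1))\<^sup>2" by (simp add: power_mult_distrib power4_eq_xxxx power2_eq_square)
    also have "\<dots> < (4 * p * q)\<^sup>2"
      unfolding m(2) using product_gt_1(2)[OF qp] pos by (intro power_strict_mono) auto
    also have "\<dots> = 16 * p * q * (q + 1 - 1) * (m * (q + 1) - 1)" unfolding m(2) by (simp add: power2_eq_square)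
    finally show ?thesis by (simp add: D_def)
  qed
  have zq: "2 * z > q + 1"
  proof -
    (* A point at which the quartic term of D dominates. *)
    define b where "b = q + 1 + 16 * p * q"
    have b: "b > q + 1" "b \<ge> 1" "b > 16 * p * q" using pos by (auto simp: b_def)
    have "16 * p * q * (b - 1) * (m * b - 1) \<le> b * (b * (m * b))"
    proof -
      have "1 * 1 \<le> m * b" using m(1) b(2) by (intro mult_mono) auto
      then have "(16 * p * q) * ((b - 1) * (m * b - 1)) \<le> b * (b * (m * b))"
        using b pos by (intro mult_mono) auto
      then show ?thesis by (simp only: mult_ac)
    qed
    also have "\<dots> < m\<^sup>2 * b ^ 4"
    proof -
      have "1 * 1 < m * b" using m(1) b(1) pos by (intro mult_le_less_imp_less) auto
      then have "(b * (b * (m * b))) * 1 < (b * (b * (m * b))) * (m * b)"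
        using b m by (intro mult_strict_left_mono mult_pos_pos) auto
      then show ?thesis by (simp add: power2_eq_square power4_eq_xxxx mult_ac)
    qed
    finally have "D b > 0" by (simp add: D_def)
    then have "poly (G_poly p q) (b / 2) > 0" using G[of b] m2 by (metis zero_less_mult_pos2)
    moreover have "poly (G_poly p q) ((q + 1) / 2) < 0" using G[of "q + 1"] D1 m2 by (metis mult_less_0_iff not_less_iff_gr_or_eq)
    ultimately obtain x where x: "x > (q + 1) / 2" "poly (G_poly p q) x = 0"
      using poly_IVT_pos[of "(q + 1) / 2" "b / 2" "G_poly p q"] b by auto
    then show ?thesis using z(2)[OF x(2)] x(1) by simp
  qed
  have Dz: "D (2 * z) = 0" using G[of "2 * z"] z(1) by simp
  have fy: "D X < 0 \<longleftrightarrow> 1 < (16 * p * q / m\<^sup>2) * ((1 / X)\<^sup>2 * (1 - 1 / X) * (m - 1 / X))"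
           "D X = 0 \<longleftrightarrow> 1 = (16 * p * q / m\<^sup>2) * ((1 / X)\<^sup>2 * (1 - 1 / X) * (m - 1 / X))" if "X > 0" for X
  proof -
    have "(16 * p * q / m\<^sup>2) * ((1 / X)\<^sup>2 * (1 - 1 / X) * (m - 1 / X)) = 16 * p * q * (X - 1) * (m * X - 1) / (m\<^sup>2 * X ^ 4)"
      using that m(1) by (simp add: field_simps power2_eq_square power4_eq_xxxx)
    moreover have "m\<^sup>2 * X ^ 4 > 0" using that m(1) by simp
    ultimately show "D X < 0 \<longleftrightarrow> 1 < (16 * p * q / m\<^sup>2) * ((1 / X)\<^sup>2 * (1 - 1 / X) * (m - 1 / X))"
           "D X = 0 \<longleftrightarrow> 1 = (16 * p * q / m\<^sup>2) * ((1 / X)\<^sup>2 * (1 - 1 / X) * (m - 1 / X))"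
      by (simp_all only: D_def less_divide_eq_1 eq_divide_eq_1) auto
  qed
  have between: "D X < 0" if X: "q + 1 < X" "X < 2 * z" for X
  proof -
    have "1 < (16 * p * q / m\<^sup>2) * ((1 / X)\<^sup>2 * (1 - 1 / X) * (m - 1 / X))"
    proof (rule log_concave_between[OF m(1), of "1 / (2 * z)" _ "1 / (q + 1)"])
      show "0 < 1 / (2 * z)" "1 / (2 * z) < 1 / X" "1 / X < 1 / (q + 1)" "1 / (q + 1) < 1"
        using X pos by (auto intro!: divide_strict_left_mono simp: divide_less_eq)
      show "0 < 16 * p * q / m\<^sup>2" using pos m(1) by simp
      show "1 \<le> (16 * p * q / m\<^sup>2) * ((1 / (2 * z))\<^sup>2 * (1 - 1 / (2 * z)) * (m - 1 / (2 * z)))"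
        by (rule eq_refl, rule iffD1[OF fy(2) Dz]) (use zq pos in simp)
      show "1 < (16 * p * q / m\<^sup>2) * ((1 / (q + 1))\<^sup>2 * (1 - 1 / (q + 1)) * (m - 1 / (q + 1)))"
        by (rule iffD1[OF fy(1) D1]) (use pos in simp)
    qed
    then show ?thesis by (rule iffD2[OF fy(1), rotated]) (use X pos in simp)
  qed
  have \<alpha>: "alpha p q > 0" using product_gt_1(1)[OF qp] pos by (simp add: alpha_def)
  define B where "B = (N - 2) / alpha p q"
  have "B < 2 * z" using N \<alpha> by (simp add: B_def divide_less_eq mult_ac)
  then obtain X where X: "q + 1 < X" "X < 2 * z" "B < X"
    using dense[of "max (q + 1) B" "2 * z"] zq by auto
  show ?thesis
  proof (rule that[OF X(1)])
    show "((p + 1) / (q + 1))\<^sup>2 * X ^ 4 < 16 * p * q * (X - 1) * ((p + 1) / (q + 1) * X - 1)"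
      using between[OF X(1,2)] by (simp add: D_def m_def)
    show "N < 2 + alpha p q * X" using X(3) \<alpha> by (simp add: B_def divide_less_eq mult_ac)
  qed
qed

section \<open>Nonexistence of stable positive solutions\<close>

lemma stable_lane_emdenI:
  fixes u v :: "'a::euclidean_space \<Rightarrow> real"
  assumes pq: "p > 0" "q > 0" "p * q > 1" "q \<le> p"
    and sol: "positive_solution p q u v"
    and st: "\<And>\<Omega>. open \<Omega> \<Longrightarrow> bounded \<Omega> \<Longrightarrow> stable_in p q u v \<Omega>"
  shows "stable_lane_emden p q u v (\<lambda>i. partial_deriv i u) (\<lambda>i. partial_deriv i (partial_deriv i u))
    (\<lambda>i. partial_deriv i v) (\<lambda>i. partial_deriv i (partial_deriv i v))"
proof -
  have C2: "C2_on UNIV u" "C2_on UNIV v" and pos: "\<And>x. u x > 0" "\<And>x. v x > 0"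
    and eq: "\<And>x. - laplacian u x = \<bar>v x\<bar> powr (p - 1) * v x" "\<And>x. - laplacian v x = \<bar>u x\<bar> powr (q - 1) * u x"
    using sol unfolding positive_solution_def by auto
  have pw: "\<bar>a\<bar> powr (r - 1) * a = a powr r" if "a > 0" for a r :: real
    using powr_add[of a "r - 1" 1] that by simp
  note C = C2_fun_if_C2_on[OF C2(1)] C2_fun_if_C2_on[OF C2(2)]
  show ?thesis
  proof unfold_locales
    fix R :: real and f :: "'a \<Rightarrow> real" and f1
    assume R: "R > 0" and f: "continuous_on UNIV f" "\<And>i. i \<in> Basis \<Longrightarrow> continuous_on UNIV (f1 i)"
      "\<And>i x. i \<in> Basis \<Longrightarrow> has_slope i f (f1 i x) x" "\<And>x. bump 0 R x = 0 \<Longrightarrow> f x = 0"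
    obtain r where r: "cube (0::'a) R \<subseteq> ball 0 r"
      using bounded_subset_ballD[OF compact_imp_bounded[OF compact_cube]] by metis
    show "sqrt (p * q) * integral (cube 0 R) (\<lambda>x. u x powr ((q - 1) / 2) * v x powr ((p - 1) / 2) * (f x)\<^sup>2)
      \<le> integral (cube 0 R) (\<lambda>x. \<Sum>i\<in>Basis. (f1 i x)\<^sup>2)"
      by (rule stable_in_inequality[OF st[of "ball 0 r"] pq(1,2) C2_funD(1)[OF C(1)] C2_funD(1)[OF C(2)] pos _ r R f]) simp_all
  qed (use pq C pos eq pw in \<open>auto simp: laplacian_def\<close>)
qed

theorem theorem1p8:
  fixes p q z\<^sub>0 :: real
  assumes "p \<ge> q" and "q > 1 / 3" and "p > (q + 1) / (3 * q - 1)"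
    and "poly (G_poly p q) z\<^sub>0 = 0"
    and "\<forall>x. poly (G_poly p q) x = 0 \<longrightarrow> x \<le> z\<^sub>0"
    and "real CARD('n) < 2 * alpha p q * z\<^sub>0 + 2"
  shows "\<not> (\<exists>u v :: real ^ 'n::finite \<Rightarrow> real.
            positive_solution p q u v \<and>
            (\<forall>\<Omega>. open \<Omega> \<and> bounded \<Omega> \<longrightarrow> stable_in p q u v \<Omega>))"
proof
  assume "\<exists>u v :: real ^ 'n::finite \<Rightarrow> real.
            positive_solution p q u v \<and>
            (\<forall>\<Omega>. open \<Omega> \<and> bounded \<Omega> \<longrightarrow> stable_in p q u v \<Omega>)"
  then obtain u v :: "real ^ 'n \<Rightarrow> real" where sol: "positive_solution p q u v"
    and st: "\<And>\<Omega>. open \<Omega> \<Longrightarrow> bounded \<Omega> \<Longrightarrow> stable_in p q u v \<Omega>"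
    by blast
  have pq: "p > 0" "q > 0" "p * q > 1" using assms(1,2) product_gt_1[OF assms(1-3)] by auto
  interpret stable_lane_emden p q u v "\<lambda>i. partial_deriv i u" "\<lambda>i. partial_deriv i (partial_deriv i u)"
    "\<lambda>i. partial_deriv i v" "\<lambda>i. partial_deriv i (partial_deriv i v)"
    by (rule stable_lane_emdenI[OF pq assms(1) sol st])
  obtain X where X: "X > q + 1"
    "((p + 1) / (q + 1))\<^sup>2 * X ^ 4 < 16 * p * q * (X - 1) * ((p + 1) / (q + 1) * X - 1)"
    "real CARD('n) < 2 + alpha p q * X"
    using admissible_exponent[OF assms(1-4) _ assms(6)] assms(5) by metis
  have "2 + alpha p q * X \<le> real DIM(real ^ 'n)" by (rule dimension_bound[OF X(1,2)])
  then show False using X(3) by simp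
qed

end
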